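(* Let $\sigma=\{\sigma_i\mid i\in I\}$ be a partition of the set $\mathbb{P}$ of all primes, let $G$ be a finite $\sigma$-soluble group, and let $n\ge 0$ be an integer with $|\sigma(G)|=n$. Assume that every $(n+1)$-maximal subgroup of $G$ is $\sigma$-subnormal in $G$. Then $G$ is $\sigma$-dispersive.
   Context: All groups are finite. $\mathbb{P}$ is the set of all primes, and $\sigma=\{\sigma_i\mid i\in I\}$ is a partition of $\mathbb{P}$, i.e. $\mathbb{P}=\bigcup_{i\in I}\sigma_i$ and $\sigma_i\cap\sigma_j=\emptyset$ for all $i\ne j$. For a finite group $G$, $\pi(G)$ denotes the set of primes dividing $|G|$, and $\sigma(G)=\{\sigma_i\mid \sigma_i\cap\pi(G)\neq\emptyset\}$. A finite group $X$ is $\sigma$-primary if $X=1$ or $|\sigma(X)|=1$. $G$ is $\sigma$-soluble if every chief factor of $G$ is $\sigma$-primary. A Hall $\sigma_i$-subgroup of $G$ is a subgroup $H$ such that every prime dividing $|H|$ lies in $\sigma_i$ and no prime dividing $|G:H|$ lies in $\sigma_i$. A set $\mathcal{H}$ of subgroups of $G$ is a complete Hall $\sigma$-set of $G$ if every non-identity member of $\mathcal{H}$ is a Hall $\sigma_i$-subgroup of $G$ for some $\sigma_i\in\sigma(G)$, and $\mathcal{H}$ contains exactly one Hall $\sigma_i$-subgroup of $G$ for every $\sigma_i\in\sigma(G)$. $G$ is a $\sigma$-group if it possesses a complete Hall $\sigma$-set. A $\sigma$-group $G$ is $\sigma$-dispersive if $G$ has a normal series $1=G_1<G_2<\cdots<G_t<G_{t+1}=G$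 (each $G_i$ normal in $G$) and a complete Hall $\sigma$-set $\{H_1,\ldots,H_t\}$ such that $G_iH_i=G_{i+1}$ for all $i=1,\ldots,t$. For $k\geq 1$, a subgroup $M_k$ of $G$ is a $k$-maximal subgroup of $G$ if there is a subgroup chain $M_k<M_{k-1}<\cdots<M_1<M_0=G$ such that $M_i$ is a maximal subgroup of $M_{i-1}$ for all $i=1,\ldots,k$. A subgroup $A$ of $G$ is $\sigma$-subnormal in $G$ if there is a subgroup chain $A=A_0\le A_1\le\cdots\le A_t=G$ such that for each $i=1,\ldots,t$ either $A_{i-1}$ is normal in $A_i$ or $A_i/(A_{i-1})_{A_i}$ is $\sigma$-primary, where $(A_{i-1})_{A_i}$ denotes the core of $A_{i-1}$ in $A_i$, i.e. the largest normal subgroup of $A_i$ contained in $A_{i-1}$. *)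

theory Defs
  imports
    "HOL-Algebra.Coset"
    "HOL-Computational_Algebra.Primes"
    "HOL-Library.Disjoint_Sets"
begin

text \<open>
  Throughout, a partition \<open>\<sigma>\<close> of the primes is the set of its classes. As only the
  two stated conditions are required, the empty set may occur as a class; it never
  meets the prime divisors of a group.
\<close>

definition prime_partition :: "nat set set \<Rightarrow> bool" where
  "prime_partition \<sigma> \<longleftrightarrow> \<Union>\<sigma> = {p. prime p} \<and> disjoint \<sigma>"

definition prime_divs :: "('a, 'b) monoid_scheme \<Rightarrow> nat set" where
  "prime_divs G = {p. prime p \<and> p dvd order G}"

definition sigma_classes :: "nat set set \<Rightarrow> ('a, 'b) monoid_scheme \<Rightarrow> nat set set" where
  "sigma_classes \<sigma> G = {s \<in> \<sigma>. s \<inter> prime_divs G \<noteq> {}}"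

definition sigma_primary :: "nat set set \<Rightarrow> ('a, 'b) monoid_scheme \<Rightarrow> bool" where
  "sigma_primary \<sigma> X \<longleftrightarrow> carrier X = {\<one>\<^bsub>X\<^esub>} \<or> card (sigma_classes \<sigma> X) = 1"

text \<open>\<open>H/K\<close> is a chief factor: no normal subgroup of \<open>G\<close> lies strictly between \<open>K\<close> and \<open>H\<close>.\<close>

definition chief_factor :: "('a, 'b) monoid_scheme \<Rightarrow> 'a set \<Rightarrow> 'a set \<Rightarrow> bool" where
  "chief_factor G H K \<longleftrightarrow> H \<lhd> G \<and> K \<lhd> G \<and> K \<subset> H \<and>
     \<not> (\<exists>L. L \<lhd> G \<and> K \<subset> L \<and> L \<subset> H)"

definition sigma_soluble :: "nat set set \<Rightarrow> ('a, 'b) monoid_scheme \<Rightarrow> bool" where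
  "sigma_soluble \<sigma> G \<longleftrightarrow>
     (\<forall>H K. chief_factor G H K \<longrightarrow> sigma_primary \<sigma> ((G\<lparr>carrier := H\<rparr>) Mod K))"

definition hall_subgroup :: "nat set \<Rightarrow> 'a set \<Rightarrow> ('a, 'b) monoid_scheme \<Rightarrow> bool" where
  "hall_subgroup s H G \<longleftrightarrow> subgroup H G \<and>
     (\<forall>p. prime p \<and> p dvd card H \<longrightarrow> p \<in> s) \<and>
     (\<forall>p. prime p \<and> p dvd card (rcosets\<^bsub>G\<^esub> H) \<longrightarrow> p \<notin> s)"

definition complete_hall_set ::
    "nat set set \<Rightarrow> 'a set set \<Rightarrow> ('a, 'b) monoid_scheme \<Rightarrow> bool" where
  "complete_hall_set \<sigma> \<H> G \<longleftrightarrow>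
     (\<forall>H\<in>\<H>. subgroup H G) \<and>
     (\<forall>H\<in>\<H>. H \<noteq> {\<one>\<^bsub>G\<^esub>} \<longrightarrow> (\<exists>s\<in>sigma_classes \<sigma> G. hall_subgroup s H G)) \<and>
     (\<forall>s\<in>sigma_classes \<sigma> G. \<exists>!H. H \<in> \<H> \<and> hall_subgroup s H G)"

definition sigma_group :: "nat set set \<Rightarrow> ('a, 'b) monoid_scheme \<Rightarrow> bool" where
  "sigma_group \<sigma> G \<longleftrightarrow> (\<exists>\<H>. complete_hall_set \<sigma> \<H> G)"

text \<open>The terms \<open>N i\<close> and \<open>H i\<close> matter only for \<open>1 \<le> i \<le> t + 1\<close> and \<open>1 \<le> i \<le> t\<close>;
  the trivial group is the case \<open>t = 0\<close>.\<close>

definition sigma_dispersive :: "nat set set \<Rightarrow> ('a, 'b) monoid_scheme \<Rightarrow> bool" where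
  "sigma_dispersive \<sigma> G \<longleftrightarrow> sigma_group \<sigma> G \<and>
     (\<exists>(t::nat) (N :: nat \<Rightarrow> 'a set) (H :: nat \<Rightarrow> 'a set).
        N 1 = {\<one>\<^bsub>G\<^esub>} \<and> N (t + 1) = carrier G \<and>
        (\<forall>i\<in>{1..t + 1}. N i \<lhd> G) \<and>
        (\<forall>i\<in>{1..t}. N i \<subset> N (i + 1)) \<and>
        complete_hall_set \<sigma> (H ` {1..t}) G \<and>
        (\<forall>i\<in>{1..t}. N i <#>\<^bsub>G\<^esub> H i = N (i + 1)))"

definition maximal_subgroup :: "'a set \<Rightarrow> ('a, 'b) monoid_scheme \<Rightarrow> bool" where
  "maximal_subgroup M G \<longleftrightarrow> subgroup M G \<and> M \<noteq> carrier G \<and>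
     (\<forall>L. subgroup L G \<and> M \<subseteq> L \<longrightarrow> L = M \<or> L = carrier G)"

definition k_maximal :: "nat \<Rightarrow> 'a set \<Rightarrow> ('a, 'b) monoid_scheme \<Rightarrow> bool" where
  "k_maximal k A G \<longleftrightarrow> k \<ge> 1 \<and>
     (\<exists>M :: nat \<Rightarrow> 'a set. M 0 = carrier G \<and> M k = A \<and>
        (\<forall>i\<in>{1..k}. maximal_subgroup (M i) (G\<lparr>carrier := M (i - 1)\<rparr>)))"

definition normal_core :: "('a, 'b) monoid_scheme \<Rightarrow> 'a set \<Rightarrow> 'a set" where
  "normal_core G A = (GREATEST N. N \<lhd> G \<and> N \<subseteq> A)"

lemma (in group) normal_core_greatest:
  assumes A: "subgroup A G"
  shows "normal_core G A \<lhd> G" "normal_core G A \<subseteq> A"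
    and "\<And>N. N \<lhd> G \<Longrightarrow> N \<subseteq> A \<Longrightarrow> N \<subseteq> normal_core G A"
proof -
  let ?C = "{x \<in> carrier G. \<forall>g\<in>carrier G. g \<otimes> x \<otimes> inv g \<in> A}"
  have sub: "subgroup ?C G"
  proof (rule subgroupI)
    show "?C \<noteq> {}"
      using subgroup.one_closed[OF A] by (auto intro!: exI[of _ \<one>])
  next
    fix a assume a: "a \<in> ?C"
    have "g \<otimes> inv a \<otimes> inv g \<in> A" if g: "g \<in> carrier G" for g
    proof -
      have "inv (g \<otimes> a \<otimes> inv g) = g \<otimes> inv a \<otimes> inv g"
        using a g by (simp add: inv_mult_group m_assoc)
      thus ?thesis
        using a g subgroup.m_inv_closed[OF A, of "g \<otimes> a \<otimes> inv g"] by simp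
    qed
    thus "inv a \<in> ?C" using a by simp
  next
    fix a b assume a: "a \<in> ?C" and b: "b \<in> ?C"
    have "g \<otimes> (a \<otimes> b) \<otimes> inv g \<in> A" if g: "g \<in> carrier G" for g
    proof -
      have "(g \<otimes> a \<otimes> inv g) \<otimes> (g \<otimes> b \<otimes> inv g) = g \<otimes> (a \<otimes> b) \<otimes> inv g"
        using a b g by (simp add: m_assoc inv_solve_left')
      thus ?thesis
        using a b g subgroup.m_closed[OF A, of "g \<otimes> a \<otimes> inv g" "g \<otimes> b \<otimes> inv g"] by simp
    qed
    thus "a \<otimes> b \<in> ?C" using a b by simp
  qed auto
  have norm: "?C \<lhd> G"
    unfolding normal_inv_iff
  proof (intro conjI ballI sub)
    fix x h assume x: "x \<in> carrier G" and h: "h \<in> ?C"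
    have "g \<otimes> (x \<otimes> h \<otimes> inv x) \<otimes> inv g \<in> A" if g: "g \<in> carrier G" for g
    proof -
      have "g \<otimes> (x \<otimes> h \<otimes> inv x) \<otimes> inv g = (g \<otimes> x) \<otimes> h \<otimes> inv (g \<otimes> x)"
        using x h g by (simp add: m_assoc inv_mult_group)
      thus ?thesis using x h g by simp
    qed
    thus "x \<otimes> h \<otimes> inv x \<in> ?C" using x h by simp
  qed
  have le: "?C \<subseteq> A"
  proof
    fix x assume "x \<in> ?C"
    hence "x \<in> carrier G" "\<one> \<otimes> x \<otimes> inv \<one> \<in> A" by blast+
    thus "x \<in> A" by simp
  qed
  have gr: "N \<subseteq> ?C" if "N \<lhd> G" "N \<subseteq> A" for N
  proof
    fix x assume "x \<in> N"
    thus "x \<in> ?C"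
      using that normal.inv_op_closed2[OF that(1)]
        subgroup.mem_carrier[OF normal_imp_subgroup[OF that(1)]] by auto
  qed
  have eq: "normal_core G A = ?C"
    unfolding normal_core_def by (rule Greatest_equality) (use norm le gr in auto)
  show "normal_core G A \<lhd> G" "normal_core G A \<subseteq> A"
    "\<And>N. N \<lhd> G \<Longrightarrow> N \<subseteq> A \<Longrightarrow> N \<subseteq> normal_core G A"
    using norm le gr unfolding eq by blast+
qed

definition sigma_subnormal ::
    "nat set set \<Rightarrow> 'a set \<Rightarrow> ('a, 'b) monoid_scheme \<Rightarrow> bool" where
  "sigma_subnormal \<sigma> A G \<longleftrightarrow>
     (\<exists>(t::nat) (B :: nat \<Rightarrow> 'a set). B 0 = A \<and> B t = carrier G \<and>
        (\<forall>i\<le>t. subgroup (B i) G) \<and>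
        (\<forall>i\<in>{1..t}. B (i - 1) \<subseteq> B i \<and>
           (B (i - 1) \<lhd> G\<lparr>carrier := B i\<rparr> \<or>
            sigma_primary \<sigma>
              ((G\<lparr>carrier := B i\<rparr>) Mod normal_core (G\<lparr>carrier := B i\<rparr>) (B (i - 1))))))"

end

theory Submission
  imports Defs "HOL-Algebra.Sylow" "HOL-Algebra.Generated_Groups" "HOL-Algebra.Multiplicative_Group"
begin

text \<open>
  Call a group primary if its order involves primes of one class only. The hypothesis is first
  turned into a statement on depth. A \<open>\<sigma>\<close>-subnormal subgroup meets every Hall subgroup of a class in
  a Hall subgroup (\<open>hall_sigma_sub\<close>). If all \<open>(n + 1)\<close>-maximal subgroups are \<open>\<sigma>\<close>-subnormal,
  then each \<open>n\<close>-maximal subgroup \<open>W\<close> is primary modulo the core of any of its maximal subgroups,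
  and therefore \<open>\<sigma>\<close>-nilpotent (\<open>nilpotent_hall\<close>). Both facts together show: an
  \<open>s\<close>-subgroup at the end of a maximal chain with more than \<open>n\<close> steps lies in every Hall
  \<open>s\<close>-subgroup (\<open>deep_in_hallI\<close>), hence in the largest normal \<open>s\<close>-subgroup (\<open>deep_in_core\<close>).
  This property passes to a complement of a normal Hall subgroup with \<open>n - 1\<close> in place of \<open>n\<close>,
  so a tower is obtained by induction (\<open>tower_ex\<close>) as soon as a nontrivial group with the property
  is known to have a normal Hall subgroup \<open>\<noteq> {\<one>}\<close> of some class.

  Assume that it has none, and let \<open>O \<noteq> {\<one>}\<close> be the largest normal \<open>a\<close>-subgroup for a suitable
  class \<open>a\<close>. Maximal subgroups have primary index, so a maximal chain from \<open>G\<close> to \<open>X\<close> has at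
  least as many steps as there are classes dividing \<open>|G : X|\<close> (\<open>max_chain_lower\<close>). For a Hall
  subgroup \<open>H\<close> of another class this gives \<open>n - 1\<close> steps down to \<open>O H\<close>, and chains to \<open>H\<close> have
  at most \<open>n\<close> steps. Hence \<open>H\<close> is maximal in \<open>O H\<close>, and all proper subgroups of \<open>H\<close> lie in the
  core of \<open>H\<close>. If two such cores are nontrivial, there are only two classes, and the Hall
  subgroups have orders \<open>p\<^sup>2\<close> and \<open>q\<^sup>2\<close>; the one for the larger prime is then normal
  (\<open>two_cores_contradiction\<close>). Otherwise all \<open>H\<close> have prime order, and \<open>O\<close> is an abelian
  \<open>p\<close>-group with a complement \<open>N\<close> that acts faithfully on it. The subgroup \<open>N\<close> contains a Hall
  \<open>a\<close>-subgroup \<open>L\<close> of prime order and a subgroup \<open>A\<close> of prime order normalised but not centralised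
  by \<open>L\<close>, and by maximality in \<open>O A\<close> and in \<open>O L\<close> neither fixes a nontrivial element of \<open>O\<close>.
  For the Frobenius group \<open>A L\<close> this is impossible (\<open>fixed_point_free_pair\<close>,
  \<open>single_core_contradiction\<close>).

  The Hall subgroups themselves come from the Schur-Zassenhaus theorem for abelian normal subgroups;
  chief factors that are not abelian are avoided by a Frattini argument (\<open>hall_section_ex\<close>).
\<close>

section \<open>Subgroups of a fixed finite group\<close>

text \<open>
  With \<open>\<pi>\<close> replaced by its complement this also expresses that no prime of \<open>\<pi>\<close>
  divides the number.
\<close>

definition pi_number :: "nat set \<Rightarrow> nat \<Rightarrow> bool" where
  "pi_number \<pi> m \<longleftrightarrow> (\<forall>p. prime p \<and> p dvd m \<longrightarrow> p \<in> \<pi>)"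

lemma pi_number_1 [simp]: "pi_number \<pi> (Suc 0)"
  by (auto simp: pi_number_def)

lemma pi_number_mult [simp]: "pi_number \<pi> (a * b) \<longleftrightarrow> pi_number \<pi> a \<and> pi_number \<pi> b"
  by (auto simp: pi_number_def prime_dvd_mult_iff)

lemma pi_number_dvd: "pi_number \<pi> b \<Longrightarrow> a dvd b \<Longrightarrow> pi_number \<pi> a"
  by (auto simp: pi_number_def intro: dvd_trans)

lemma pi_number_mono: "pi_number \<pi> a \<Longrightarrow> \<pi> \<subseteq> \<rho> \<Longrightarrow> pi_number \<rho> a"
  by (auto simp: pi_number_def)

lemma pi_number_disjoint_coprime:
  assumes "pi_number \<pi> a" "pi_number \<rho> b" "\<pi> \<inter> \<rho> = {}"
  shows "coprime a b"
proof (rule ccontr)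
  assume "\<not> coprime a b"
  then obtain p where "prime p" "p dvd gcd a b"
    by (metis coprime_iff_gcd_eq_1 prime_factor_nat)
  with assms show False by (auto simp: pi_number_def)
qed

lemma pi_number_coprime: "pi_number \<pi> a \<Longrightarrow> pi_number (- \<pi>) b \<Longrightarrow> coprime a b"
  by (rule pi_number_disjoint_coprime) auto

lemma pi_number_compl_eq_1: "pi_number \<pi> a \<Longrightarrow> pi_number (- \<pi>) a \<Longrightarrow> a = 1"
  using pi_number_coprime[of \<pi> a a] by simp

lemma pi_number_prime_power: "prime p \<Longrightarrow> pi_number {p} (p ^ k)"
  by (auto simp: pi_number_def dest: prime_dvd_power primes_dvd_imp_eq)

locale fin_group = group G for G (structure) +
  assumes fin: "finite (carrier G)"
begin

lemma finite_subgroup [simp]: "subgroup X G \<Longrightarrow> finite X"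
  using fin finite_subset subgroup.subset by blast

lemma card_subgroup_pos [simp]: "subgroup X G \<Longrightarrow> 0 < card X"
  using fin subgroup.finite_imp_card_positive by blast

lemma subgroup_nonempty [simp]: "subgroup X G \<Longrightarrow> X \<noteq> {}"
  using subgroup.one_closed by blast

lemma subgroup_carrier: "subgroup X G \<Longrightarrow> x \<in> X \<Longrightarrow> x \<in> carrier G"
  by (rule subgroup.mem_carrier)

lemma cancel_inv [simp]:
  "a \<in> carrier G \<Longrightarrow> b \<in> carrier G \<Longrightarrow> inv a \<otimes> (a \<otimes> b) = b"
  "a \<in> carrier G \<Longrightarrow> b \<in> carrier G \<Longrightarrow> a \<otimes> (inv a \<otimes> b) = b"
  by (simp_all add: m_assoc[symmetric])

text \<open>
  Together with \<open>cancel_inv\<close> these rewrite a product of group elements and inverses to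
  its reduced right-nested form, and so decide equations in the free group.
\<close>

lemmas word = m_assoc inv_mult_group

text \<open>
  Every group in the proof is a subgroup of one fixed finite group, given by its carrier set.
  Sections \<open>Y/K\<close> are then pairs of sets, and an induction may pass to subgroups and to
  quotients without changing the type of the elements.
\<close>

definition normal_in :: "'a set \<Rightarrow> 'a set \<Rightarrow> bool" where
  "normal_in K Y \<longleftrightarrow> subgroup K G \<and> subgroup Y G \<and> K \<subseteq> Y \<and>
     (\<forall>y\<in>Y. \<forall>k\<in>K. y \<otimes> k \<otimes> inv y \<in> K)"

definition index :: "'a set \<Rightarrow> 'a set \<Rightarrow> nat" where
  "index Y X = card Y div card X"

lemma normal_inD:
  assumes "normal_in K Y"
  shows "subgroup K G" "subgroup Y G" "K \<subseteq> Y"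
    and "\<And>y k. y \<in> Y \<Longrightarrow> k \<in> K \<Longrightarrow> y \<otimes> k \<otimes> inv y \<in> K"
  using assms by (auto simp: normal_in_def)

lemma normal_in_inv:
  assumes "normal_in K Y" "y \<in> Y" "k \<in> K" shows "inv y \<otimes> k \<otimes> y \<in> K"
proof -
  have "inv y \<in> Y" using subgroup.m_inv_closed[OF normal_inD(2)[OF assms(1)] assms(2)] .
  then have "inv y \<otimes> k \<otimes> inv (inv y) \<in> K" using normal_inD(4)[OF assms(1)] assms(3) by blast
  moreover have "y \<in> carrier G" using subgroup_carrier[OF normal_inD(2)[OF assms(1)] assms(2)] .
  ultimately show ?thesis by simp
qed

lemma normal_in_refl: "subgroup Y G \<Longrightarrow> normal_in Y Y"
  by (auto simp: normal_in_def subgroup.m_closed subgroup.m_inv_closed)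

lemma normal_in_one: "subgroup Y G \<Longrightarrow> normal_in {\<one>} Y"
  by (auto simp: normal_in_def triv_subgroup subgroup.one_closed subgroup_carrier)

lemma normal_in_mono: "normal_in K Y \<Longrightarrow> subgroup X G \<Longrightarrow> K \<subseteq> X \<Longrightarrow> X \<subseteq> Y \<Longrightarrow> normal_in K X"
  unfolding normal_in_def by blast

lemma normal_in_Int: "normal_in K Y \<Longrightarrow> normal_in L Y \<Longrightarrow> normal_in (K \<inter> L) Y"
  unfolding normal_in_def by (auto intro: subgroups_Inter_pair)

lemma normal_in_Int_sub: "normal_in K Y \<Longrightarrow> subgroup X G \<Longrightarrow> X \<subseteq> Y \<Longrightarrow> normal_in (K \<inter> X) X"
  unfolding normal_in_def
  by (simp add: subgroups_Inter_pair subgroup.m_closed subgroup.m_inv_closed subset_iff)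

lemma normal_in_carrier_iff: "normal_in K (carrier G) \<longleftrightarrow> K \<lhd> G"
  unfolding normal_in_def normal_inv_iff using subgroup.subset subgroup_self by blast

lemma normal_in_iff_normal: "normal_in K Y \<longleftrightarrow> subgroup Y G \<and> K \<lhd> G\<lparr>carrier := Y\<rparr>"
proof (cases "subgroup Y G")
  case True
  interpret Y: group "G\<lparr>carrier := Y\<rparr>" using True by (rule subgroup_imp_group)
  have "K \<subseteq> Y" if "subgroup K (G\<lparr>carrier := Y\<rparr>)"
    using subgroup.subset[OF that] by simp
  then have 1: "subgroup K (G\<lparr>carrier := Y\<rparr>) \<longleftrightarrow> subgroup K G \<and> K \<subseteq> Y"
    using True incl_subgroup subgroup_incl by blast
  have 2: "inv\<^bsub>G\<lparr>carrier := Y\<rparr>\<^esub> y = inv y" if "y \<in> Y" for y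
    using m_inv_consistent[OF True that] .
  show ?thesis
    unfolding normal_in_def Y.normal_inv_iff 1 using True 2 by simp
qed (simp add: normal_in_def)

lemma card_dvd:
  assumes "subgroup X G" "subgroup Y G" "X \<subseteq> Y" shows "card X dvd card Y"
proof -
  interpret Y: group "G\<lparr>carrier := Y\<rparr>" using assms(2) by (rule subgroup_imp_group)
  have "subgroup X (G\<lparr>carrier := Y\<rparr>)" using assms subgroup_incl by blast
  from Y.lagrange[OF this] show ?thesis by (metis dvd_triv_right order_def partial_object.simps(1)
        partial_object.surjective partial_object.update_convs(1))
qed

lemma index_card:
  assumes "subgroup X G" "subgroup Y G" "X \<subseteq> Y" shows "index Y X * card X = card Y"
  using card_dvd[OF assms] by (simp add: index_def)

lemma index_pos:
  assumes "subgroup X G" "subgroup Y G" "X \<subseteq> Y" shows "0 < index Y X"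
  using index_card[OF assms] card_subgroup_pos[OF assms(2)] by (cases "index Y X = 0") auto

lemma index_one [simp]: "index Y {\<one>} = card Y"
  by (simp add: index_def)

lemma index_self [simp]: "subgroup Y G \<Longrightarrow> index Y Y = 1"
  using card_subgroup_pos[of Y] by (metis index_def div_self less_irrefl)

lemma index_eq_1:
  assumes "subgroup X G" "subgroup Y G" "X \<subseteq> Y" "index Y X = 1" shows "X = Y"
  using index_card[OF assms(1-3)] assms by (simp add: card_subset_eq)

lemma index_mult:
  assumes "subgroup X G" "subgroup Z G" "subgroup Y G" "X \<subseteq> Z" "Z \<subseteq> Y"
  shows "index Y X = index Y Z * index Z X"
proof -
  have "index Y X * card X = index Y Z * index Z X * card X"
    using index_card[of X Y] index_card[of X Z] index_card[of Z Y] assms by (simp add: mult.assoc)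
  then show ?thesis using card_subgroup_pos[OF assms(1)] by simp
qed

lemma index_dvd_card:
  assumes "subgroup X G" "subgroup Y G" "X \<subseteq> Y" shows "index Y X dvd card Y"
  using index_card[OF assms] by (metis dvd_triv_left)

lemma subgroup_Int [simp]: "subgroup X G \<Longrightarrow> subgroup Y G \<Longrightarrow> subgroup (X \<inter> Y) G"
  by (rule subgroups_Inter_pair)

lemma set_multI: "x \<in> X \<Longrightarrow> z \<in> Z \<Longrightarrow> x \<otimes> z \<in> X <#> Z"
  by (auto simp: set_mult_def)

lemma set_multE: "x \<in> A <#> B \<Longrightarrow> \<exists>a b. a \<in> A \<and> b \<in> B \<and> x = a \<otimes> b"
  by (auto simp: set_mult_def)

text \<open>
  The fibre of the multiplication map over \<open>x \<otimes> z\<close>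
  consists of the pairs \<open>(x \<otimes> d, inv d \<otimes> z)\<close> with \<open>d\<close> in the intersection.
\<close>

lemma card_set_mult:
  assumes X: "subgroup X G" and Z: "subgroup Z G"
  shows "card (X <#> Z) * card (X \<inter> Z) = card X * card Z"
proof -
  let ?f = "\<lambda>(x, z). x \<otimes> z"
  have im: "X <#> Z = ?f ` (X \<times> Z)" by (auto simp: set_mult_def)
  have fib: "card {v \<in> X \<times> Z. ?f v = w} = card (X \<inter> Z)" if w: "w \<in> X <#> Z" for w
  proof -
    obtain x z where xz: "x \<in> X" "z \<in> Z" "w = x \<otimes> z" using w by (auto simp: set_mult_def)
    have cX: "a \<in> carrier G" if "a \<in> X" for a using that X subgroup_carrier by auto
    have cZ: "a \<in> carrier G" if "a \<in> Z" for a using that Z subgroup_carrier by auto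
    have "{v \<in> X \<times> Z. ?f v = w} = (\<lambda>d. (x \<otimes> d, inv d \<otimes> z)) ` (X \<inter> Z)"
    proof
      show "(\<lambda>d. (x \<otimes> d, inv d \<otimes> z)) ` (X \<inter> Z) \<subseteq> {v \<in> X \<times> Z. ?f v = w}"
        using xz X Z cX cZ by (auto simp: m_assoc subgroup.m_closed subgroup.m_inv_closed)
      show "{v \<in> X \<times> Z. ?f v = w} \<subseteq> (\<lambda>d. (x \<otimes> d, inv d \<otimes> z)) ` (X \<inter> Z)"
      proof
        fix v assume "v \<in> {v \<in> X \<times> Z. ?f v = w}"
        then obtain a b where v: "v = (a, b)" "a \<in> X" "b \<in> Z" "a \<otimes> b = x \<otimes> z" using xz by auto
        note c = cX[OF xz(1)] cZ[OF xz(2)] cX[OF v(2)] cZ[OF v(3)]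
        define d where "d = inv x \<otimes> a"
        have "d = inv x \<otimes> (a \<otimes> b) \<otimes> inv b" unfolding d_def using c by (simp add: m_assoc)
        then have d: "d = z \<otimes> inv b" unfolding v(4) using c by (simp add: m_assoc)
        have "d \<in> X"
          unfolding d_def using v xz X by (simp add: subgroup.m_closed subgroup.m_inv_closed)
        moreover have "d \<in> Z"
          unfolding d using v xz Z by (simp add: subgroup.m_closed subgroup.m_inv_closed)
        moreover have "x \<otimes> d = a" unfolding d_def using c by simp
        moreover have "inv d \<otimes> z = b" unfolding d using c by (simp add: word)
        ultimately show "v \<in> (\<lambda>d. (x \<otimes> d, inv d \<otimes> z)) ` (X \<inter> Z)" using v(1) by force
      qed
    qed
    moreover have "inj_on (\<lambda>d. (x \<otimes> d, inv d \<otimes> z)) (X \<inter> Z)"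
      using cX[OF xz(1)] cX by (auto simp: inj_on_def)
    ultimately show ?thesis by (simp add: card_image)
  qed
  have fX: "finite X" "finite Z" using X Z by auto
  have "card (X \<times> Z) = (\<Sum>w\<in>X <#> Z. card {v \<in> X \<times> Z. ?f v = w})"
    unfolding im card_eq_sum by (rule sum.image_gen) (use fX in simp)
  also have "\<dots> = card (X <#> Z) * card (X \<inter> Z)" using fib by simp
  finally show ?thesis by (simp add: card_cartesian_product)
qed

lemma set_mult_subgroup:
  assumes N: "normal_in N Y" and X: "subgroup X G" "X \<subseteq> Y"
  shows "subgroup (N <#> X) G" "N <#> X \<subseteq> Y" "N \<subseteq> N <#> X" "X \<subseteq> N <#> X"
proof -
  note n = normal_inD[OF N]
  have c: "x \<in> carrier G" if "x \<in> N \<or> x \<in> X \<or> x \<in> Y" for x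
    using that n X subgroup_carrier by blast
  show "subgroup (N <#> X) G"
  proof (rule subgroupI)
    show "N <#> X \<subseteq> carrier G" using n X by (simp add: setmult_subset_G subgroup.subset)
    show "N <#> X \<noteq> {}" using n X subgroup.one_closed by (fastforce simp: set_mult_def)
  next
    fix a assume "a \<in> N <#> X"
    then obtain k x where k: "k \<in> N" "x \<in> X" "a = k \<otimes> x" by (auto simp: set_mult_def)
    have "inv a = (inv x \<otimes> inv k \<otimes> inv (inv x)) \<otimes> inv x"
      using k c by (simp add: inv_mult_group m_assoc)
    moreover have "inv x \<in> X" "inv k \<in> N" using k X n by (auto intro: subgroup.m_inv_closed)
    ultimately show "inv a \<in> N <#> X" using n(4) X(2) by (auto simp: intro!: set_multI)
  next
    fix a b assume "a \<in> N <#> X" "b \<in> N <#> X"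
    then obtain k x l z where k: "k \<in> N" "x \<in> X" "a = k \<otimes> x" "l \<in> N" "z \<in> X" "b = l \<otimes> z"
      by (auto simp: set_mult_def)
    have "a \<otimes> b = (k \<otimes> (x \<otimes> l \<otimes> inv x)) \<otimes> (x \<otimes> z)"
      using k c by (simp add: m_assoc)
    moreover have "x \<otimes> l \<otimes> inv x \<in> N" using n(4) k X by blast
    ultimately show "a \<otimes> b \<in> N <#> X" using k n(1) X
      by (auto intro!: set_multI intro: subgroup.m_closed)
  qed
  show "N <#> X \<subseteq> Y" using n X by (auto simp: set_mult_def intro: subgroup.m_closed)
  show "N \<subseteq> N <#> X"
  proof
    fix k assume k: "k \<in> N"
    then have "k \<otimes> \<one> \<in> N <#> X" using X by (intro set_multI) (auto simp: subgroup.one_closed)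
    then show "k \<in> N <#> X" using k c by simp
  qed
  show "X \<subseteq> N <#> X"
  proof
    fix k assume k: "k \<in> X"
    then have "\<one> \<otimes> k \<in> N <#> X" using n by (intro set_multI) (auto simp: subgroup.one_closed)
    then show "k \<in> N <#> X" using k c by simp
  qed
qed

lemma set_mult_least: "subgroup Z G \<Longrightarrow> N \<subseteq> Z \<Longrightarrow> X \<subseteq> Z \<Longrightarrow> N <#> X \<subseteq> Z"
  by (auto simp: set_mult_def intro: subgroup.m_closed)

lemma set_mult_normal:
  assumes N: "normal_in N Y" and X: "normal_in X Y"
  shows "normal_in (N <#> X) Y"
proof -
  note n = normal_inD[OF N] and x = normal_inD[OF X]
  have "y \<otimes> k \<otimes> inv y \<in> N <#> X" if y: "y \<in> Y" and k: "k \<in> N <#> X" for y k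
  proof -
    obtain a b where k: "k = a \<otimes> b" "a \<in> N" "b \<in> X" using k by (auto simp: set_mult_def)
    have c: "a \<in> carrier G" "b \<in> carrier G" "y \<in> carrier G"
      using n x k y subgroup_carrier by blast+
    have "y \<otimes> k \<otimes> inv y = (y \<otimes> a \<otimes> inv y) \<otimes> (y \<otimes> b \<otimes> inv y)"
      using k c by (simp add: m_assoc)
    then show ?thesis using n x k y by (auto intro!: set_multI)
  qed
  then show ?thesis using set_mult_subgroup[OF N x(1,3)] n unfolding normal_in_def by blast
qed

text \<open>
  The orders of the second isomorphism theorem; both follow from \<open>card_set_mult\<close>.
\<close>

lemma index_second_iso:
  assumes N: "normal_in N Y" and X: "subgroup X G" "X \<subseteq> Y"
  shows "index (N <#> X) N = index X (N \<inter> X)" "index (N <#> X) X = index N (N \<inter> X)"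
proof -
  note n = normal_inD[OF N] and s = set_mult_subgroup[OF N X]
  have e: "card (N <#> X) * card (N \<inter> X) = card N * card X" by (rule card_set_mult[OF n(1) X(1)])
  have "index (N <#> X) N * card N * card (N \<inter> X) = index X (N \<inter> X) * card (N \<inter> X) * card N"
    using index_card[of N "N <#> X"] index_card[of "N \<inter> X" X] e n X s by (simp add: mult.commute)
  then show "index (N <#> X) N = index X (N \<inter> X)"
    using card_subgroup_pos[of N] card_subgroup_pos[of "N \<inter> X"] n X by simp
  have "index (N <#> X) X * card X * card (N \<inter> X) = index N (N \<inter> X) * card (N \<inter> X) * card X"
    using index_card[of X "N <#> X"] index_card[of "N \<inter> X" N] e n X s by (simp add: mult.commute)
  then show "index (N <#> X) X = index N (N \<inter> X)"
    using card_subgroup_pos[of X] card_subgroup_pos[of "N \<inter> X"] n X by simp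
qed

lemma index_Int_dvd:
  assumes N: "normal_in N Y" and X: "subgroup X G" "X \<subseteq> Y"
  shows "index X (N \<inter> X) dvd index Y N"
  using index_mult[of N "N <#> X" Y] index_second_iso[OF N X] set_mult_subgroup[OF N X] normal_inD[OF N] by simp

lemma index_Int_dvd':
  assumes N: "normal_in N Y" and X: "subgroup X G" "X \<subseteq> Y"
  shows "index N (N \<inter> X) dvd index Y X"
  using index_mult[of X "N <#> X" Y] index_second_iso[OF N X] set_mult_subgroup[OF N X] normal_inD[OF N] X by simp

definition conjg :: "'a \<Rightarrow> 'a set \<Rightarrow> 'a set" where
  "conjg g X = (\<lambda>x. g \<otimes> x \<otimes> inv g) ` X"

lemma conjg_mult: "g \<in> carrier G \<Longrightarrow> h \<in> carrier G \<Longrightarrow> X \<subseteq> carrier G \<Longrightarrow> conjg g (conjg h X) = conjg (g \<otimes> h) X"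
  unfolding conjg_def image_image
    by (rule image_cong) (auto simp: inv_mult_group m_assoc subset_iff)

lemma conjg_one: "X \<subseteq> carrier G \<Longrightarrow> conjg \<one> X = X"
  unfolding conjg_def by force

lemma conjg_inv: "g \<in> carrier G \<Longrightarrow> X \<subseteq> carrier G \<Longrightarrow> conjg (inv g) (conjg g X) = X"
  by (simp add: conjg_mult conjg_one)

lemma conjg_mono: "X \<subseteq> Y \<Longrightarrow> conjg g X \<subseteq> conjg g Y"
  by (auto simp: conjg_def)

lemma conjg_carrier: "g \<in> carrier G \<Longrightarrow> X \<subseteq> carrier G \<Longrightarrow> conjg g X \<subseteq> carrier G"
  by (auto simp: conjg_def)

lemma conjg_card [simp]: 
  assumes "g \<in> carrier G" "X \<subseteq> carrier G" shows "card (conjg g X) = card X"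
  unfolding conjg_def by (rule card_image, rule inj_onI) (use assms in \<open>auto simp: subset_iff\<close>)

lemma conjg_subgroup:
  assumes g: "g \<in> carrier G" and X: "subgroup X G" shows "subgroup (conjg g X) G"
proof (rule subgroupI)
  have c: "x \<in> carrier G" if "x \<in> X" for x using that X subgroup_carrier by blast
  show "conjg g X \<subseteq> carrier G" using g X conjg_carrier subgroup.subset by blast
  show "conjg g X \<noteq> {}" using X subgroup.one_closed by (fastforce simp: conjg_def)
  fix a assume "a \<in> conjg g X"
  then obtain x where x: "x \<in> X" "a = g \<otimes> x \<otimes> inv g" by (auto simp: conjg_def)
  have "inv a = g \<otimes> inv x \<otimes> inv g" using x c g by (simp add: inv_mult_group m_assoc)
  then show "inv a \<in> conjg g X" using x X by (auto simp: conjg_def subgroup.m_inv_closed)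
  fix b assume "b \<in> conjg g X"
  then obtain y where y: "y \<in> X" "b = g \<otimes> y \<otimes> inv g" by (auto simp: conjg_def)
  have "a \<otimes> b = g \<otimes> (x \<otimes> y) \<otimes> inv g" using x y c g
    by (simp add: m_assoc)
  then show "a \<otimes> b \<in> conjg g X" using x y X by (auto simp: conjg_def subgroup.m_closed)
qed

lemma conjg_subset:
  assumes "subgroup Y G" "X \<subseteq> Y" "g \<in> Y" shows "conjg g X \<subseteq> Y"
  using assms by (auto simp: conjg_def intro!: subgroup.m_closed subgroup.m_inv_closed)

lemma normal_in_iff_conjg: "normal_in K Y \<longleftrightarrow> subgroup K G \<and> subgroup Y G \<and> K \<subseteq> Y \<and> (\<forall>y\<in>Y. conjg y K \<subseteq> K)"
  unfolding normal_in_def conjg_def by auto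

lemma conjg_normal:
  assumes "normal_in K Y" "y \<in> Y" shows "conjg y K = K"
  by (rule card_subset_eq) (use assms normal_in_iff_conjg[of K Y] in \<open>auto simp: subgroup.subset subgroup_carrier\<close>)

lemma conjg_set_mult:
  assumes "g \<in> carrier G" "A \<subseteq> carrier G" "B \<subseteq> carrier G"
  shows "conjg g (A <#> B) = conjg g A <#> conjg g B"
proof -
  have e: "g \<otimes> (a \<otimes> b) \<otimes> inv g = (g \<otimes> a \<otimes> inv g) \<otimes> (g \<otimes> b \<otimes> inv g)"
    if "a \<in> A" "b \<in> B" for a b
  proof -
    have "a \<in> carrier G" "b \<in> carrier G" using that assms by auto
    then show ?thesis using assms(1) by (simp add: m_assoc)
  qed
  show ?thesis
  proof
    show "conjg g (A <#> B) \<subseteq> conjg g A <#> conjg g B"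
    proof
      fix x assume "x \<in> conjg g (A <#> B)"
      then obtain a b where "a \<in> A" "b \<in> B" "x = g \<otimes> (a \<otimes> b) \<otimes> inv g"
        by (auto simp: conjg_def set_mult_def)
      then show "x \<in> conjg g A <#> conjg g B" using e by (auto simp: conjg_def set_mult_def)
    qed
    show "conjg g A <#> conjg g B \<subseteq> conjg g (A <#> B)"
    proof
      fix x assume "x \<in> conjg g A <#> conjg g B"
      then obtain a b where ab: "a \<in> A" "b \<in> B" "x = (g \<otimes> a \<otimes> inv g) \<otimes> (g \<otimes> b \<otimes> inv g)"
        by (auto simp: conjg_def set_mult_def)
      then have "x = g \<otimes> (a \<otimes> b) \<otimes> inv g" using e by simp
      moreover have "a \<otimes> b \<in> A <#> B" using ab by (intro set_multI)
      ultimately show "x \<in> conjg g (A <#> B)" unfolding conjg_def by blast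
    qed
  qed
qed

text \<open>
  Lifts a normal series of a complement to the whole group; used when a tower of Hall subgroups
  is extended by one term at the bottom.
\<close>

lemma normal_product:
  assumes H: "normal_in H Y" and K: "H <#> K = Y" "subgroup K G" and X: "normal_in X K"
  shows "normal_in (H <#> X) Y"
proof -
  note h = normal_inD[OF H] and x = normal_inD[OF X]
  have KY: "K \<subseteq> Y"
  proof
    fix k assume k: "k \<in> K"
    then have "\<one> \<otimes> k \<in> H <#> K" using subgroup.one_closed[OF h(1)] by (intro set_multI)
    then show "k \<in> Y" using K k subgroup_carrier by simp
  qed
  have XY: "X \<subseteq> Y" using x KY by blast
  note s = set_mult_subgroup[OF H x(1) XY]
  have "conjg y (H <#> X) = H <#> X" if y: "y \<in> Y" for y
  proof -
    obtain u k where u: "u \<in> H" "k \<in> K" "y = u \<otimes> k" using set_multE[of y] y K(1) by metis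
    have cc: "u \<in> carrier G" "k \<in> carrier G" "k \<in> Y" using u h KY subgroup_carrier by blast+
    have sc: "H \<subseteq> carrier G" "X \<subseteq> carrier G" "H <#> X \<subseteq> carrier G"
      using h(1) x(1) s(1) subgroup.subset by blast+
    have "conjg y (H <#> X) = conjg u (conjg k (H <#> X))"
      unfolding u(3) using conjg_mult[OF cc(1,2) sc(3)] by simp
    also have "conjg k (H <#> X) = H <#> X"
      using conjg_set_mult[OF cc(2) sc(1,2)] conjg_normal[OF H cc(3)] conjg_normal[OF X u(2)]
      by simp
    also have "conjg u (H <#> X) = H <#> X"
      using conjg_normal[OF normal_in_refl[OF s(1)], of u] s(3) u(1) by blast
    finally show ?thesis .
  qed
  then show ?thesis using s h by (simp add: normal_in_iff_conjg)
qed

definition centralizer_in :: "'a set \<Rightarrow> 'a set \<Rightarrow> 'a set" where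
  "centralizer_in Y X = {y \<in> Y. \<forall>x\<in>X. x \<otimes> y = y \<otimes> x}"

lemma centralizer_in_subgroup:
  assumes Y: "subgroup Y G" and X: "X \<subseteq> carrier G" shows "subgroup (centralizer_in Y X) G"
proof (rule subgroupI)
  have c: "y \<in> carrier G" if "y \<in> Y" for y using that Y subgroup_carrier by blast
  show "centralizer_in Y X \<subseteq> carrier G" using c by (auto simp: centralizer_in_def)
  have "\<one> \<in> centralizer_in Y X"
    using subgroup.one_closed[OF Y] X by (auto simp: centralizer_in_def subset_iff)
  then show "centralizer_in Y X \<noteq> {}" by blast
  fix y assume y: "y \<in> centralizer_in Y X"
  have "x \<otimes> inv y = inv y \<otimes> x" if x: "x \<in> X" for x
  proof -
    have cc: "x \<in> carrier G" "y \<in> carrier G" "y \<in> Y"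
      using x y X c by (auto simp: centralizer_in_def)
    have "x \<otimes> inv y = inv y \<otimes> (y \<otimes> x) \<otimes> inv y" using cc by simp
    also have "\<dots> = inv y \<otimes> (x \<otimes> y) \<otimes> inv y" using x y by (simp add: centralizer_in_def)
    also have "\<dots> = inv y \<otimes> x" using cc by (simp add: m_assoc)
    finally show ?thesis .
  qed
  then show "inv y \<in> centralizer_in Y X"
    using y subgroup.m_inv_closed[OF Y] by (simp add: centralizer_in_def)
  fix z assume z: "z \<in> centralizer_in Y X"
  have "x \<otimes> (y \<otimes> z) = (y \<otimes> z) \<otimes> x" if x: "x \<in> X" for x
  proof -
    have cc: "x \<in> carrier G" "y \<in> carrier G" "z \<in> carrier G"
      using x y z X c by (auto simp: centralizer_in_def)
    have "x \<otimes> (y \<otimes> z) = (x \<otimes> y) \<otimes> z" using cc by (simp add: m_assoc)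
    also have "\<dots> = y \<otimes> (x \<otimes> z)" using x y cc by (simp add: centralizer_in_def m_assoc)
    also have "\<dots> = (y \<otimes> z) \<otimes> x" using x z cc by (simp add: centralizer_in_def m_assoc)
    finally show ?thesis .
  qed
  then show "y \<otimes> z \<in> centralizer_in Y X"
    using y z subgroup.m_closed[OF Y] by (simp add: centralizer_in_def)
qed

lemma centralizer_in_normal:
  assumes V: "normal_in V Y" shows "normal_in (centralizer_in Y V) Y"
proof -
  note n = normal_inD[OF V]
  have c: "y \<in> carrier G" if "y \<in> Y" for y using that n subgroup_carrier by blast
  have "y \<otimes> d \<otimes> inv y \<in> centralizer_in Y V" if y: "y \<in> Y" and d: "d \<in> centralizer_in Y V" for y d
  proof -
    have dY: "d \<in> Y" using d by (simp add: centralizer_in_def)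
    have "v \<otimes> (y \<otimes> d \<otimes> inv y) = (y \<otimes> d \<otimes> inv y) \<otimes> v" if v: "v \<in> V" for v
    proof -
      have vc: "v \<in> carrier G" using v n c by blast
      have "inv y \<otimes> v \<otimes> y \<in> V" using normal_in_inv[OF V y v] .
      then have "(inv y \<otimes> v \<otimes> y) \<otimes> d = d \<otimes> (inv y \<otimes> v \<otimes> y)"
        using d by (simp add: centralizer_in_def)
      then have "y \<otimes> ((inv y \<otimes> v \<otimes> y) \<otimes> d) \<otimes> inv y = y \<otimes> (d \<otimes> (inv y \<otimes> v \<otimes> y)) \<otimes> inv y" by simp
      then show ?thesis using c[OF y] c[OF dY] vc by (simp add: m_assoc)
    qed
    moreover have "y \<otimes> d \<otimes> inv y \<in> Y"
      using y dY by (intro subgroup.m_closed[OF n(2)] subgroup.m_inv_closed[OF n(2)])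
    ultimately show ?thesis by (simp add: centralizer_in_def)
  qed
  then show ?thesis using centralizer_in_subgroup[OF n(2) subgroup.subset[OF n(1)]] n(2)
    unfolding normal_in_def by (auto simp: centralizer_in_def)
qed

lemma index_cj:
  assumes "g \<in> Y" "subgroup Y G" "X \<subseteq> Y" shows "index Y (conjg g X) = index Y X"
proof -
  have "g \<in> carrier G" "X \<subseteq> carrier G" using assms subgroup.subset[of Y G] by blast+
  then show ?thesis by (simp add: index_def)
qed

definition normalizer_in :: "'a set \<Rightarrow> 'a set \<Rightarrow> 'a set" where
  "normalizer_in Y X = {y \<in> Y. conjg y X = X}"

lemma normalizer_in_subgroup:
  assumes Y: "subgroup Y G" and X: "X \<subseteq> carrier G" shows "subgroup (normalizer_in Y X) G"
proof (rule subgroupI)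
  show "normalizer_in Y X \<subseteq> carrier G" using subgroup.subset[OF Y] by (auto simp: normalizer_in_def)
  have "\<one> \<in> normalizer_in Y X"
    using subgroup.one_closed[OF Y] conjg_one[OF X] by (simp add: normalizer_in_def)
  then show "normalizer_in Y X \<noteq> {}" by blast
next
  fix a assume a: "a \<in> normalizer_in Y X"
  then have "a \<in> carrier G" using Y subgroup_carrier by (auto simp: normalizer_in_def)
  then have "conjg (inv a) X = X" using a X conjg_inv[of a X] by (auto simp: normalizer_in_def)
  then show "inv a \<in> normalizer_in Y X"
    using a Y by (auto simp: normalizer_in_def subgroup.m_inv_closed)
next
  fix a b assume a: "a \<in> normalizer_in Y X" and b: "b \<in> normalizer_in Y X"
  then have "a \<in> carrier G" "b \<in> carrier G"
    using Y subgroup_carrier by (auto simp: normalizer_in_def)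
  then have "conjg (a \<otimes> b) X = X" using a b X conjg_mult[of a b X] by (auto simp: normalizer_in_def)
  then show "a \<otimes> b \<in> normalizer_in Y X"
    using a b Y by (auto simp: normalizer_in_def subgroup.m_closed)
qed

lemma normalizer_in_props:
  assumes Y: "subgroup Y G" and X: "subgroup X G" "X \<subseteq> Y"
  shows "X \<subseteq> normalizer_in Y X" "normal_in X (normalizer_in Y X)" "normalizer_in Y X \<subseteq> Y"
proof -
  show "X \<subseteq> normalizer_in Y X"
    using conjg_normal[OF normal_in_refl[OF X(1)]] X by (auto simp: normalizer_in_def)
  then show "normal_in X (normalizer_in Y X)"
    using normalizer_in_subgroup[OF Y] X subgroup.subset[of X G]
    by (auto simp: normal_in_iff_conjg normalizer_in_def)
qed (auto simp: normalizer_in_def)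

lemma normal_in_of_normalizer:
  assumes Y: "subgroup Y G" and X: "subgroup X G" "X \<subseteq> Y" and "normalizer_in Y X = Y"
  shows "normal_in X Y"
  using normalizer_in_props(2)[OF assms(1-3)] assms(4) by simp

definition core_in :: "'a set \<Rightarrow> 'a set \<Rightarrow> 'a set" where
  "core_in Y X = {x \<in> Y. \<forall>y\<in>Y. y \<otimes> x \<otimes> inv y \<in> X}"

lemma core_in_props:
  assumes Y: "subgroup Y G" and X: "subgroup X G" "X \<subseteq> Y"
  shows "normal_in (core_in Y X) Y" "core_in Y X \<subseteq> X" "\<And>N. normal_in N Y \<Longrightarrow> N \<subseteq> X \<Longrightarrow> N \<subseteq> core_in Y X"
proof -
  have c: "x \<in> carrier G" if "x \<in> Y" for x using that Y subgroup_carrier by blast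
  have sub: "subgroup (core_in Y X) G"
  proof (rule subgroupI)
    show "core_in Y X \<subseteq> carrier G" using c by (auto simp: core_in_def)
    have "\<one> \<in> core_in Y X" using subgroup.one_closed[OF Y] subgroup.one_closed[OF X(1)] c
      by (auto simp: core_in_def)
    then show "core_in Y X \<noteq> {}" by blast
  next
    fix a assume a: "a \<in> core_in Y X"
    have "y \<otimes> inv a \<otimes> inv y \<in> X" if y: "y \<in> Y" for y
    proof -
      have "inv (y \<otimes> a \<otimes> inv y) = y \<otimes> inv a \<otimes> inv y"
        using a y c by (simp add: inv_mult_group m_assoc core_in_def)
      then show ?thesis
        using a y subgroup.m_inv_closed[OF X(1), of "y \<otimes> a \<otimes> inv y"] by (simp add: core_in_def)
    qed
    then show "inv a \<in> core_in Y X" using a Y by (auto simp: core_in_def subgroup.m_inv_closed)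
  next
    fix a b assume a: "a \<in> core_in Y X" and b: "b \<in> core_in Y X"
    have "y \<otimes> (a \<otimes> b) \<otimes> inv y \<in> X" if y: "y \<in> Y" for y
    proof -
      have "(y \<otimes> a \<otimes> inv y) \<otimes> (y \<otimes> b \<otimes> inv y) = y \<otimes> (a \<otimes> b) \<otimes> inv y"
        using a b y c by (simp add: m_assoc inv_solve_left' core_in_def)
      then show ?thesis using a b y subgroup.m_closed[OF X(1), of "y \<otimes> a \<otimes> inv y" "y \<otimes> b \<otimes> inv y"]
        by (simp add: core_in_def)
    qed
    then show "a \<otimes> b \<in> core_in Y X" using a b Y by (auto simp: core_in_def subgroup.m_closed)
  qed
  have "z \<otimes> a \<otimes> inv z \<in> core_in Y X" if a: "a \<in> core_in Y X" and z: "z \<in> Y" for a z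
  proof -
    have "y \<otimes> (z \<otimes> a \<otimes> inv z) \<otimes> inv y \<in> X" if y: "y \<in> Y" for y
    proof -
      have "y \<otimes> (z \<otimes> a \<otimes> inv z) \<otimes> inv y = (y \<otimes> z) \<otimes> a \<otimes> inv (y \<otimes> z)"
        using a y z c by (simp add: m_assoc inv_mult_group core_in_def)
      then show ?thesis using a y z Y by (simp add: core_in_def subgroup.m_closed)
    qed
    then show ?thesis
      using a z Y by (auto simp: core_in_def intro!: subgroup.m_closed subgroup.m_inv_closed)
  qed
  then show "normal_in (core_in Y X) Y"
    using sub Y unfolding normal_in_def by (auto simp: core_in_def)
  show "core_in Y X \<subseteq> X"
  proof
    fix x assume "x \<in> core_in Y X"
    then have "x \<in> Y" "\<one> \<otimes> x \<otimes> inv \<one> \<in> X"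
      using subgroup.one_closed[OF Y] by (auto simp: core_in_def)
    then show "x \<in> X" using c by simp
  qed
  show "N \<subseteq> core_in Y X" if "normal_in N Y" "N \<subseteq> X" for N
    using that unfolding normal_in_def core_in_def by blast
qed

section \<open>Hall subgroups and Sylow arguments\<close>

definition hall :: "nat set \<Rightarrow> 'a set \<Rightarrow> 'a set \<Rightarrow> bool" where
  "hall \<pi> H Y \<longleftrightarrow> subgroup H G \<and> subgroup Y G \<and> H \<subseteq> Y \<and>
     pi_number \<pi> (card H) \<and> pi_number (- \<pi>) (index Y H)"

lemma hallD:
  assumes "hall \<pi> H Y"
  shows "subgroup H G" "subgroup Y G" "H \<subseteq> Y" "pi_number \<pi> (card H)" "pi_number (- \<pi>) (index Y H)"
  using assms by (auto simp: hall_def)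

lemma hall_normal_Int:
  assumes N: "normal_in N Y" and H: "hall \<pi> H Y" shows "hall \<pi> (N \<inter> H) N"
proof -
  note n = normal_inD[OF N] and h = hallD[OF H]
  have "index N (N \<inter> H) dvd index Y H" using index_Int_dvd'[OF N h(1,3)] .
  moreover have "card (N \<inter> H) dvd card H" using n h by (intro card_dvd) auto
  ultimately show ?thesis using n h unfolding hall_def by (auto intro: pi_number_dvd)
qed

lemma hall_conjg:
  assumes g: "g \<in> Y" and H: "hall \<pi> H Y" shows "hall \<pi> (conjg g H) Y"
proof -
  note h = hallD[OF H]
  have c: "g \<in> carrier G" "H \<subseteq> carrier G" using g h subgroup_carrier subgroup.subset by blast+
  show ?thesis using h c conjg_subgroup[OF c(1) h(1)] conjg_subset[OF h(2,3) g] index_cj[OF g h(2,3)]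
    unfolding hall_def by simp
qed

text \<open>
  The index of \<open>N \<inter> X\<close> in \<open>X\<close> divides both \<open>|X|\<close> and \<open>|Y : N|\<close>, which are coprime.
\<close>

lemma pi_subgroup_in_normal:
  assumes N: "normal_in N Y" and i: "pi_number (- \<pi>) (index Y N)"
    and X: "subgroup X G" "X \<subseteq> Y" "pi_number \<pi> (card X)"
  shows "X \<subseteq> N"
proof -
  note n = normal_inD[OF N]
  have "index X (N \<inter> X) dvd card X" using n X by (intro index_dvd_card) auto
  moreover have "index X (N \<inter> X) dvd index Y N" using index_Int_dvd[OF N X(1,2)] .
  ultimately have "index X (N \<inter> X) = 1" using i X pi_number_dvd pi_number_compl_eq_1 by metis
  then have "N \<inter> X = X" using n X by (intro index_eq_1) auto
  then show ?thesis by blast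
qed

text \<open>
  Dual to the previous lemma: now \<open>|N : N \<inter> H|\<close> divides both \<open>|N|\<close> and \<open>|Y : H|\<close>.
\<close>

lemma normal_pi_in_hall:
  assumes N: "normal_in N Y" "pi_number \<pi> (card N)" and H: "hall \<pi> H Y"
  shows "N \<subseteq> H"
proof -
  note n = normal_inD[OF N(1)] and h = hallD[OF H]
  have "index N (N \<inter> H) dvd card N" using n h by (intro index_dvd_card) auto
  moreover have "index N (N \<inter> H) dvd index Y H" using index_Int_dvd'[OF N(1) h(1,3)] .
  ultimately have "index N (N \<inter> H) = 1" using N h pi_number_dvd pi_number_compl_eq_1 by metis
  then have "N \<inter> H = N" using n h by (intro index_eq_1) auto
  then show ?thesis by blast
qed

lemma hall_maximal:
  assumes H: "hall \<pi> H Y" and X: "subgroup X G" "X \<subseteq> Y" "H \<subseteq> X" "pi_number \<pi> (card X)"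
  shows "X = H"
proof -
  note h = hallD[OF H]
  have "index X H dvd card X" using h X by (intro index_dvd_card) auto
  moreover have "index X H dvd index Y H" using index_mult[of H X Y] h X by auto
  ultimately have "index X H = 1" using X h pi_number_dvd pi_number_compl_eq_1 by metis
  then show ?thesis using index_eq_1[of H X] h X by auto
qed

lemma hall_subgroup:
  assumes "hall \<pi> H Y" "subgroup Z G" "H \<subseteq> Z" "Z \<subseteq> Y" shows "hall \<pi> H Z"
  using assms index_mult[of H Z Y] unfolding hall_def by auto

lemma hall_trans:
  assumes "hall \<pi> H Z" "subgroup Y G" "Z \<subseteq> Y" "pi_number (- \<pi>) (index Y Z)" shows "hall \<pi> H Y"
  using assms index_mult[of H Z Y] unfolding hall_def by auto

lemma hall_card_dvd:
  assumes H: "hall \<pi> H Y" and X: "subgroup X G" "X \<subseteq> Y" "pi_number \<pi> (card X)"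
  shows "card X dvd card H"
proof -
  note h = hallD[OF H]
  have "card X dvd index Y H * card H"
    using index_card[of H Y] card_dvd[OF X(1) h(2) X(2)] h by simp
  moreover have "coprime (card X) (index Y H)" using X h pi_number_coprime by blast
  ultimately show ?thesis by (simp add: coprime_dvd_mult_right_iff)
qed

lemma hall_conjg_normal:
  assumes N: "normal_in N Y" and P: "hall \<pi> P N" and g: "g \<in> Y" shows "hall \<pi> (conjg g P) N"
proof -
  note h = hallD[OF P] and n = normal_inD[OF N]
  have gc: "g \<in> carrier G" using g n subgroup_carrier by blast
  have "conjg g P \<subseteq> N" using conjg_mono[OF h(3), of g] conjg_normal[OF N g] by blast
  moreover have "index N (conjg g P) = index N P"
    using gc h subgroup.subset[OF h(1)] by (simp add: index_def)
  ultimately show ?thesis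
    using h conjg_subgroup[OF gc h(1)] gc subgroup.subset[OF h(1)] unfolding hall_def by simp
qed

text \<open>
  A \<open>p\<close>-group \<open>R\<close> acts on the left cosets of \<open>M\<close>, and \<open>yM\<close> is a fixed point iff
  \<open>R\<close> lies in the conjugate of \<open>M\<close> by \<open>y\<close>. All other orbits have length divisible by
  \<open>p\<close>. The orbit of \<open>yM\<close> is the double coset \<open>R y M\<close>, so the count is made with double
  cosets. Sylow conjugacy and the growth of normalisers in
  \<open>p\<close>-groups are both read off from it.
\<close>

lemma double_coset_count:
  assumes p: "prime p" and R: "subgroup R G" "R \<subseteq> Y" "pi_number {p} (card R)"
    and M: "subgroup M G" "M \<subseteq> Y" and Y: "subgroup Y G"
  shows "p * card M dvd card (Y - {y \<in> Y. R \<subseteq> conjg y M})"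
proof -
  have c: "x \<in> carrier G" if "x \<in> Y" for x using that Y subgroup_carrier by blast
  define F where "F = {y \<in> Y. R \<subseteq> conjg y M}"
  define D where "D y = {r \<otimes> y \<otimes> m | r m. r \<in> R \<and> m \<in> M}" for y
  have inD: "y \<in> D y" if "y \<in> Y" for y
    unfolding D_def using subgroup.one_closed[OF R(1)] subgroup.one_closed[OF M(1)] c[OF that]
    by force
  have DY: "D y \<subseteq> Y" if "y \<in> Y" for y
    using that R M Y by (auto simp: D_def intro!: subgroup.m_closed[OF Y])
  have sub: "D y \<subseteq> D z" if yz: "y \<in> D z" "z \<in> Y" for y z
  proof
    fix x assume "x \<in> D y"
    then obtain r m where x: "x = r \<otimes> y \<otimes> m" "r \<in> R" "m \<in> M" by (auto simp: D_def)
    obtain r' m' where y: "y = r' \<otimes> z \<otimes> m'" "r' \<in> R" "m' \<in> M" using yz by (auto simp: D_def)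
    have cc: "r \<in> carrier G" "m \<in> carrier G" "r' \<in> carrier G" "m' \<in> carrier G" "z \<in> carrier G"
      using x y yz c R M by blast+
    have "x = (r \<otimes> r') \<otimes> z \<otimes> (m' \<otimes> m)" using x y cc by (simp add: m_assoc)
    moreover have "r \<otimes> r' \<in> R" "m' \<otimes> m \<in> M"
      using x y subgroup.m_closed[OF R(1)] subgroup.m_closed[OF M(1)] by auto
    ultimately show "x \<in> D z" unfolding D_def by blast
  qed
  have sym: "z \<in> D y" if yz: "y \<in> D z" "z \<in> Y" for y z
  proof -
    obtain r m where y: "y = r \<otimes> z \<otimes> m" "r \<in> R" "m \<in> M" using yz by (auto simp: D_def)
    have cc: "r \<in> carrier G" "m \<in> carrier G" "z \<in> carrier G" using y yz c R M by blast+
    have "z = inv r \<otimes> y \<otimes> inv m" using y cc by (simp add: m_assoc)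
    moreover have "inv r \<in> R" "inv m \<in> M"
      using y subgroup.m_inv_closed[OF R(1)] subgroup.m_inv_closed[OF M(1)] by auto
    ultimately show ?thesis unfolding D_def by blast
  qed
  have DF: "D y \<inter> F = {}" if y: "y \<in> Y - F" for y
  proof (rule ccontr)
    assume "D y \<inter> F \<noteq> {}"
    then obtain x where x: "x \<in> D y" "x \<in> F" by blast
    then obtain r m where x': "x = r \<otimes> y \<otimes> m" "r \<in> R" "m \<in> M" by (auto simp: D_def)
    have cc: "r \<in> carrier G" "m \<in> carrier G" "y \<in> carrier G" using x' y c R M by blast+
    have "R \<subseteq> conjg y M"
    proof
      fix s assume s: "s \<in> R"
      have sc: "s \<in> carrier G" using s c R by blast
      have "r \<otimes> s \<otimes> inv r \<in> R"
        using s x' subgroup.m_closed[OF R(1)] subgroup.m_inv_closed[OF R(1)] by simp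
      then obtain n where n: "n \<in> M" "r \<otimes> s \<otimes> inv r = x \<otimes> n \<otimes> inv x"
        using x by (auto simp: F_def conjg_def)
      have nc: "n \<in> carrier G" using n c M by blast
      have "s = inv r \<otimes> (r \<otimes> s \<otimes> inv r) \<otimes> r" using cc sc by (simp add: m_assoc)
      also have "\<dots> = y \<otimes> (m \<otimes> n \<otimes> inv m) \<otimes> inv y"
        unfolding n(2) x'(1) using cc nc by (simp add: m_assoc inv_mult_group)
      finally have "s = y \<otimes> (m \<otimes> n \<otimes> inv m) \<otimes> inv y" .
      moreover have "m \<otimes> n \<otimes> inv m \<in> M"
        using n x' subgroup.m_closed[OF M(1)] subgroup.m_inv_closed[OF M(1)] by simp
      ultimately show "s \<in> conjg y M" by (auto simp: conjg_def)
    qed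
    then show False using y by (auto simp: F_def)
  qed
  have card: "p * card M dvd card (D y)" if y: "y \<in> Y - F" for y
  proof -
    have yc: "y \<in> carrier G" using y c by blast
    have "D y = (\<lambda>w. w \<otimes> y) ` (R <#> conjg y M)"
    proof -
      have "r \<otimes> y \<otimes> m = r \<otimes> (y \<otimes> m \<otimes> inv y) \<otimes> y" if "r \<in> R" "m \<in> M" for r m
      proof -
        have "r \<in> carrier G" "m \<in> carrier G" using that c R M by blast+
        then show ?thesis using yc by (simp add: m_assoc)
      qed
      then show ?thesis unfolding D_def set_mult_def conjg_def by force
    qed
    moreover have "inj_on (\<lambda>w. w \<otimes> y) (carrier G)" using yc by (auto simp: inj_on_def)
    moreover have cm: "subgroup (conjg y M) G" using conjg_subgroup[OF yc M(1)] .
    moreover have "R <#> conjg y M \<subseteq> carrier G"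
      using setmult_subset_G[OF subgroup.subset[OF R(1)] subgroup.subset[OF cm]] .
    ultimately have 1: "card (D y) = card (R <#> conjg y M)"
      by (metis card_image inj_on_subset)
    have 2: "card (R <#> conjg y M) * card (R \<inter> conjg y M) = card R * card M"
      using card_set_mult[OF R(1) cm] yc subgroup.subset[OF M(1)] by simp
    have "R \<inter> conjg y M \<noteq> R" using y by (auto simp: F_def)
    then have "index R (R \<inter> conjg y M) \<noteq> 1" using index_eq_1[of "R \<inter> conjg y M" R] R cm by auto
    then obtain q where q: "prime q" "q dvd index R (R \<inter> conjg y M)" using prime_factor_nat by blast
    have "index R (R \<inter> conjg y M) dvd card R" using R cm by (intro index_dvd_card) auto
    then have "q = p" using q R(3) dvd_trans by (auto simp: pi_number_def)
    moreover have "card (D y) = index R (R \<inter> conjg y M) * card M"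
    proof -
      have s: "subgroup (R \<inter> conjg y M) G" using R cm by simp
      have "card (D y) * card (R \<inter> conjg y M) = index R (R \<inter> conjg y M) * card M * card (R \<inter> conjg y M)"
        using 1 2 index_card[OF s R(1)] by (simp add: mult_ac)
      then show ?thesis using card_subgroup_pos[OF s] s by simp
    qed
    ultimately show ?thesis using q by (simp add: mult_dvd_mono)
  qed
  have U: "Y - F = \<Union> (D ` (Y - F))"
    using inD DY DF by fast
  have "p * card M dvd card (\<Union> (D ` (Y - F)))"
  proof (rule dvd_partition)
    show "finite (\<Union> (D ` (Y - F)))" unfolding U[symmetric] using Y by simp
    show "\<forall>c\<in>D ` (Y - F). p * card M dvd card c" using card by blast
    show "\<forall>c1\<in>D ` (Y - F). \<forall>c2\<in>D ` (Y - F). c1 \<noteq> c2 \<longrightarrow> c1 \<inter> c2 = {}"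
    proof (intro ballI impI)
      fix c1 c2 assume "c1 \<in> D ` (Y - F)" "c2 \<in> D ` (Y - F)" "c1 \<noteq> c2"
      then obtain y z where *: "c1 = D y" "c2 = D z" "y \<in> Y" "z \<in> Y" "D y \<noteq> D z" by blast
      have "D y = D z" if "x \<in> D y" "x \<in> D z" for x
      proof -
        have "x \<in> Y" using that * DY by blast
        then have "D y = D x" "D z = D x" using sub[of x y] sub[of y x] sym[of x y]
            sub[of x z] sub[of z x] sym[of x z] that * by blast+
        then show ?thesis by simp
      qed
      then show "c1 \<inter> c2 = {}" using * by blast
    qed
  qed
  then show ?thesis using U F_def by simp
qed

lemma p_subgroup_in_conj:
  assumes p: "prime p" and R: "subgroup R G" "R \<subseteq> Y" "pi_number {p} (card R)"
    and M: "subgroup M G" "M \<subseteq> Y" and Y: "subgroup Y G" and np: "\<not> p dvd index Y M"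
  shows "\<exists>y\<in>Y. R \<subseteq> conjg y M"
proof (rule ccontr)
  assume "\<not> ?thesis"
  then have e: "{y \<in> Y. R \<subseteq> conjg y M} = {}" by blast
  have "p * card M dvd card Y" using double_coset_count[OF p R M Y] unfolding e by simp
  then have "p * card M dvd index Y M * card M" using index_card[OF M(1) Y M(2)] by simp
  then show False using np card_subgroup_pos[OF M(1)] M(1) by simp
qed

lemma sylow_ex:
  assumes p: "prime p" and Y: "subgroup Y G" shows "\<exists>P. hall {p} P Y"
proof -
  interpret Y: group "G\<lparr>carrier := Y\<rparr>" using Y by (rule subgroup_imp_group)
  obtain m where m: "card Y = p ^ multiplicity p (card Y) * m" "\<not> p dvd m"
    using multiplicity_decompose'[of "card Y" p] p card_subgroup_pos[OF Y]
    by (metis not_prime_unit neq0_conv)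
  have "\<exists>P. subgroup P (G\<lparr>carrier := Y\<rparr>) \<and> card P = p ^ multiplicity p (card Y)"
    using sylow_thm[of p "G\<lparr>carrier := Y\<rparr>" "multiplicity p (card Y)" m] p Y.group_axioms m Y
    by (simp add: order_def)
  then obtain P where P: "subgroup P (G\<lparr>carrier := Y\<rparr>)" "card P = p ^ multiplicity p (card Y)"
    by blast
  have s: "subgroup P G" using incl_subgroup[OF Y P(1)] .
  have PY: "P \<subseteq> Y" using subgroup.subset[OF P(1)] by simp
  have "index Y P * card P = m * card P" using index_card[OF s Y PY] m P by (simp add: mult.commute)
  then have "index Y P = m" using card_subgroup_pos[OF s] s by simp
  then have "pi_number (- {p}) (index Y P)" using m by (auto simp: pi_number_def)
  then show ?thesis using s Y PY P pi_number_prime_power[OF p] unfolding hall_def by auto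
qed

lemma sylow_contains:
  assumes p: "prime p" and P: "hall {p} P Y" and R: "subgroup R G" "R \<subseteq> Y" "pi_number {p} (card R)"
  shows "\<exists>y\<in>Y. R \<subseteq> conjg y P"
proof -
  have "\<not> p dvd index Y P" using hallD(5)[OF P] p by (auto simp: pi_number_def)
  then show ?thesis using p_subgroup_in_conj[OF p R] hallD[OF P] by blast
qed

lemma sylow_conj:
  assumes p: "prime p" and P: "hall {p} P Y" and Q: "hall {p} Q Y"
  shows "\<exists>y\<in>Y. Q = conjg y P"
proof -
  obtain y where y: "y \<in> Y" "Q \<subseteq> conjg y P"
    using sylow_contains[OF p P] hallD[OF Q] by blast
  have "hall {p} (conjg y P) Y" using hall_conjg[OF y(1) P] .
  then have "conjg y P = Q" using hall_maximal[OF Q] y hallD[of "{p}" "conjg y P" Y] by blast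
  then show ?thesis using y by blast
qed

text \<open>
  Stated for an arbitrary subset \<open>X\<close>, because it is applied to Sylow subgroups, to their
  products with a normal subgroup, and to complements.
\<close>

lemma frattini:
  assumes N: "normal_in N Y" and X: "X \<subseteq> carrier G" and cjs: "\<And>g. g \<in> Y \<Longrightarrow> \<exists>n\<in>N. conjg g X = conjg n X"
  shows "N <#> normalizer_in Y X = Y"
proof
  note n = normal_inD[OF N]
  show "N <#> normalizer_in Y X \<subseteq> Y"
    using n by (auto simp: normalizer_in_def set_mult_def intro: subgroup.m_closed)
  show "Y \<subseteq> N <#> normalizer_in Y X"
  proof
    fix g assume g: "g \<in> Y"
    obtain k where k: "k \<in> N" "conjg g X = conjg k X" using cjs[OF g] by blast
    have c: "g \<in> carrier G" "k \<in> carrier G" using g k n subgroup_carrier by blast+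
    have "conjg (inv k \<otimes> g) X = conjg (inv k) (conjg g X)" using c X by (simp add: conjg_mult)
    also have "\<dots> = X" unfolding k(2) using c X by (simp add: conjg_inv)
    finally have "inv k \<otimes> g \<in> normalizer_in Y X" using g k n
      by (auto simp: normalizer_in_def intro!: subgroup.m_closed subgroup.m_inv_closed)
    then have "k \<otimes> (inv k \<otimes> g) \<in> N <#> normalizer_in Y X" using k by (intro set_multI)
    then show "g \<in> N <#> normalizer_in Y X" using c by simp
  qed
qed

lemma sylow_conj_normal:
  assumes p: "prime p" and N: "normal_in N Y" and P: "hall {p} P N" and g: "g \<in> Y"
  shows "\<exists>k\<in>N. conjg g P = conjg k P"
  using sylow_conj[OF p P hall_conjg_normal[OF N P g]] by blast

lemma frattini_sylow:
  assumes p: "prime p" and N: "normal_in N Y" and P: "hall {p} P N"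
  shows "N <#> normalizer_in Y P = Y"
  using frattini[OF N subgroup.subset[OF hallD(1)[OF P]] sylow_conj_normal[OF p N P]] .

text \<open>
  This is the preimage of the centraliser of the image of \<open>x\<close> in \<open>Y/M\<close>.
\<close>

lemma commutes_mod_subgroup:
  assumes M: "normal_in M Y" and x: "x \<in> Y"
  shows "subgroup {y \<in> Y. x \<otimes> y \<otimes> inv x \<otimes> inv y \<in> M} G"
proof (rule subgroupI)
  note m = normal_inD[OF M]
  have c: "z \<in> carrier G" if "z \<in> Y" for z using that m subgroup_carrier by blast
  show "{y \<in> Y. x \<otimes> y \<otimes> inv x \<otimes> inv y \<in> M} \<subseteq> carrier G" using c by blast
  have "\<one> \<in> {y \<in> Y. x \<otimes> y \<otimes> inv x \<otimes> inv y \<in> M}"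
    using x c subgroup.one_closed[OF m(1)] subgroup.one_closed[OF m(2)] by simp
  then show "{y \<in> Y. x \<otimes> y \<otimes> inv x \<otimes> inv y \<in> M} \<noteq> {}" by blast
next
  note m = normal_inD[OF M]
  have c: "z \<in> carrier G" if "z \<in> Y" for z using that m subgroup_carrier by blast
  fix y assume y: "y \<in> {y \<in> Y. x \<otimes> y \<otimes> inv x \<otimes> inv y \<in> M}"
  have "inv y \<otimes> inv (x \<otimes> y \<otimes> inv x \<otimes> inv y) \<otimes> y \<in> M"
    using y normal_in_inv[OF M] subgroup.m_inv_closed[OF m(1)] by simp
  moreover have "inv y \<otimes> inv (x \<otimes> y \<otimes> inv x \<otimes> inv y) \<otimes> y = x \<otimes> inv y \<otimes> inv x \<otimes> inv (inv y)"
    using c x y by (simp add: m_assoc inv_mult_group)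
  ultimately show "inv y \<in> {y \<in> Y. x \<otimes> y \<otimes> inv x \<otimes> inv y \<in> M}"
    using y subgroup.m_inv_closed[OF m(2)] by simp
next
  note m = normal_inD[OF M]
  have c: "z \<in> carrier G" if "z \<in> Y" for z using that m subgroup_carrier by blast
  fix y z assume y: "y \<in> {y \<in> Y. x \<otimes> y \<otimes> inv x \<otimes> inv y \<in> M}"
    and z: "z \<in> {y \<in> Y. x \<otimes> y \<otimes> inv x \<otimes> inv y \<in> M}"
  have "(x \<otimes> y \<otimes> inv x \<otimes> inv y) \<otimes> (y \<otimes> (x \<otimes> z \<otimes> inv x \<otimes> inv z) \<otimes> inv y) \<in> M"
    using y z m(4) subgroup.m_closed[OF m(1)] by simp
  moreover have "(x \<otimes> y \<otimes> inv x \<otimes> inv y) \<otimes> (y \<otimes> (x \<otimes> z \<otimes> inv x \<otimes> inv z) \<otimes> inv y)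
      = x \<otimes> (y \<otimes> z) \<otimes> inv x \<otimes> inv (y \<otimes> z)"
    using c x y z by (simp add: m_assoc inv_mult_group)
  ultimately show "y \<otimes> z \<in> {y \<in> Y. x \<otimes> y \<otimes> inv x \<otimes> inv y \<in> M}"
    using y z subgroup.m_closed[OF m(2)] by simp
qed

text \<open>
  Take \<open>M\<close> maximal among the proper subgroups of \<open>N\<close> containing \<open>K\<close>. A Sylow
  \<open>p\<close>-subgroup \<open>P\<close> of \<open>M\<close> satisfies \<open>M = K P\<close>, so its fixed points on the cosets of
  \<open>M\<close> make up the normaliser of \<open>M\<close>, which by counting is larger than \<open>M\<close>; hence \<open>M\<close>
  is normal. The centraliser modulo \<open>M\<close> of an element outside \<open>M\<close> contains that element
  and \<open>M\<close>, so it is all of \<open>N\<close>.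
\<close>

lemma p_section_abelian_top:
  assumes p: "prime p" and K: "normal_in K N" "K \<noteq> N" "pi_number {p} (index N K)"
  shows "\<exists>M. normal_in M N \<and> K \<subseteq> M \<and> M \<noteq> N \<and> (\<forall>x\<in>N. \<forall>y\<in>N. x \<otimes> y \<otimes> inv x \<otimes> inv y \<in> M)"
proof -
  note k = normal_inD[OF K(1)]
  define S where "S = {M. subgroup M G \<and> K \<subseteq> M \<and> M \<subseteq> N \<and> M \<noteq> N}"
  have "finite S" unfolding S_def using k(2) by (rule_tac finite_subset[of _ "Pow N"]) auto
  moreover have "K \<in> S" using k K by (auto simp: S_def)
  ultimately obtain M where M: "M \<in> S" and Mmax: "\<And>L. L \<in> S \<Longrightarrow> M \<subseteq> L \<Longrightarrow> L = M"
    using finite_has_maximal2[of S K] by metis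
  have m: "subgroup M G" "K \<subseteq> M" "M \<subseteq> N" "M \<noteq> N" using M by (auto simp: S_def)
  have ip: "index N K = index N M * index M K" using index_mult k m by blast
  obtain P where P: "hall {p} P M" using sylow_ex[OF p m(1)] by blast
  note h = hallD[OF P]
  have KM: "normal_in K M" using normal_in_mono[OF K(1) m(1,2,3)] .
  have MKP: "K <#> P = M"
  proof -
    note s = set_mult_subgroup[OF KM h(1,3)]
    have "index M (K <#> P) dvd index M K" using index_mult[of K "K <#> P" M] s k m by simp
    moreover have "index M (K <#> P) dvd index M P" using index_mult[of P "K <#> P" M] s h by simp
    ultimately have "index M (K <#> P) = 1"
      using pi_number_compl_eq_1[of "{p}"] pi_number_dvd h(5) K(3) ip by (metis pi_number_mult)
    then show ?thesis using index_eq_1 s m by blast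
  qed
  have "{y \<in> N. P \<subseteq> conjg y M} \<subseteq> normalizer_in N M"
  proof
    fix y assume y: "y \<in> {y \<in> N. P \<subseteq> conjg y M}"
    have yc: "y \<in> carrier G" using y k subgroup_carrier by blast
    have "K \<subseteq> conjg y M" using conjg_normal[OF K(1), of y] conjg_mono[OF m(2), of y] y by blast
    then have "K <#> P \<subseteq> conjg y M" using y by (intro set_mult_least conjg_subgroup yc m) auto
    then have "M \<subseteq> conjg y M" using MKP by simp
    then have "conjg y M = M" using conjg_subgroup[OF yc m(1)] yc subgroup.subset[OF m(1)]
      by (metis card_subset_eq conjg_card finite_subgroup)
    then show "y \<in> normalizer_in N M" using y by (simp add: normalizer_in_def)
  qed
  moreover have "normalizer_in N M \<subseteq> {y \<in> N. P \<subseteq> conjg y M}"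
    using h by (auto simp: normalizer_in_def)
  ultimately have F: "{y \<in> N. P \<subseteq> conjg y M} = normalizer_in N M" by blast
  have 1: "p * card M dvd card (N - normalizer_in N M)"
    using double_coset_count[OF p h(1) _ h(4) m(1,3) k(2)] h m F by auto
  have "index N M \<noteq> 1" using index_eq_1[of M N] m k by auto
  then obtain q where q: "prime q" "q dvd index N M" using prime_factor_nat by blast
  have "q = p" using q K(3) ip by (auto simp: pi_number_def)
  then have "p * card M dvd card N" using q index_card[of M N] m k by (metis mult_dvd_mono dvd_refl)
  moreover have nm: "subgroup (normalizer_in N M) G" "normalizer_in N M \<subseteq> N" "M \<subseteq> normalizer_in N M"
    using normalizer_in_props[OF k(2) m(1,3)] normalizer_in_subgroup[OF k(2)] subgroup.subset[OF m(1)] by blast+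
  then have "card N = card (N - normalizer_in N M) + card (normalizer_in N M)"
    using k(2) by (metis card_Diff_subset card_mono finite_subgroup le_add_diff_inverse2)
  ultimately have "p * card M dvd card (normalizer_in N M)" using 1 by (metis dvd_add_right_iff)
  then have "p * card M \<le> card (normalizer_in N M)"
    using card_subgroup_pos[OF nm(1)] dvd_imp_le by blast
  moreover have "card M < p * card M" using p card_subgroup_pos[OF m(1)] prime_gt_1_nat by simp
  ultimately have "normalizer_in N M \<noteq> M" by auto
  then have "normalizer_in N M = N" using Mmax[of "normalizer_in N M"] nm m by (auto simp: S_def)
  then have MN: "normal_in M N" using normal_in_of_normalizer[OF k(2) m(1,3)] by blast
  have "x \<otimes> y \<otimes> inv x \<otimes> inv y \<in> M" if x: "x \<in> N" and y: "y \<in> N" for x y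
  proof -
    have c: "z \<in> carrier G" if "z \<in> N" for z using that k subgroup_carrier by blast
    let ?C = "{y \<in> N. x \<otimes> y \<otimes> inv x \<otimes> inv y \<in> M}"
    have C: "subgroup ?C G" using commutes_mod_subgroup[OF MN x] .
    have "x \<otimes> y \<otimes> inv x \<otimes> inv y \<in> M" if "y \<in> M" for y
      using normal_inD(4)[OF MN x that] that subgroup.m_closed[OF m(1)] subgroup.m_inv_closed[OF m(1)] by blast
    then have MC: "M \<subseteq> ?C" using m by blast
    have xC: "x \<in> ?C" using x c[OF x] subgroup.one_closed[OF m(1)] by (simp add: m_assoc)
    show ?thesis
    proof (cases "x \<in> M")
      case False
      then have "?C = N" using Mmax[of ?C] C MC xC m unfolding S_def by blast
      then show ?thesis using y by blast
    next
      case True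
      have "y \<otimes> inv x \<otimes> inv y \<in> M"
        using normal_inD(4)[OF MN y] subgroup.m_inv_closed[OF m(1) True] by blast
      then have "x \<otimes> (y \<otimes> inv x \<otimes> inv y) \<in> M" using True subgroup.m_closed[OF m(1)] by blast
      then show ?thesis using c[OF x] c[OF y] by (simp add: m_assoc)
    qed
  qed
  then show ?thesis using MN m by blast
qed

end

section \<open>The Schur-Zassenhaus theorem for abelian sections\<close>

text \<open>
  The quotient \<open>N/K\<close> is an abelian normal Hall subgroup of \<open>Y/K\<close>. For a transversal \<open>s\<close>
  of \<open>N\<close> in \<open>Y\<close>, the product of the cosets of \<open>g t s(g t)\<^sup>-\<^sup>1\<close> over all representatives
  \<open>t\<close> is a crossed homomorphism \<open>\<delta>\<close> from \<open>Y\<close> to \<open>N/K\<close> (\<open>delta_mult\<close>) which on \<open>N\<close> is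
  the power map with exponent \<open>|Y : N|\<close> (\<open>delta_N\<close>). That exponent is prime to \<open>|N/K|\<close>, so
  \<open>\<delta>\<close> maps \<open>N/K\<close> bijectively, and the kernel of \<open>\<delta>\<close> is a complement.
\<close>

locale abelian_section = fin_group +
  fixes K N Y
  assumes K: "normal_in K Y" and N: "normal_in N Y" and KN: "K \<subseteq> N"
    and comm: "\<And>a b. a \<in> N \<Longrightarrow> b \<in> N \<Longrightarrow> a \<otimes> b \<otimes> inv a \<otimes> inv b \<in> K"
    and coprime: "coprime (index N K) (index Y N)"
begin

lemmas kD = normal_inD[OF K]
lemmas nD = normal_inD[OF N]

lemma Yc: "y \<in> Y \<Longrightarrow> y \<in> carrier G" using nD subgroup_carrier by blast
lemma NY: "y \<in> N \<Longrightarrow> y \<in> Y" using nD by blast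
lemma KY: "y \<in> K \<Longrightarrow> y \<in> Y" using kD by blast
lemma Ycl [simp]: "x \<in> Y \<Longrightarrow> y \<in> Y \<Longrightarrow> x \<otimes> y \<in> Y" "x \<in> Y \<Longrightarrow> inv x \<in> Y" "\<one> \<in> Y"
  using subgroup.m_closed[OF nD(2)] subgroup.m_inv_closed[OF nD(2)] subgroup.one_closed[OF nD(2)]
  by auto
lemma Ncl [simp]: "x \<in> N \<Longrightarrow> y \<in> N \<Longrightarrow> x \<otimes> y \<in> N" "x \<in> N \<Longrightarrow> inv x \<in> N" "\<one> \<in> N"
  using subgroup.m_closed[OF nD(1)] subgroup.m_inv_closed[OF nD(1)] subgroup.one_closed[OF nD(1)]
  by auto
lemma Kcl [simp]: "x \<in> K \<Longrightarrow> y \<in> K \<Longrightarrow> x \<otimes> y \<in> K" "x \<in> K \<Longrightarrow> inv x \<in> K" "\<one> \<in> K"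
  using subgroup.m_closed[OF kD(1)] subgroup.m_inv_closed[OF kD(1)] subgroup.one_closed[OF kD(1)]
  by auto

definition Q where "Q = (G\<lparr>carrier := N\<rparr>) Mod K"
definition quot_map where "quot_map n = K #> n"

lemma KNn: "normal_in K N" using normal_in_mono[OF K nD(1) KN nD(3)] .

lemma K_normal_N: "K \<lhd> G\<lparr>carrier := N\<rparr>" using KNn normal_in_iff_normal by blast

lemma Q_group: "group Q"
  unfolding Q_def by (rule normal.factorgroup_is_group[OF K_normal_N])

lemma Q_carrier: "carrier Q = quot_map ` N"
  unfolding Q_def FactGroup_def quot_map_def by (auto simp: RCOSETS_def)

lemma quot_map_closed [simp]: "n \<in> N \<Longrightarrow> quot_map n \<in> carrier Q"
  by (simp add: Q_carrier)

lemma quot_map_mult: "a \<in> N \<Longrightarrow> b \<in> N \<Longrightarrow> quot_map a \<otimes>\<^bsub>Q\<^esub> quot_map b = quot_map (a \<otimes> b)"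
  using normal.rcos_sum[OF K_normal_N, of a b] by (simp add: Q_def quot_map_def)

lemma Q_one: "\<one>\<^bsub>Q\<^esub> = quot_map \<one>"
  using kD(1) by (simp add: Q_def quot_map_def coset_mult_one subgroup.subset)

lemma quot_map_eq: assumes "a \<in> Y" "b \<in> Y" shows "quot_map a = quot_map b \<longleftrightarrow> a \<otimes> inv b \<in> K"
proof
  have c: "a \<in> carrier G" "b \<in> carrier G" using assms Yc by auto
  assume "quot_map a = quot_map b"
  moreover have "a \<in> quot_map a" using rcos_self[OF c(1) kD(1)] by (simp add: quot_map_def)
  ultimately obtain k where k: "k \<in> K" "a = k \<otimes> b" by (auto simp: quot_map_def r_coset_def)
  then have "a \<otimes> inv b = k" using c Yc KY by (simp add: m_assoc)
  then show "a \<otimes> inv b \<in> K" using k by simp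
next
  have c: "a \<in> carrier G" "b \<in> carrier G" using assms Yc by auto
  assume k: "a \<otimes> inv b \<in> K"
  have "a = (a \<otimes> inv b) \<otimes> b" using c by (simp add: m_assoc)
  then have "a \<in> K #> b" using k by (auto simp: r_coset_def)
  then show "quot_map a = quot_map b"
    unfolding quot_map_def using repr_independence[OF _ c(2) kD(1)] by simp
qed

lemma quot_map_eq_one: "a \<in> Y \<Longrightarrow> quot_map a = \<one>\<^bsub>Q\<^esub> \<longleftrightarrow> a \<in> K"
  using quot_map_eq[of a \<one>] Yc by (simp add: Q_one)

lemma Q_comm: "comm_group Q"
proof -
  interpret q: group Q by (rule Q_group)
  show "comm_group Q"
  proof (rule q.group_comm_groupI)
    fix x y assume "x \<in> carrier Q" "y \<in> carrier Q"
    then obtain a b where ab: "a \<in> N" "b \<in> N" "x = quot_map a" "y = quot_map b"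
      by (auto simp: Q_carrier)
    have c: "a \<in> carrier G" "b \<in> carrier G" using ab NY Yc by auto
    have "(a \<otimes> b) \<otimes> inv (b \<otimes> a) \<in> K" using comm[of a b] ab c by (simp add: word)
    then have "quot_map (a \<otimes> b) = quot_map (b \<otimes> a)"
      using quot_map_eq[of "a \<otimes> b" "b \<otimes> a"] ab NY by simp
    then show "x \<otimes>\<^bsub>Q\<^esub> y = y \<otimes>\<^bsub>Q\<^esub> x" using ab by (simp add: quot_map_mult)
  qed
qed

sublocale Q: comm_group Q by (rule Q_comm)

lemma finQ: "finite (carrier Q)"
  using nD(1) by (simp add: Q_carrier)

lemma card_Q: "card (carrier Q) = index N K"
proof -
  have "subgroup K (G\<lparr>carrier := N\<rparr>)" using subgroup_incl[OF kD(1) nD(1) KN] .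
  from group.lagrange[OF subgroup_imp_group[OF nD(1)] this]
  have "card (carrier Q) * card K = card N" by (simp add: Q_def FactGroup_def order_def)
  then show ?thesis using index_card[OF kD(1) nD(1) KN] card_subgroup_pos[OF kD(1)]
    by (metis mult_right_cancel less_irrefl)
qed

lemma conjg_quot_map:
  assumes "g \<in> Y" "n \<in> N" shows "conjg g (quot_map n) = quot_map (g \<otimes> n \<otimes> inv g)"
proof -
  have c: "g \<in> carrier G" "n \<in> carrier G" using assms NY Yc by auto
  have "conjg g (quot_map n) = (\<lambda>k. g \<otimes> (k \<otimes> n) \<otimes> inv g) ` K"
    by (auto simp: conjg_def quot_map_def r_coset_def)
  also have "\<dots> = (\<lambda>k. (g \<otimes> k \<otimes> inv g) \<otimes> (g \<otimes> n \<otimes> inv g)) ` K"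
    by (rule image_cong) (use c KY Yc in \<open>auto simp: m_assoc\<close>)
  also have "\<dots> = (\<lambda>k. k \<otimes> (g \<otimes> n \<otimes> inv g)) ` conjg g K"
    by (simp add: conjg_def image_image)
  also have "\<dots> = quot_map (g \<otimes> n \<otimes> inv g)"
    using conjg_normal[OF K assms(1)] by (auto simp: quot_map_def r_coset_def)
  finally show ?thesis .
qed

lemma conjg_Q: assumes "g \<in> Y" "C \<in> carrier Q" shows "conjg g C \<in> carrier Q"
  using assms conjg_quot_map[OF assms(1)] nD(4) by (auto simp: Q_carrier)

lemma conjg_Q_mult:
  assumes g: "g \<in> Y" and "C \<in> carrier Q" "D \<in> carrier Q"
  shows "conjg g (C \<otimes>\<^bsub>Q\<^esub> D) = conjg g C \<otimes>\<^bsub>Q\<^esub> conjg g D"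
proof -
  obtain a b where ab: "a \<in> N" "b \<in> N" "C = quot_map a" "D = quot_map b"
    using assms by (auto simp: Q_carrier)
  have c: "a \<in> carrier G" "b \<in> carrier G" "g \<in> carrier G" using ab g NY Yc by auto
  have "(g \<otimes> a \<otimes> inv g) \<otimes> (g \<otimes> b \<otimes> inv g) = g \<otimes> (a \<otimes> b) \<otimes> inv g" using c by (simp add: m_assoc)
  then show ?thesis using ab g nD(4) by (simp add: quot_map_mult conjg_quot_map)
qed

lemma conjg_Q_N: assumes "g \<in> N" "C \<in> carrier Q" shows "conjg g C = C"
proof -
  obtain a where a: "a \<in> N" "C = quot_map a" using assms by (auto simp: Q_carrier)
  have "quot_map (g \<otimes> a \<otimes> inv g) = quot_map a"
    using quot_map_eq[of "g \<otimes> a \<otimes> inv g" a] assms a comm NY by simp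
  then show ?thesis using a assms NY by (simp add: conjg_quot_map)
qed

lemma conjg_Q_one: assumes "g \<in> Y" shows "conjg g \<one>\<^bsub>Q\<^esub> = \<one>\<^bsub>Q\<^esub>"
  using assms Yc[OF assms] by (simp add: Q_one conjg_quot_map)

lemma conjg_finprod:
  assumes g: "g \<in> Y" and "finite R" "f \<in> R \<rightarrow> carrier Q"
  shows "conjg g (finprod Q f R) = finprod Q (\<lambda>t. conjg g (f t)) R"
  using assms(2,3)
proof (induction R rule: finite_induct)
  case empty
  then show ?case using conjg_Q_one[OF g] by simp
next
  case (insert x F)
  have 1: "f \<in> F \<rightarrow> carrier Q" "f x \<in> carrier Q" using insert by auto
  then have 2: "(\<lambda>t. conjg g (f t)) \<in> F \<rightarrow> carrier Q" "conjg g (f x) \<in> carrier Q"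
    using conjg_Q[OF g] by auto
  show ?case using insert 1 2 conjg_Q_mult[OF g 1(2), of "finprod Q f F"] by simp
qed

text \<open>
  A transversal is a choice function on the cosets of \<open>N\<close>, seen as an idempotent map on \<open>Y\<close>.
\<close>

definition transversal :: "('a \<Rightarrow> 'a) \<Rightarrow> bool" where
  "transversal s \<longleftrightarrow> (\<forall>x\<in>Y. s x \<in> Y \<and> s x \<otimes> inv x \<in> N) \<and> (\<forall>x\<in>Y. \<forall>y\<in>Y. x \<otimes> inv y \<in> N \<longrightarrow> s x = s y)"

definition delta :: "('a \<Rightarrow> 'a) \<Rightarrow> 'a \<Rightarrow> 'a set" where
  "delta s g = finprod Q (\<lambda>t. quot_map (g \<otimes> t \<otimes> inv (s (g \<otimes> t)))) (s ` Y)"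

definition delta_ker :: "('a \<Rightarrow> 'a) \<Rightarrow> 'a set" where
  "delta_ker s = {g \<in> Y. delta s g = \<one>\<^bsub>Q\<^esub>}"

lemma same_coset_inv: assumes "x \<in> Y" "y \<in> Y" "x \<otimes> inv y \<in> N" shows "y \<otimes> inv x \<in> N"
  using Ncl(2)[OF assms(3)] assms Yc by (simp add: inv_mult_group)

context
  fixes s assumes s: "transversal s"
begin

lemma sY [simp]: "x \<in> Y \<Longrightarrow> s x \<in> Y" using s by (simp add: transversal_def)
lemma sN: "x \<in> Y \<Longrightarrow> s x \<otimes> inv x \<in> N" using s by (simp add: transversal_def)
lemma sN': "x \<in> Y \<Longrightarrow> x \<otimes> inv (s x) \<in> N" using same_coset_inv[OF _ _ sN] by simp
lemma s_eq: "x \<in> Y \<Longrightarrow> y \<in> Y \<Longrightarrow> x \<otimes> inv y \<in> N \<Longrightarrow> s x = s y" using s by (simp add: transversal_def)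
lemma s_eqD: assumes "x \<in> Y" "y \<in> Y" "s x = s y" shows "x \<otimes> inv y \<in> N"
proof -
  have "(x \<otimes> inv (s x)) \<otimes> (s y \<otimes> inv y) \<in> N" using sN[of y] sN'[of x] assms(1,2) by simp
  then show ?thesis using assms Yc by (simp add: m_assoc)
qed
lemma s_s [simp]: "x \<in> Y \<Longrightarrow> s (s x) = s x" using s_eq sN by simp

lemma s_mult_left: assumes "g \<in> Y" "x \<in> Y" shows "s (g \<otimes> s x) = s (g \<otimes> x)"
proof (rule s_eq)
  have "g \<otimes> (s x \<otimes> inv x) \<otimes> inv g \<in> N" using nD(4) assms sN by simp
  then show "(g \<otimes> s x) \<otimes> inv (g \<otimes> x) \<in> N" using assms Yc by (simp add: word)
qed (use assms in auto)

lemma RY: "t \<in> s ` Y \<Longrightarrow> t \<in> Y" by auto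
lemma Rs: "t \<in> s ` Y \<Longrightarrow> s t = t" by auto
lemma finR: "finite (s ` Y)" using nD(2) by simp

lemma perm:
  assumes g: "g \<in> Y" shows "bij_betw (\<lambda>t. s (g \<otimes> t)) (s ` Y) (s ` Y)"
proof (rule bij_betwI[where g = "\<lambda>t. s (inv g \<otimes> t)"])
  show "(\<lambda>t. s (g \<otimes> t)) \<in> s ` Y \<rightarrow> s ` Y" using g by auto
  show "(\<lambda>t. s (inv g \<otimes> t)) \<in> s ` Y \<rightarrow> s ` Y" using g by auto
  show "s (inv g \<otimes> s (g \<otimes> t)) = t" if "t \<in> s ` Y" for t
    using RY[OF that] Rs[OF that] g Yc by (simp add: s_mult_left)
  show "s (g \<otimes> s (inv g \<otimes> t)) = t" if "t \<in> s ` Y" for t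
    using RY[OF that] Rs[OF that] g Yc by (simp add: s_mult_left)
qed

lemma term_N: "g \<in> Y \<Longrightarrow> t \<in> Y \<Longrightarrow> g \<otimes> t \<otimes> inv (s (g \<otimes> t)) \<in> N"
  using sN' by simp

lemma delta_closed [simp]: "g \<in> Y \<Longrightarrow> delta s g \<in> carrier Q"
  unfolding delta_def by (rule Q.finprod_closed) (use term_N RY in auto)

text \<open>
  Since \<open>g h t s(g h t)\<^sup>-\<^sup>1\<close> splits as the conjugate by \<open>g\<close> of \<open>h t s(h t)\<^sup>-\<^sup>1\<close> times
  \<open>g t' s(g t')\<^sup>-\<^sup>1\<close> with \<open>t' = s(h t)\<close>, and \<open>t'\<close> runs through all representatives.
\<close>

lemma delta_mult:
  assumes g: "g \<in> Y" and h: "h \<in> Y"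
  shows "delta s (g \<otimes> h) = conjg g (delta s h) \<otimes>\<^bsub>Q\<^esub> delta s g"
proof -
  let ?R = "s ` Y"
  have "delta s (g \<otimes> h) = finprod Q (\<lambda>t. conjg g (quot_map (h \<otimes> t \<otimes> inv (s (h \<otimes> t)))) \<otimes>\<^bsub>Q\<^esub>
      quot_map (g \<otimes> s (h \<otimes> t) \<otimes> inv (s (g \<otimes> s (h \<otimes> t))))) ?R"
    unfolding delta_def
  proof (rule Q.finprod_cong')
    fix t assume t: "t \<in> ?R"
    note tY = RY[OF t]
    define a where "a = h \<otimes> t \<otimes> inv (s (h \<otimes> t))"
    define b where "b = g \<otimes> s (h \<otimes> t) \<otimes> inv (s (g \<otimes> s (h \<otimes> t)))"
    have ab: "a \<in> N" "b \<in> N" unfolding a_def b_def using term_N g h tY by auto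
    have "g \<otimes> h \<otimes> t \<otimes> inv (s (g \<otimes> h \<otimes> t)) = (g \<otimes> a \<otimes> inv g) \<otimes> b"
      unfolding a_def b_def using g h tY Yc by (simp add: m_assoc s_mult_left)
    then show "quot_map (g \<otimes> h \<otimes> t \<otimes> inv (s (g \<otimes> h \<otimes> t))) = conjg g (quot_map a) \<otimes>\<^bsub>Q\<^esub> quot_map b"
      using ab g nD(4) by (simp add: conjg_quot_map quot_map_mult)
  next
    show "(\<lambda>t. conjg g (quot_map (h \<otimes> t \<otimes> inv (s (h \<otimes> t)))) \<otimes>\<^bsub>Q\<^esub>
      quot_map (g \<otimes> s (h \<otimes> t) \<otimes> inv (s (g \<otimes> s (h \<otimes> t))))) \<in> ?R \<rightarrow> carrier Q"
      using term_N g h RY conjg_Q[OF g] by (intro funcsetI Q.m_closed) auto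
  qed simp
  also have "\<dots> = finprod Q (\<lambda>t. conjg g (quot_map (h \<otimes> t \<otimes> inv (s (h \<otimes> t))))) ?R \<otimes>\<^bsub>Q\<^esub>
      finprod Q (\<lambda>t. quot_map (g \<otimes> s (h \<otimes> t) \<otimes> inv (s (g \<otimes> s (h \<otimes> t))))) ?R"
    by (rule Q.finprod_multf) (use term_N g h RY conjg_Q[OF g] in auto)
  also have "finprod Q (\<lambda>t. conjg g (quot_map (h \<otimes> t \<otimes> inv (s (h \<otimes> t))))) ?R = conjg g (delta s h)"
    unfolding delta_def by (rule conjg_finprod[symmetric]) (use g h finR term_N RY in auto)
  also have "finprod Q (\<lambda>t. quot_map (g \<otimes> s (h \<otimes> t) \<otimes> inv (s (g \<otimes> s (h \<otimes> t))))) ?R = delta s g"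
  proof -
    have "delta s g = finprod Q (\<lambda>t. quot_map (g \<otimes> t \<otimes> inv (s (g \<otimes> t)))) ((\<lambda>t. s (h \<otimes> t)) ` ?R)"
      using perm[OF h] by (simp add: delta_def bij_betw_def)
    also have "\<dots> = finprod Q (\<lambda>t. quot_map (g \<otimes> s (h \<otimes> t) \<otimes> inv (s (g \<otimes> s (h \<otimes> t))))) ?R"
      by (rule Q.finprod_reindex) (use perm[OF h] term_N g h RY in \<open>auto simp: bij_betw_def\<close>)
    finally show ?thesis by simp
  qed
  finally show ?thesis .
qed

lemma card_R: "card (s ` Y) = index Y N"
proof -
  have "card Y = (\<Sum>t\<in>s ` Y. card {x \<in> Y. s x = t})"
    unfolding card_eq_sum by (rule sum.image_gen) (use nD(2) in simp)
  also have "\<dots> = (\<Sum>t\<in>s ` Y. card N)"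
  proof (rule sum.cong)
    fix t assume t: "t \<in> s ` Y"
    note tY = RY[OF t]
    have "{x \<in> Y. s x = t} = (\<lambda>n. n \<otimes> t) ` N"
    proof
      show "(\<lambda>n. n \<otimes> t) ` N \<subseteq> {x \<in> Y. s x = t}"
        using tY NY s_eq[of _ t] Rs[OF t] Yc by (auto simp: m_assoc)
      show "{x \<in> Y. s x = t} \<subseteq> (\<lambda>n. n \<otimes> t) ` N"
      proof
        fix x assume x: "x \<in> {x \<in> Y. s x = t}"
        have "x \<otimes> inv t \<in> N" using x sN' by auto
        moreover have "x = (x \<otimes> inv t) \<otimes> t" using x tY Yc by (simp add: m_assoc)
        ultimately show "x \<in> (\<lambda>n. n \<otimes> t) ` N" by blast
      qed
    qed
    moreover have "inj_on (\<lambda>n. n \<otimes> t) N" using tY Yc NY by (auto simp: inj_on_def)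
    ultimately show "card {x \<in> Y. s x = t} = card N" by (simp add: card_image)
  qed simp
  finally have "card (s ` Y) * card N = index Y N * card N"
    unfolding index_card[OF nD(1,2,3)] by simp
  then show ?thesis using card_subgroup_pos[OF nD(1)] by (metis mult_right_cancel less_irrefl)
qed

lemma delta_N: assumes n: "n \<in> N" shows "delta s n = quot_map n [^]\<^bsub>Q\<^esub> index Y N"
proof -
  have "delta s n = finprod Q (\<lambda>t. quot_map n) (s ` Y)"
    unfolding delta_def
  proof (rule Q.finprod_cong')
    fix t assume t: "t \<in> s ` Y"
    note tY = RY[OF t]
    have "s (n \<otimes> t) = s t" by (rule s_eq) (use n NY tY Yc in \<open>auto simp: m_assoc\<close>)
    then have "n \<otimes> t \<otimes> inv (s (n \<otimes> t)) = n" using Rs[OF t] n NY tY Yc by (simp add: m_assoc)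
    then show "quot_map (n \<otimes> t \<otimes> inv (s (n \<otimes> t))) = quot_map n" by simp
  qed (use n in auto)
  also have "\<dots> = quot_map n [^]\<^bsub>Q\<^esub> card (s ` Y)" using n by (intro Q.finprod_const) auto
  finally show ?thesis using card_R by simp
qed

lemma delta_one [simp]: "delta s \<one> = \<one>\<^bsub>Q\<^esub>"
  using delta_N[of \<one>] by (simp add: Q_one[symmetric])

lemma delta_inv_eq:
  assumes g: "g \<in> Y" and h: "h \<in> Y" and e: "delta s g = delta s h" shows "inv g \<otimes> h \<in> delta_ker s"
proof -
  have "delta s h = delta s (g \<otimes> (inv g \<otimes> h))" using g h Yc by simp
  also have "\<dots> = conjg g (delta s (inv g \<otimes> h)) \<otimes>\<^bsub>Q\<^esub> delta s g" using delta_mult g h by simp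
  finally have "\<one>\<^bsub>Q\<^esub> \<otimes>\<^bsub>Q\<^esub> delta s h = conjg g (delta s (inv g \<otimes> h)) \<otimes>\<^bsub>Q\<^esub> delta s h"
    using e h by simp
  then have 1: "conjg g (delta s (inv g \<otimes> h)) = \<one>\<^bsub>Q\<^esub>"
    using g h conjg_Q[of g "delta s (inv g \<otimes> h)"]
      Q.right_cancel[of "delta s h" "\<one>\<^bsub>Q\<^esub>" "conjg g (delta s (inv g \<otimes> h))"] by simp
  obtain n where "n \<in> N" "delta s (inv g \<otimes> h) = quot_map n"
    using delta_closed[of "inv g \<otimes> h"] g h by (auto simp: Q_carrier simp del: delta_closed)
  then have sub: "delta s (inv g \<otimes> h) \<subseteq> carrier G"
    using NY Yc r_coset_subset_G[OF subgroup.subset[OF kD(1)]] by (simp add: quot_map_def)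
  have "delta s (inv g \<otimes> h) = conjg (inv g) (conjg g (delta s (inv g \<otimes> h)))"
    using sub g Yc by (simp add: conjg_inv)
  also have "\<dots> = \<one>\<^bsub>Q\<^esub>" unfolding 1 using conjg_Q_one g by simp
  finally show ?thesis using g h by (simp add: delta_ker_def)
qed

lemma delta_ker_sub: "subgroup (delta_ker s) G"
proof (rule subgroupI)
  show "delta_ker s \<subseteq> carrier G" using Yc by (auto simp: delta_ker_def)
  have "\<one> \<in> delta_ker s" by (simp add: delta_ker_def)
  then show "delta_ker s \<noteq> {}" by blast
  fix a assume a: "a \<in> delta_ker s"
  then show "inv a \<in> delta_ker s" using delta_inv_eq[of a \<one>] Yc by (auto simp: delta_ker_def)
  fix b assume b: "b \<in> delta_ker s"
  then show "a \<otimes> b \<in> delta_ker s"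
    using a delta_mult[of a b] conjg_Q_one by (auto simp: delta_ker_def)
qed

lemma pow_coprime_one:
  assumes "x \<in> carrier Q" "x [^]\<^bsub>Q\<^esub> index Y N = \<one>\<^bsub>Q\<^esub>" shows "x = \<one>\<^bsub>Q\<^esub>"
proof -
  have "Q.ord x dvd index Y N" using assms by (simp add: Q.pow_eq_id)
  moreover have "Q.ord x dvd index N K"
    using Q.ord_dvd_group_order[OF assms(1)] by (simp add: order_def card_Q)
  ultimately have "Q.ord x dvd 1" using coprime by (meson coprime_common_divisor)
  then show ?thesis using Q.ord_eq_1 assms by simp
qed

lemma delta_ker_Int: "delta_ker s \<inter> N = K"
proof
  show "K \<subseteq> delta_ker s \<inter> N"
  proof
    fix k assume k: "k \<in> K"
    then have "quot_map k = \<one>\<^bsub>Q\<^esub>" using quot_map_eq_one KY by blast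
    then show "k \<in> delta_ker s \<inter> N" using k KN KY delta_N by (auto simp: delta_ker_def)
  qed
  show "delta_ker s \<inter> N \<subseteq> K"
  proof
    fix k assume k: "k \<in> delta_ker s \<inter> N"
    then have "quot_map k = \<one>\<^bsub>Q\<^esub>"
      using pow_coprime_one[of "quot_map k"] delta_N by (auto simp: delta_ker_def)
    then show "k \<in> K" using quot_map_eq_one k NY by blast
  qed
qed

text \<open>
  The fibres of a crossed homomorphism are left cosets of its kernel.
\<close>

lemma delta_ker_card_ge: "card Y \<le> card (delta_ker s) * index N K"
proof -
  have "card Y = (\<Sum>c\<in>delta s ` Y. card {x \<in> Y. delta s x = c})"
    unfolding card_eq_sum by (rule sum.image_gen) (use nD(2) in simp)
  also have "\<dots> \<le> (\<Sum>c\<in>delta s ` Y. card (delta_ker s))"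
  proof (rule sum_mono)
    fix c assume "c \<in> delta s ` Y"
    then obtain g where g: "g \<in> Y" "c = delta s g" by blast
    have "{x \<in> Y. delta s x = c} \<subseteq> (\<lambda>k. g \<otimes> k) ` delta_ker s"
    proof
      fix x assume x: "x \<in> {x \<in> Y. delta s x = c}"
      then have "inv g \<otimes> x \<in> delta_ker s" using delta_inv_eq[of g x] g by simp
      moreover have "x = g \<otimes> (inv g \<otimes> x)" using x g Yc by simp
      ultimately show "x \<in> (\<lambda>k. g \<otimes> k) ` delta_ker s" by blast
    qed
    then show "card {x \<in> Y. delta s x = c} \<le> card (delta_ker s)"
      using surj_card_le[OF finite_subgroup[OF delta_ker_sub]] by blast
  qed
  also have "\<dots> = card (delta s ` Y) * card (delta_ker s)" by simp
  also have "\<dots> \<le> index N K * card (delta_ker s)"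
  proof (rule mult_right_mono)
    have "delta s ` Y \<subseteq> carrier Q" using delta_closed by blast
    then show "card (delta s ` Y) \<le> index N K" using card_mono[OF finQ] card_Q by simp
  qed simp
  finally show ?thesis by (simp add: mult.commute)
qed

end

text \<open>
  \<open>S/K\<close> is a complement of \<open>N/K\<close> in \<open>Y/K\<close>.
\<close>

definition complement :: "'a set \<Rightarrow> bool" where
  "complement S \<longleftrightarrow> subgroup S G \<and> S \<subseteq> Y \<and> N \<inter> S = K \<and> N <#> S = Y"

lemma complement_card: assumes "complement S" shows "card Y * card K = card N * card S"
  using card_set_mult[OF nD(1), of S] assms by (simp add: complement_def)

lemma delta_ker_compl:
  assumes s: "transversal s" shows "complement (delta_ker s)"
proof -
  note sub = delta_ker_sub[OF s]
  have kY: "delta_ker s \<subseteq> Y" by (auto simp: delta_ker_def)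
  have i: "N \<inter> delta_ker s = K" using delta_ker_Int[OF s] by blast
  note m = set_mult_subgroup[OF N sub kY]
  have "card (N <#> delta_ker s) * card K = card N * card (delta_ker s)"
    using card_set_mult[OF nD(1) sub] i by simp
  also have "\<dots> = (card (delta_ker s) * index N K) * card K"
    using index_card[OF kD(1) nD(1) KN] by simp
  finally have "card Y \<le> card (N <#> delta_ker s)" using delta_ker_card_ge[OF s] kD(1) by simp
  then have "N <#> delta_ker s = Y" using m nD(2) by (intro card_seteq) auto
  then show ?thesis using sub kY i by (simp add: complement_def)
qed

lemma transversal_ex:
  assumes S: "S \<subseteq> Y" "N <#> S = Y" shows "\<exists>s. transversal s \<and> s ` Y \<subseteq> S"
proof -
  define s where "s x = (SOME y. y \<in> S \<and> y \<otimes> inv x \<in> N)" for x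
  have ex: "\<exists>y. y \<in> S \<and> y \<otimes> inv x \<in> N" if x: "x \<in> Y" for x
  proof -
    obtain n t where nt: "n \<in> N" "t \<in> S" "x = n \<otimes> t" using x S set_multE by metis
    have "t \<otimes> inv x = inv n" using nt S Yc NY by (simp add: word subset_iff)
    then show ?thesis using nt by auto
  qed
  have s: "s x \<in> S" "s x \<otimes> inv x \<in> N" if "x \<in> Y" for x
    using someI_ex[OF ex[OF that]] by (auto simp: s_def)
  have shift: "z \<otimes> inv y \<in> N" if "x \<in> Y" "y \<in> Y" "x \<otimes> inv y \<in> N" "z \<in> S" "z \<otimes> inv x \<in> N" for x y z
  proof -
    have "(z \<otimes> inv x) \<otimes> (x \<otimes> inv y) = z \<otimes> inv y"
      using that(1,2,4) S Yc by (simp add: m_assoc subset_iff)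
    then show ?thesis using Ncl(1)[OF that(5,3)] by simp
  qed
  have "s x = s y" if xy: "x \<in> Y" "y \<in> Y" "x \<otimes> inv y \<in> N" for x y
  proof -
    have "z \<otimes> inv x \<in> N \<longleftrightarrow> z \<otimes> inv y \<in> N" if "z \<in> S" for z
      using shift[OF xy that] shift[OF xy(2,1) same_coset_inv[OF xy] that] by blast
    then show ?thesis unfolding s_def by metis
  qed
  then have "transversal s" unfolding transversal_def using s S by blast
  then show ?thesis using s by blast
qed

text \<open>
  Every complement arises as a kernel: choose the representatives inside it, so that all the
  factors \<open>g t s(g t)\<^sup>-\<^sup>1\<close> with \<open>g\<close> in the complement lie in \<open>N \<inter> S = K\<close>.
\<close>

lemma complement_ker:
  assumes S: "complement S" and s: "transversal s" "s ` Y \<subseteq> S" shows "delta_ker s = S"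
proof -
  have sS: "subgroup S G" "S \<subseteq> Y" and NS: "N \<inter> S = K" using S by (auto simp: complement_def)
  have "S \<subseteq> delta_ker s"
  proof
    fix g assume g: "g \<in> S"
    have "delta s g = finprod Q (\<lambda>t. \<one>\<^bsub>Q\<^esub>) (s ` Y)"
      unfolding delta_def
    proof (rule Q.finprod_cong')
      fix t assume t: "t \<in> s ` Y"
      have tY: "t \<in> Y" "t \<in> S" "g \<in> Y" using RY[OF s(1) t] t s g sS by auto
      have "s (g \<otimes> t) \<in> S" using s tY by auto
      then have "g \<otimes> t \<otimes> inv (s (g \<otimes> t)) \<in> S"
        using g tY by (intro subgroup.m_closed[OF sS(1)] subgroup.m_inv_closed[OF sS(1)]) auto
      moreover have "g \<otimes> t \<otimes> inv (s (g \<otimes> t)) \<in> N" using term_N[OF s(1)] tY by simp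
      ultimately show "quot_map (g \<otimes> t \<otimes> inv (s (g \<otimes> t))) = \<one>\<^bsub>Q\<^esub>"
        using NS quot_map_eq_one KY by blast
    qed auto
    then show "g \<in> delta_ker s" using g sS by (auto simp: delta_ker_def)
  qed
  moreover have "card (delta_ker s) = card S"
    using complement_card[OF delta_ker_compl[OF s(1)]] complement_card[OF S] nD(1) by simp
  ultimately show ?thesis
    using card_subset_eq[OF finite_subgroup[OF delta_ker_sub[OF s(1)]], of S] by simp
qed

text \<open>
  Replacing the representatives \<open>t\<close> by \<open>s' t\<close> changes \<open>\<delta>\<close> by the coboundary of \<open>b\<close>,
  the product of the cosets of \<open>s' t t\<^sup>-\<^sup>1\<close>.
\<close>

lemma delta_change:
  assumes s: "transversal s" and s': "transversal s'"
  shows "\<exists>b\<in>carrier Q. \<forall>g\<in>Y. delta s' g \<otimes>\<^bsub>Q\<^esub> b = conjg g b \<otimes>\<^bsub>Q\<^esub> delta s g"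
proof -
  define u where "u t = quot_map (s' t \<otimes> inv t)" for t
  define R where "R = s ` Y"
  have uQ: "u t \<in> carrier Q" if "t \<in> Y" for t using that sN[OF s'] by (simp add: u_def)
  define b where "b = finprod Q u R"
  have bQ: "b \<in> carrier Q"
    unfolding b_def R_def by (rule Q.finprod_closed) (use uQ RY[OF s] in auto)
  have ss': "s (s' x) = s x" "s' (s x) = s' x" if "x \<in> Y" for x
    using that sN[OF s] sN[OF s'] sY[OF s] sY[OF s'] s_eq[OF s] s_eq[OF s'] by auto
  have R': "s' ` Y = s' ` R" and inj: "inj_on s' R"
  proof -
    show "s' ` Y = s' ` R" unfolding R_def image_image using ss' by auto
    show "inj_on s' R"
    proof (rule inj_onI)
      fix x y assume xy: "x \<in> R" "y \<in> R" "s' x = s' y"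
      then have "s x = s y" using s_eqD[OF s'] s_eq[OF s] RY[OF s] unfolding R_def by metis
      then show "x = y" using xy Rs[OF s] unfolding R_def by metis
    qed
  qed
  have "delta s' g \<otimes>\<^bsub>Q\<^esub> b = conjg g b \<otimes>\<^bsub>Q\<^esub> delta s g" if g: "g \<in> Y" for g
  proof -
    have 1: "delta s' g = finprod Q (\<lambda>t. quot_map (g \<otimes> s' t \<otimes> inv (s' (g \<otimes> s' t)))) R"
      unfolding delta_def R'
      by (rule Q.finprod_reindex) (use term_N[OF s'] RY[OF s] sY[OF s'] g inj in \<open>auto simp: R_def\<close>)
    have 2: "b = finprod Q (\<lambda>t. u (s (g \<otimes> t))) R"
    proof -
      have "b = finprod Q u ((\<lambda>t. s (g \<otimes> t)) ` R)"
        using perm[OF s g] by (simp add: b_def bij_betw_def R_def)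
      also have "\<dots> = finprod Q (\<lambda>t. u (s (g \<otimes> t))) R"
        by (rule Q.finprod_reindex) (use perm[OF s g] uQ g RY[OF s] sY[OF s] in \<open>auto simp: bij_betw_def R_def\<close>)
      finally show ?thesis .
    qed
    have 3: "conjg g b = finprod Q (\<lambda>t. conjg g (u t)) R"
      unfolding b_def by (rule conjg_finprod) (use g finR[OF s] uQ RY[OF s] in \<open>auto simp: R_def\<close>)
    have "delta s' g \<otimes>\<^bsub>Q\<^esub> b = finprod Q (\<lambda>t. quot_map (g \<otimes> s' t \<otimes> inv (s' (g \<otimes> s' t))) \<otimes>\<^bsub>Q\<^esub> u (s (g \<otimes> t))) R"
      unfolding 1 by (subst 2, rule Q.finprod_multf[symmetric])
        (use term_N[OF s'] RY[OF s] sY[OF s] sY[OF s'] g uQ in \<open>auto simp: R_def\<close>)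
    also have "\<dots> = finprod Q (\<lambda>t. conjg g (u t) \<otimes>\<^bsub>Q\<^esub> quot_map (g \<otimes> t \<otimes> inv (s (g \<otimes> t)))) R"
    proof (rule Q.finprod_cong')
      fix t assume "t \<in> R"
      then have t: "t \<in> Y" using RY[OF s] by (simp add: R_def)
      have e: "s' (g \<otimes> s' t) = s' (g \<otimes> t)" "s' (s (g \<otimes> t)) = s' (g \<otimes> t)"
        using s_mult_left[OF s' g t] ss' g t by auto
      have c: "g \<in> carrier G" "t \<in> carrier G" "s' t \<in> carrier G" "s (g \<otimes> t) \<in> carrier G" "s' (g \<otimes> t) \<in> carrier G"
        using g t sY[OF s] sY[OF s'] Yc by auto
      have N1: "g \<otimes> s' t \<otimes> inv (s' (g \<otimes> t)) \<in> N" using term_N[OF s' g sY[OF s' t]] e by simp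
      have N2: "s' (g \<otimes> t) \<otimes> inv (s (g \<otimes> t)) \<in> N"
        using sN[OF s', of "s (g \<otimes> t)"] e g t sY[OF s] by simp
      have N3: "g \<otimes> (s' t \<otimes> inv t) \<otimes> inv g \<in> N" using nD(4) g sN[OF s' t] by simp
      have N4: "g \<otimes> t \<otimes> inv (s (g \<otimes> t)) \<in> N" using term_N[OF s g t] .
      have "quot_map (g \<otimes> s' t \<otimes> inv (s' (g \<otimes> s' t))) \<otimes>\<^bsub>Q\<^esub> u (s (g \<otimes> t))
          = quot_map ((g \<otimes> s' t \<otimes> inv (s' (g \<otimes> t))) \<otimes> (s' (g \<otimes> t) \<otimes> inv (s (g \<otimes> t))))"
        unfolding u_def e using N1 N2 by (simp add: quot_map_mult)
      also have "\<dots> = quot_map ((g \<otimes> (s' t \<otimes> inv t) \<otimes> inv g) \<otimes> (g \<otimes> t \<otimes> inv (s (g \<otimes> t))))"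
        using c by (simp add: m_assoc)
      also have "\<dots> = conjg g (u t) \<otimes>\<^bsub>Q\<^esub> quot_map (g \<otimes> t \<otimes> inv (s (g \<otimes> t)))"
        unfolding u_def using N3 N4 g sN[OF s' t] by (simp add: quot_map_mult conjg_quot_map)
      finally show "quot_map (g \<otimes> s' t \<otimes> inv (s' (g \<otimes> s' t))) \<otimes>\<^bsub>Q\<^esub> u (s (g \<otimes> t)) =
        conjg g (u t) \<otimes>\<^bsub>Q\<^esub> quot_map (g \<otimes> t \<otimes> inv (s (g \<otimes> t)))" .
    next
      show "(\<lambda>t. conjg g (u t) \<otimes>\<^bsub>Q\<^esub> quot_map (g \<otimes> t \<otimes> inv (s (g \<otimes> t)))) \<in> R \<rightarrow> carrier Q"
        using g conjg_Q uQ RY[OF s] term_N[OF s] by (intro funcsetI Q.m_closed) (auto simp: R_def)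
    qed simp
    also have "\<dots> = conjg g b \<otimes>\<^bsub>Q\<^esub> delta s g"
      unfolding 3 delta_def R_def
      by (rule Q.finprod_multf) (use g conjg_Q uQ RY[OF s] term_N[OF s] in auto)
    finally show ?thesis .
  qed
  then show ?thesis using bQ by blast
qed

lemma Q_root: assumes b: "b \<in> carrier Q" shows "\<exists>c\<in>N. quot_map c [^]\<^bsub>Q\<^esub> index Y N = b"
proof -
  obtain k y where "index Y N * k = index N K * y + gcd (index Y N) (index N K)"
    using bezout_nat[of "index Y N" "index N K"] index_pos[OF nD(1,2,3)] by auto
  then have k: "index Y N * k = order Q * y + 1"
    using coprime by (simp add: order_def card_Q coprime_iff_gcd_eq_1 gcd.commute)
  have "b [^]\<^bsub>Q\<^esub> (order Q * y) = \<one>\<^bsub>Q\<^esub>"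
    using b Q.pow_order_eq_1[OF b] by (simp add: Q.nat_pow_pow[symmetric])
  then have "b [^]\<^bsub>Q\<^esub> (index Y N * k) = b"
    unfolding k using b by (simp add: Q.nat_pow_mult[symmetric])
  then have "(b [^]\<^bsub>Q\<^esub> k) [^]\<^bsub>Q\<^esub> index Y N = b" using b by (simp add: Q.nat_pow_pow mult.commute)
  moreover have "b [^]\<^bsub>Q\<^esub> k \<in> carrier Q" using b by simp
  ultimately show ?thesis unfolding Q_carrier by auto
qed

text \<open>
  The two complements are kernels of crossed homomorphisms differing by the coboundary of some
  \<open>b\<close>. Taking roots in \<open>N/K\<close> gives \<open>c\<close> in \<open>N\<close> with \<open>\<delta>(c) = b\<close>, and then
  \<open>\<delta>(c\<^sup>-\<^sup>1 g c) = \<delta>'(g)\<close> for all \<open>g\<close>.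
\<close>

theorem complement_conj:
  assumes S: "complement S" and S': "complement S'" shows "\<exists>c\<in>N. S' = conjg c S"
proof -
  obtain s where s: "transversal s" "s ` Y \<subseteq> S"
    using transversal_ex[of S] S unfolding complement_def by blast
  obtain s' where s': "transversal s'" "s' ` Y \<subseteq> S'"
    using transversal_ex[of S'] S' unfolding complement_def by blast
  have k: "delta_ker s = S" "delta_ker s' = S'" using complement_ker S S' s s' by auto
  obtain b where b: "b \<in> carrier Q" and bd: "\<And>g. g \<in> Y \<Longrightarrow> delta s' g \<otimes>\<^bsub>Q\<^esub> b = conjg g b \<otimes>\<^bsub>Q\<^esub> delta s g"
    using delta_change[OF s(1) s'(1)] by blast
  obtain c where c: "c \<in> N" "delta s c = b" using Q_root[OF b] delta_N[OF s(1)] by metis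
  have cY: "c \<in> Y" "inv c \<in> N" "c \<in> carrier G" using c NY Yc by auto
  have d: "delta s (inv c \<otimes> g \<otimes> c) = delta s' g" if g: "g \<in> Y" for g
  proof -
    note dc = delta_closed[OF s(1)] delta_closed[OF s'(1)]
    have e: "delta s (g \<otimes> c) = delta s' g \<otimes>\<^bsub>Q\<^esub> b"
      using delta_mult[OF s(1) g cY(1)] bd[OF g] c by simp
    have "\<one>\<^bsub>Q\<^esub> = delta s (inv c \<otimes> c)" using cY delta_one[OF s(1)] by simp
    also have "\<dots> = conjg (inv c) (delta s c) \<otimes>\<^bsub>Q\<^esub> delta s (inv c)"
      by (rule delta_mult[OF s(1)]) (use cY in auto)
    also have "\<dots> = b \<otimes>\<^bsub>Q\<^esub> delta s (inv c)" using conjg_Q_N[of "inv c" b] cY b c by simp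
    finally have bi: "b \<otimes>\<^bsub>Q\<^esub> delta s (inv c) = \<one>\<^bsub>Q\<^esub>" by simp
    have "delta s (inv c \<otimes> g \<otimes> c) = delta s (inv c \<otimes> (g \<otimes> c))" using g cY Yc by (simp add: m_assoc)
    also have "\<dots> = conjg (inv c) (delta s (g \<otimes> c)) \<otimes>\<^bsub>Q\<^esub> delta s (inv c)"
      using delta_mult[OF s(1)] g cY by simp
    also have "\<dots> = delta s (g \<otimes> c) \<otimes>\<^bsub>Q\<^esub> delta s (inv c)" using conjg_Q_N[of "inv c"] dc g cY by simp
    also have "\<dots> = delta s' g" unfolding e using bi dc g b cY by (simp add: Q.m_assoc)
    finally show ?thesis .
  qed
  have "S' \<subseteq> conjg c S"
  proof
    fix g assume g: "g \<in> S'"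
    have gY: "g \<in> Y" "delta s' g = \<one>\<^bsub>Q\<^esub>" using g k by (auto simp: delta_ker_def)
    have "inv c \<otimes> g \<otimes> c \<in> S" using d[OF gY(1)] gY cY k by (auto simp: delta_ker_def)
    moreover have "g = c \<otimes> (inv c \<otimes> g \<otimes> c) \<otimes> inv c" using gY cY Yc by (simp add: m_assoc)
    ultimately show "g \<in> conjg c S" by (auto simp: conjg_def)
  qed
  moreover have "subgroup S G" using S by (simp add: complement_def)
  moreover have "card S' = card S" using complement_card[OF S] complement_card[OF S'] nD(1) by simp
  ultimately have "S' = conjg c S"
    using cY conjg_subgroup[of c S] by (intro card_subset_eq) (auto simp: subgroup.subset)
  then show ?thesis using c by blast
qed

theorem complement_ex: "\<exists>S. complement S"
proof -
  have "N <#> Y = Y" using set_mult_subgroup[OF N nD(2)] by auto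
  then show ?thesis using transversal_ex[OF subset_refl] delta_ker_compl by blast
qed

end

section \<open>Hall subgroups of sigma-soluble groups\<close>

lemma middle_factor_less:
  fixes a b c :: nat
  assumes "a \<noteq> 1 \<or> c \<noteq> 1" "0 < a" "0 < b" "0 < c" shows "b < a * b * c"
proof -
  have "a * c \<noteq> 1" "a * c \<noteq> 0" using assms by auto
  then have "1 < a * c" by linarith
  then have "b * 1 < b * (a * c)" using assms by (simp only: mult_less_cancel1)
  then show ?thesis by (simp add: mult_ac)
qed

context fin_group begin

lemma abelian_sectionI:
  assumes "normal_in K Y" "normal_in N Y" "K \<subseteq> N"
    and "\<And>a b. a \<in> N \<Longrightarrow> b \<in> N \<Longrightarrow> a \<otimes> b \<otimes> inv a \<otimes> inv b \<in> K"
    and "coprime (index N K) (index Y N)"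
  shows "abelian_section G K N Y"
  by unfold_locales (use assms in auto)

text \<open>
  The core in \<open>Y\<close> of the subgroup \<open>M\<close> from \<open>p_section_abelian_top\<close> contains all
  commutators of \<open>L\<close>, and it is \<open>K\<close> because \<open>L/K\<close> is a chief factor.
\<close>

lemma chief_p_section_abelian:
  assumes p: "prime p" and K: "normal_in K Y" and L: "normal_in L Y" "K \<subseteq> L" "K \<noteq> L"
    and chief: "\<And>D. normal_in D Y \<Longrightarrow> K \<subseteq> D \<Longrightarrow> D \<subseteq> L \<Longrightarrow> D = K \<or> D = L"
    and pi: "pi_number {p} (index L K)"
    and ab: "a \<in> L" "b \<in> L"
  shows "a \<otimes> b \<otimes> inv a \<otimes> inv b \<in> K"
proof -
  note k = normal_inD[OF K] and l = normal_inD[OF L(1)]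
  have KL: "normal_in K L" using normal_in_mono[OF K l(1) L(2) l(3)] .
  obtain M where M: "normal_in M L" "K \<subseteq> M" "M \<noteq> L"
    and com: "\<And>x y. x \<in> L \<Longrightarrow> y \<in> L \<Longrightarrow> x \<otimes> y \<otimes> inv x \<otimes> inv y \<in> M"
    using p_section_abelian_top[OF p KL L(3) pi] by blast
  note m = normal_inD[OF M(1)]
  have MY: "M \<subseteq> Y" using m l by blast
  note c = core_in_props[OF k(2) m(1) MY]
  have "K \<subseteq> core_in Y M" using c(3)[OF K M(2)] .
  moreover have "core_in Y M \<noteq> L" "core_in Y M \<subseteq> L" using c(2) m(3) M(3) by auto
  ultimately have e: "core_in Y M = K" using chief[OF c(1)] by blast
  have cc: "z \<in> carrier G" if "z \<in> Y" for z using that l subgroup_carrier by blast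
  have "a \<otimes> b \<otimes> inv a \<otimes> inv b \<in> core_in Y M"
    unfolding core_in_def
  proof (intro CollectI conjI ballI)
    have "a \<in> Y" "b \<in> Y" using ab l by auto
    then show "a \<otimes> b \<otimes> inv a \<otimes> inv b \<in> Y"
      by (simp add: subgroup.m_closed[OF l(2)] subgroup.m_inv_closed[OF l(2)])
    fix y assume y: "y \<in> Y"
    have "(y \<otimes> a \<otimes> inv y) \<otimes> (y \<otimes> b \<otimes> inv y) \<otimes> inv (y \<otimes> a \<otimes> inv y) \<otimes> inv (y \<otimes> b \<otimes> inv y) \<in> M"
      using com l(4) y ab by blast
    moreover have "a \<in> carrier G" "b \<in> carrier G" "y \<in> carrier G" using ab y l cc by auto
    ultimately show "y \<otimes> (a \<otimes> b \<otimes> inv a \<otimes> inv b) \<otimes> inv y \<in> M" by (simp add: word)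
  qed
  then show ?thesis using e by simp
qed

lemma frattini_mod:
  assumes p: "prime p" and K: "normal_in K Y" and L: "normal_in L Y" "K \<subseteq> L" and P: "hall {p} P L"
  shows "L <#> normalizer_in Y (K <#> P) = Y"
proof (rule frattini[OF L(1)])
  note k = normal_inD[OF K] and l = normal_inD[OF L(1)] and h = hallD[OF P]
  note kp = set_mult_subgroup[OF normal_in_mono[OF K l(1) L(2) l(3)] h(1,3)]
  show "K <#> P \<subseteq> carrier G" using subgroup.subset[OF kp(1)] .
  fix g assume g: "g \<in> Y"
  obtain n where n: "n \<in> L" "conjg g P = conjg n P" using sylow_conj_normal[OF p L(1) P g] by blast
  have gc: "g \<in> carrier G" "n \<in> carrier G" "n \<in> Y" using g n l subgroup_carrier by blast+
  have "conjg g (K <#> P) = conjg n (K <#> P)"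
    using gc g n conjg_normal[OF K] subgroup.subset[OF k(1)] subgroup.subset[OF h(1)]
    by (simp add: conjg_set_mult)
  then show "\<exists>n\<in>L. conjg g (K <#> P) = conjg n (K <#> P)" using n by blast
qed

text \<open>
  Normality of \<open>K P\<close> forces \<open>K P = L\<close>.
\<close>

lemma chief_p_number:
  assumes p: "prime p" "p dvd index L K" and K: "normal_in K Y" and L: "normal_in L Y" "K \<subseteq> L"
    and chief: "\<And>D. normal_in D Y \<Longrightarrow> K \<subseteq> D \<Longrightarrow> D \<subseteq> L \<Longrightarrow> D = K \<or> D = L"
    and P: "hall {p} P L" and KP: "normal_in (K <#> P) Y"
  shows "pi_number {p} (index L K)"
proof -
  note k = normal_inD[OF K] and l = normal_inD[OF L(1)] and h = hallD[OF P]
  have KL: "normal_in K L" using normal_in_mono[OF K l(1) L(2) l(3)] .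
  note kp = set_mult_subgroup[OF KL h(1,3)]
  have "K <#> P \<noteq> K"
  proof
    assume "K <#> P = K"
    then have "P \<subseteq> K" using kp by simp
    then have "index L K dvd index L P" using index_mult[of P K L] h k l L by auto
    then show False using p h(5) dvd_trans by (auto simp: pi_number_def)
  qed
  then have "K <#> P = L" using chief[OF KP] kp by blast
  then have "index L K = index P (K \<inter> P)" using index_second_iso(1)[OF KL h(1,3)] by simp
  then have "index L K dvd card P" using index_dvd_card[of "K \<inter> P" P] k h by simp
  then show ?thesis using h(4) pi_number_dvd by blast
qed

end

locale sigma_fin_group = fin_group +
  fixes \<sigma> :: "nat set set"
  assumes partition: "prime_partition \<sigma>"
begin

text \<open>
  Applied to an index, this says that the corresponding section is \<open>\<sigma>\<close>-primary.
\<close>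

definition primary :: "nat \<Rightarrow> bool" where
  "primary m \<longleftrightarrow> (\<exists>s\<in>\<sigma>. pi_number s m)"

lemma primary_dvd: "primary m \<Longrightarrow> k dvd m \<Longrightarrow> primary k"
  unfolding primary_def using pi_number_dvd by blast

lemma class_of_prime: "prime p \<Longrightarrow> \<exists>s\<in>\<sigma>. p \<in> s"
  using partition by (auto simp: prime_partition_def)

lemma classes_disjoint: "s \<in> \<sigma> \<Longrightarrow> t \<in> \<sigma> \<Longrightarrow> s \<noteq> t \<Longrightarrow> s \<inter> t = {}"
  using partition by (auto simp: prime_partition_def disjoint_def)

lemma primary_1 [simp]: "primary (Suc 0)"
  using class_of_prime[OF two_is_prime_nat] by (auto simp: primary_def)

text \<open>
  \<open>\<sigma>\<close>-solubility is used as the existence of a normal series with \<open>\<sigma>\<close>-primary factors. In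
  contrast to the condition on chief factors this is inherited by subgroups at once, by
  intersecting the series.
\<close>

inductive series_term :: "'a set \<Rightarrow> 'a set \<Rightarrow> bool" for Y where
  series_term_one: "series_term Y {\<one>}"
| series_term_step: "series_term Y N \<Longrightarrow> normal_in N Y \<Longrightarrow> normal_in M Y \<Longrightarrow> N \<subseteq> M \<Longrightarrow> primary (index M N) \<Longrightarrow> series_term Y M"

definition sigma_sol :: "'a set \<Rightarrow> bool" where
  "sigma_sol Y \<longleftrightarrow> subgroup Y G \<and> series_term Y Y"

text \<open>
  Intersect the series with \<open>D\<close>, and multiply the first term not inside \<open>K\<close> by \<open>K\<close>.
\<close>

lemma sigma_sol_step:
  assumes Y: "sigma_sol Y" and K: "normal_in K Y" and D: "normal_in D Y" "K \<subseteq> D" "K \<noteq> D"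
  shows "\<exists>M. normal_in M Y \<and> K \<subset> M \<and> M \<subseteq> D \<and> primary (index M K)"
proof -
  note k = normal_inD[OF K] and d = normal_inD[OF D(1)]
  have "\<not> N \<inter> D \<subseteq> K \<Longrightarrow> ?thesis" if "series_term Y N" for N
    using that
  proof (induction rule: series_term.induct)
    case series_term_one
    then show ?case using subgroup.one_closed[OF k(1)] by auto
  next
    case (series_term_step N M)
    note n = normal_inD[OF series_term_step(2)] and m = normal_inD[OF series_term_step(3)]
    show ?case
    proof (cases "N \<inter> D \<subseteq> K")
      case True
      have MD: "normal_in (M \<inter> D) Y" using normal_in_Int[OF series_term_step(3) D(1)] .
      note md = normal_inD[OF MD]
      let ?M = "K <#> (M \<inter> D)"
      have a: "normal_in ?M Y" using set_mult_normal[OF K MD] .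
      note b = set_mult_subgroup[OF K md(1,3)]
      have c: "?M \<subseteq> D" by (rule set_mult_least[OF d(1) D(2)]) auto
      have "index ?M K = index (M \<inter> D) (K \<inter> (M \<inter> D))" using index_second_iso[OF K md(1,3)] by simp
      also have "\<dots> dvd index (M \<inter> D) (N \<inter> (M \<inter> D))"
      proof -
        have "N \<inter> (M \<inter> D) \<subseteq> K \<inter> (M \<inter> D)" using True by blast
        then have "index (M \<inter> D) (N \<inter> (M \<inter> D)) =
          index (M \<inter> D) (K \<inter> (M \<inter> D)) * index (K \<inter> (M \<inter> D)) (N \<inter> (M \<inter> D))"
          using n k md by (intro index_mult) auto
        then show ?thesis by simp
      qed
      also have "\<dots> dvd index M N"
        by (rule index_Int_dvd[OF normal_in_mono[OF series_term_step(2) m(1) series_term_step(4) m(3)] md(1)]) auto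
      finally have "primary (index ?M K)" using primary_dvd series_term_step(5) by blast
      moreover have "K \<noteq> ?M" using b(4) series_term_step.prems by blast
      ultimately show ?thesis using a b(3) c by blast
    qed (rule series_term_step.IH)
  qed
  moreover have "\<not> Y \<inter> D \<subseteq> K" using d D by blast
  ultimately show ?thesis using Y by (auto simp: sigma_sol_def)
qed

lemma sigma_sol_chief:
  assumes Y: "sigma_sol Y" and K: "normal_in K Y" and D: "normal_in D Y" "K \<subseteq> D" "K \<noteq> D"
  obtains L where "normal_in L Y" "K \<subset> L" "L \<subseteq> D" "primary (index L K)"
    "\<And>E. normal_in E Y \<Longrightarrow> K \<subseteq> E \<Longrightarrow> E \<subseteq> L \<Longrightarrow> E = K \<or> E = L"
proof -
  let ?S = "{M. normal_in M Y \<and> K \<subset> M \<and> M \<subseteq> D}"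
  have fS: "finite ?S" using normal_inD(1)[OF D(1)] by (intro finite_subset[of ?S "Pow D"]) auto
  obtain M where M: "M \<in> ?S" "primary (index M K)" using sigma_sol_step[OF assms] by blast
  obtain L where L: "L \<in> ?S" "L \<subseteq> M" "\<forall>b\<in>?S. b \<subseteq> L \<longrightarrow> L = b"
    using finite_has_minimal2[OF fS M(1)] by (elim bexE conjE)
  have "index L K dvd index M K"
    using index_mult[of K L M] L(1,2) M(1) normal_inD(1)[OF K] normal_inD(1)[of L Y] normal_inD(1)[of M Y]
    by (simp add: psubset_imp_subset)
  then have "primary (index L K)" by (rule primary_dvd[OF M(2)])
  moreover have "E = K \<or> E = L" if E: "normal_in E Y" "K \<subseteq> E" "E \<subseteq> L" for E
  proof (cases "E = K")
    case False
    have "L \<subseteq> D" using L(1) by simp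
    with E False have "E \<in> ?S" by auto
    then show ?thesis using L(3) E(3) by auto
  qed simp
  moreover have "normal_in L Y" "K \<subset> L" "L \<subseteq> D" using L(1) by auto
  ultimately show ?thesis using that[of L] by metis
qed

lemma sigma_sol_subgroup:
  assumes Y: "sigma_sol Y" and X: "subgroup X G" "X \<subseteq> Y" shows "sigma_sol X"
proof -
  have "series_term X (N \<inter> X)" if "series_term Y N" for N
    using that
  proof (induction rule: series_term.induct)
    case series_term_one
    have "{\<one>} \<inter> X = {\<one>}" using subgroup.one_closed[OF X(1)] by blast
    then show ?case using series_term.series_term_one by simp
  next
    case (series_term_step N M)
    note n = normal_inD[OF series_term_step(2)] and m = normal_inD[OF series_term_step(3)]
    have "index (M \<inter> X) (N \<inter> (M \<inter> X)) dvd index M N"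
      by (rule index_Int_dvd[OF normal_in_mono[OF series_term_step(2) m(1) series_term_step(4) m(3)]]) (use m X in auto)
    moreover have "N \<inter> (M \<inter> X) = N \<inter> X" using series_term_step(4) by blast
    ultimately have "primary (index (M \<inter> X) (N \<inter> X))" using series_term_step(5) primary_dvd by metis
    then show ?case using series_term_step(2-4) X
      by (intro series_term.series_term_step[OF series_term_step.IH] normal_in_Int_sub) auto
  qed
  moreover have "Y \<inter> X = X" using X by blast
  ultimately show ?thesis using Y X by (metis sigma_sol_def)
qed

text \<open>
  \<open>\<pi>\<close> consists of whole classes up to elements that are not prime. This covers the single
  classes and their complements.
\<close>

definition class_closed :: "nat set \<Rightarrow> bool" where
  "class_closed \<pi> \<longleftrightarrow> (\<forall>s\<in>\<sigma>. s \<subseteq> \<pi> \<or> s \<inter> \<pi> = {})"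

lemma class_closed_class: "s \<in> \<sigma> \<Longrightarrow> class_closed s"
  unfolding class_closed_def using classes_disjoint by blast

lemma class_closed_compl: "class_closed \<pi> \<Longrightarrow> class_closed (- \<pi>)"
  unfolding class_closed_def by blast

lemma class_closed_primary: "class_closed \<pi> \<Longrightarrow> primary m \<Longrightarrow> pi_number \<pi> m \<or> pi_number (- \<pi>) m"
  unfolding class_closed_def primary_def by (meson disjoint_eq_subset_Compl pi_number_mono)

text \<open>
  The assertion is that \<open>Y/K\<close> has a Hall \<open>\<pi>\<close>-subgroup. In the critical case \<open>L/K\<close> is a chief
  factor of order prime to \<open>\<pi>\<close> and \<open>Y/L\<close> is a \<open>\<pi>\<close>-group. If a Sylow subgroup of \<open>L/K\<close> is
  not normal in \<open>Y/K\<close>, its normaliser is a proper subgroup whose index is prime to \<open>\<pi>\<close> by the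
  Frattini argument, and induction applies to it. Otherwise \<open>L/K\<close> is an abelian \<open>p\<close>-group.
  In this way chief factors that are not abelian never meet the Schur-Zassenhaus theorem.
\<close>

lemma hall_section_ex:
  assumes "class_closed \<pi>" "sigma_sol Y" "normal_in K Y"
  shows "\<exists>S. subgroup S G \<and> K \<subseteq> S \<and> S \<subseteq> Y \<and> pi_number \<pi> (index S K) \<and> pi_number (- \<pi>) (index Y S)"
  using assms(2,3)
proof (induction "index Y K" arbitrary: Y K rule: less_induct)
  case less
  note k = normal_inD[OF less.prems(2)]
  show ?case
  proof (cases "K = Y")
    case True
    then show ?thesis using k by (intro exI[of _ Y]) auto
  next
    case False
    obtain L where L: "normal_in L Y" "K \<subset> L" "primary (index L K)"
      and chief: "\<And>E. normal_in E Y \<Longrightarrow> K \<subseteq> E \<Longrightarrow> E \<subseteq> L \<Longrightarrow> E = K \<or> E = L"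
      by (rule sigma_sol_chief[OF less.prems normal_in_refl[OF k(2)] k(3) False]) blast
    note l = normal_inD[OF L(1)]
    have lt: "index Z W < index Y K"
      if "subgroup Z G" "subgroup W G" "K \<subseteq> W" "W \<subseteq> Z" "Z \<subseteq> Y" "W \<noteq> K \<or> Z \<noteq> Y" for Z W
    proof -
      have "index Y K = index Y Z * index Z W * index W K"
        using index_mult[of K Z Y] index_mult[of K W Z] that k by auto
      moreover have "index Y Z \<noteq> 1 \<or> index W K \<noteq> 1" using index_eq_1 that k by metis
      moreover have "0 < index Y Z" "0 < index Z W" "0 < index W K" using index_pos that k by auto
      ultimately show ?thesis using middle_factor_less by metis
    qed
    have "index Y L < index Y K" using lt[of Y L] l L by auto
    from less.hyps[OF this less.prems(1) L(1)] obtain S where S: "subgroup S G" "L \<subseteq> S" "S \<subseteq> Y"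
      "pi_number \<pi> (index S L)" "pi_number (- \<pi>) (index Y S)" by blast
    consider "pi_number \<pi> (index L K)" | "pi_number (- \<pi>) (index L K)"
      using class_closed_primary[OF assms(1) L(3)] by blast
    then show ?thesis
    proof cases
      case 1
      then have "pi_number \<pi> (index S K)" using index_mult[of K L S] k l S L by auto
      then show ?thesis using S L by blast
    next
      case 2
      show ?thesis
      proof (cases "S = Y")
        case False
        have KS: "normal_in K S" using normal_in_mono[OF less.prems(2) S(1)] S L by blast
        have "index S K < index Y K" using lt[of S K] S k KS False normal_inD[OF KS] by auto
        from less.hyps[OF this sigma_sol_subgroup[OF less.prems(1) S(1,3)] KS]
        obtain T where T: "subgroup T G" "K \<subseteq> T" "T \<subseteq> S" "pi_number \<pi> (index T K)" "pi_number (- \<pi>) (index S T)"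
          by blast
        then have "pi_number (- \<pi>) (index Y T)" using index_mult[of T S Y] S k by auto
        then show ?thesis using T S by blast
      next
        case True
        have piYL: "pi_number \<pi> (index Y L)" using S True by simp
        have "index L K \<noteq> 1" using index_eq_1 k l L by blast
        then obtain p where p: "prime p" "p dvd index L K" using prime_factor_nat by blast
        obtain P where P: "hall {p} P L" using sylow_ex[OF p(1) l(1)] by blast
        note h = hallD[OF P]
        have KL: "normal_in K L" using normal_in_mono[OF less.prems(2) l(1)] L l by blast
        note kp = set_mult_subgroup[OF KL h(1,3)]
        let ?KP = "K <#> P"
        define T where "T = normalizer_in Y ?KP"
        have KPY: "?KP \<subseteq> Y" using kp l by blast
        note t = normalizer_in_props[OF k(2) kp(1) KPY, folded T_def]
        have sT: "subgroup T G"
          unfolding T_def using normalizer_in_subgroup[OF k(2)] subgroup.subset[OF kp(1)] by blast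
        have LT: "L <#> T = Y"
          unfolding T_def using frattini_mod[OF p(1) less.prems(2) L(1) _ P] L by blast
        have iT: "pi_number (- \<pi>) (index Y T)"
        proof -
          have "index Y T = index L (L \<inter> T)" using index_second_iso(2)[OF L(1) sT t(3)] LT by simp
          also have "\<dots> dvd index L K" using index_mult[of K "L \<inter> T" L] k l sT L kp t by auto
          finally show ?thesis using 2 pi_number_dvd by blast
        qed
        have KT: "normal_in K T" using normal_in_mono[OF less.prems(2) sT] kp t by blast
        show ?thesis
        proof (cases "T = Y")
          case False
          have "index T K < index Y K" using lt[of T K] sT k normal_inD[OF KT] False t by auto
          from less.hyps[OF this sigma_sol_subgroup[OF less.prems(1) sT t(3)] KT]
          obtain U where U: "subgroup U G" "K \<subseteq> U" "U \<subseteq> T" "pi_number \<pi> (index U K)" "pi_number (- \<pi>) (index T U)"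
            by blast
          then have "pi_number (- \<pi>) (index Y U)" using index_mult[of U T Y] sT k t iT by auto
          then show ?thesis using U t by blast
        next
          case True
          then have KPn: "normal_in ?KP Y" using t(2) by simp
          have pi: "pi_number {p} (index L K)"
            using chief_p_number[OF p less.prems(2) L(1) _ chief P KPn] L by blast
          interpret s: abelian_section G K L Y
          proof (rule abelian_sectionI[OF less.prems(2) L(1)])
            show "K \<subseteq> L" using L by blast
            show "a \<otimes> b \<otimes> inv a \<otimes> inv b \<in> K" if "a \<in> L" "b \<in> L" for a b
              using chief_p_section_abelian[OF p(1) less.prems(2) L(1) _ _ chief pi that] L by blast
            show "coprime (index L K) (index Y L)"
              using pi_number_coprime piYL 2 coprime_commute by metis
          qed
          obtain U where "s.complement U" using s.complement_ex by blast
          then have U: "subgroup U G" "U \<subseteq> Y" "L \<inter> U = K" "L <#> U = Y"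
            by (auto simp: s.complement_def)
          have "index U K = index Y L" "index Y U = index L K"
            using index_second_iso[OF L(1) U(1,2)] U by auto
          then show ?thesis using U piYL 2 by (intro exI[of _ U]) auto
        qed
      qed
    qed
  qed
qed

lemma hall_ex:
  assumes "class_closed \<pi>" "sigma_sol Y" shows "\<exists>H. hall \<pi> H Y"
proof -
  have "subgroup Y G" using assms by (simp add: sigma_sol_def)
  then show ?thesis using hall_section_ex[OF assms normal_in_one] unfolding hall_def by auto
qed

lemma order_section:
  assumes "normal_in K H" shows "card (carrier ((G\<lparr>carrier := H\<rparr>) Mod K)) = index H K"
proof -
  note k = normal_inD[OF assms]
  have "subgroup K (G\<lparr>carrier := H\<rparr>)" using subgroup_incl[OF k(1,2,3)] .
  from group.lagrange[OF subgroup_imp_group[OF k(2)] this]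
  have "card (carrier ((G\<lparr>carrier := H\<rparr>) Mod K)) * card K = card H"
    by (simp add: FactGroup_def order_def)
  then show ?thesis using index_card[OF k(1,2,3)] card_subgroup_pos[OF k(1)]
    by (metis mult_right_cancel less_irrefl)
qed

lemma sigma_primary_primary:
  assumes "sigma_primary \<sigma> X" "order X = m" shows "primary m"
proof (cases "carrier X = {\<one>\<^bsub>X\<^esub>}")
  case True
  then have "m = 1" using assms by (simp add: order_def)
  then show ?thesis by simp
next
  case False
  then obtain s where s: "sigma_classes \<sigma> X = {s}"
    using assms card_1_singletonE by (auto simp: sigma_primary_def)
  have "p \<in> s" if p: "prime p" "p dvd m" for p
  proof -
    obtain t where t: "t \<in> \<sigma>" "p \<in> t" using class_of_prime p by blast
    then have "t \<in> sigma_classes \<sigma> X" using p assms by (auto simp: sigma_classes_def prime_divs_def)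
    then show ?thesis using s t by simp
  qed
  moreover have "s \<in> \<sigma>" using s by (auto simp: sigma_classes_def)
  ultimately show ?thesis by (auto simp: primary_def pi_number_def)
qed

text \<open>
  A largest term of a normal series with \<open>\<sigma>\<close>-primary factors is the whole group, since a chief
  factor above it would extend the series.
\<close>

lemma sigma_soluble_sigma_sol:
  assumes "sigma_soluble \<sigma> G" shows "sigma_sol (carrier G)"
proof -
  let ?S = "{N. series_term (carrier G) N \<and> normal_in N (carrier G)}"
  have "finite ?S" using fin normal_inD(3) by (intro finite_subset[of ?S "Pow (carrier G)"]) auto
  moreover have "{\<one>} \<in> ?S" using series_term_one normal_in_one[OF subgroup_self] by blast
  ultimately obtain N where N: "N \<in> ?S" and max: "\<forall>b\<in>?S. N \<subseteq> b \<longrightarrow> N = b"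
    using finite_has_maximal2[of ?S "{\<one>}"] by blast
  have "N = carrier G"
  proof (rule ccontr)
    assume ne: "N \<noteq> carrier G"
    let ?T = "{M. normal_in M (carrier G) \<and> N \<subset> M}"
    have "finite ?T" using fin normal_inD(3) by (intro finite_subset[of ?T "Pow (carrier G)"]) auto
    moreover have "carrier G \<in> ?T"
      using normal_in_refl[OF subgroup_self] ne N normal_inD(3) by blast
    ultimately obtain M where M: "M \<in> ?T" and min: "\<forall>b\<in>?T. b \<subseteq> M \<longrightarrow> M = b"
      using finite_has_minimal2[of ?T "carrier G"] by blast
    have "chief_factor G M N"
      using N M min unfolding chief_factor_def normal_in_carrier_iff by blast
    then have "sigma_primary \<sigma> ((G\<lparr>carrier := M\<rparr>) Mod N)"
      using assms by (simp add: sigma_soluble_def)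
    moreover have "normal_in N M" using normal_in_mono[of N "carrier G" M] N M normal_inD by blast
    ultimately have "primary (index M N)"
      using sigma_primary_primary order_section unfolding order_def by blast
    then have "M \<in> ?S" using series_term_step[of "carrier G" N M] N M by blast
    then show False using max M by blast
  qed
  then show ?thesis using N subgroup_self by (simp add: sigma_sol_def)
qed

end

section \<open>Maximal chains\<close>

context fin_group begin

definition maximal_in :: "'a set \<Rightarrow> 'a set \<Rightarrow> bool" where
  "maximal_in M Y \<longleftrightarrow> subgroup M G \<and> subgroup Y G \<and> M \<subseteq> Y \<and> M \<noteq> Y \<and>
     (\<forall>L. subgroup L G \<and> M \<subseteq> L \<and> L \<subseteq> Y \<longrightarrow> L = M \<or> L = Y)"

lemma maximal_inD:
  assumes "maximal_in M Y"
  shows "subgroup M G" "subgroup Y G" "M \<subseteq> Y" "M \<noteq> Y"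
    and "\<And>L. subgroup L G \<Longrightarrow> M \<subseteq> L \<Longrightarrow> L \<subseteq> Y \<Longrightarrow> L = M \<or> L = Y"
  using assms by (auto simp: maximal_in_def)

lemma maximal_in_ex:
  assumes X: "subgroup X G" "X \<subseteq> Y" "X \<noteq> Y" and Y: "subgroup Y G"
  shows "\<exists>M. maximal_in M Y \<and> X \<subseteq> M"
proof -
  let ?S = "{M. subgroup M G \<and> X \<subseteq> M \<and> M \<subseteq> Y \<and> M \<noteq> Y}"
  have fS: "finite ?S" using Y by (intro finite_subset[of ?S "Pow Y"]) auto
  have "X \<in> ?S" using X by simp
  then obtain M where M: "M \<in> ?S" "\<forall>b\<in>?S. M \<subseteq> b \<longrightarrow> M = b"
    by (rule bexE[OF finite_has_maximal2[OF fS]]) (elim conjE)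
  have "L = M \<or> L = Y" if L: "subgroup L G" "M \<subseteq> L" "L \<subseteq> Y" for L
  proof (cases "L = Y")
    case False
    then have "L \<in> ?S" using L M(1) by auto
    then show ?thesis using M(2) L(2) by auto
  qed simp
  then have "maximal_in M Y" using M(1) Y unfolding maximal_in_def by blast
  then show ?thesis using M(1) by blast
qed

lemma maximal_in_above_ex:
  assumes X: "subgroup X G" "X \<subseteq> Y" "X \<noteq> Y" and Y: "subgroup Y G"
  shows "\<exists>Z. maximal_in X Z \<and> Z \<subseteq> Y"
proof -
  let ?S = "{Z. subgroup Z G \<and> X \<subseteq> Z \<and> Z \<subseteq> Y \<and> X \<noteq> Z}"
  have fS: "finite ?S" using Y by (intro finite_subset[of ?S "Pow Y"]) auto
  have "Y \<in> ?S" using X Y by simp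
  then obtain Z where Z: "Z \<in> ?S" "\<forall>b\<in>?S. b \<subseteq> Z \<longrightarrow> Z = b"
    by (rule bexE[OF finite_has_minimal2[OF fS]]) (elim conjE)
  have "L = X \<or> L = Z" if L: "subgroup L G" "X \<subseteq> L" "L \<subseteq> Z" for L
  proof (cases "L = X")
    case False
    then have "L \<in> ?S" using L Z(1) by auto
    then show ?thesis using Z(2) L(3) by auto
  qed simp
  then have "maximal_in X Z" using Z(1) X unfolding maximal_in_def by blast
  then show ?thesis using Z(1) by blast
qed

text \<open>
  The chain grows at its lower end, as in the definition of \<open>k\<close>-maximal subgroups, but the
  length \<open>0\<close> is admitted.
\<close>

inductive max_chain :: "nat \<Rightarrow> 'a set \<Rightarrow> 'a set \<Rightarrow> bool" where
  max_chain_0: "subgroup Y G \<Longrightarrow> max_chain 0 Y Y"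
| max_chain_Suc: "max_chain k Y Z \<Longrightarrow> maximal_in X Z \<Longrightarrow> max_chain (Suc k) Y X"

lemma max_chain_sub: "max_chain k Y X \<Longrightarrow> subgroup X G \<and> subgroup Y G \<and> X \<subseteq> Y"
  by (induction rule: max_chain.induct) (auto dest: maximal_inD)

lemma max_chain_append:
  assumes "max_chain l Z X" "max_chain k Y Z" shows "max_chain (k + l) Y X"
  using assms by (induction rule: max_chain.induct) (auto intro: max_chain_Suc)

lemma max_chain_split:
  assumes "max_chain k Y X" "m \<le> k" shows "\<exists>Z. max_chain m Y Z \<and> max_chain (k - m) Z X"
  using assms
proof (induction rule: max_chain.induct)
  case max_chain_0
  then show ?case using max_chain.max_chain_0 by auto
next
  case (max_chain_Suc k Y Z X)
  show ?case
  proof (cases "m = Suc k")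
    case True
    then show ?thesis
      using max_chain_Suc max_chain.max_chain_Suc max_chain.max_chain_0 maximal_inD(1)
      by (metis diff_self_eq_0)
  next
    case False
    then obtain W where "max_chain m Y W" "max_chain (k - m) W Z" using max_chain_Suc by auto
    then have "max_chain (Suc (k - m)) W X" using max_chain.max_chain_Suc max_chain_Suc by blast
    then show ?thesis using \<open>max_chain m Y W\<close> False max_chain_Suc by (metis Suc_diff_le le_SucE)
  qed
qed

lemma max_chain_ex:
  assumes "subgroup X G" "X \<subseteq> Y" "subgroup Y G" shows "\<exists>k. max_chain k Y X"
  using assms
proof (induction "card Y - card X" arbitrary: X rule: less_induct)
  case less
  show ?case
  proof (cases "X = Y")
    case True
    then show ?thesis using max_chain_0 less by blast
  next
    case False
    obtain Z where Z: "maximal_in X Z" "Z \<subseteq> Y" using maximal_in_above_ex False less by blast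
    note z = maximal_inD[OF Z(1)]
    have "card X < card Z" using z by (simp add: psubset_card_mono psubset_eq)
    moreover have "card Z \<le> card Y" using Z less by (simp add: card_mono)
    ultimately have "card Y - card Z < card Y - card X" by linarith
    then obtain k where "max_chain k Y Z" using less.hyps[OF _ z(2) Z(2) less.prems(3)] by blast
    then show ?thesis using max_chain_Suc Z by blast
  qed
qed

lemma max_chain_pos: "max_chain k Y X \<Longrightarrow> X \<noteq> Y \<Longrightarrow> 1 \<le> k"
  by (cases rule: max_chain.cases) auto

lemma max_chain_ge_2:
  assumes "max_chain k Y X" "\<not> maximal_in X Y" "X \<noteq> Y" shows "2 \<le> k"
proof (rule ccontr)
  assume "\<not> 2 \<le> k"
  moreover have "1 \<le> k" using max_chain_pos assms by blast
  ultimately have "max_chain (Suc 0) Y X"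
    using assms(1) by (metis One_nat_def le_antisym not_less_eq_eq numeral_2_eq_2)
  then obtain Z where "max_chain 0 Y Z" "maximal_in X Z" by (cases rule: max_chain.cases) auto
  moreover have "Z = Y" using max_chain_pos[OF calculation(1)] by auto
  ultimately show False using assms by simp
qed

end

context sigma_fin_group begin

definition classes_of :: "nat \<Rightarrow> nat set set" where
  "classes_of m = {s \<in> \<sigma>. \<exists>p\<in>s. prime p \<and> p dvd m}"

lemma classes_of_mult: "classes_of (a * b) = classes_of a \<union> classes_of b"
  by (auto simp: classes_of_def prime_dvd_mult_iff)

lemma classes_of_1 [simp]: "classes_of (Suc 0) = {}"
  by (auto simp: classes_of_def)

lemma classes_of_iff: "s \<in> \<sigma> \<Longrightarrow> s \<in> classes_of m \<longleftrightarrow> \<not> pi_number (- s) m"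
  by (auto simp: classes_of_def pi_number_def)

lemma classes_of_pi_num: "pi_number s m \<Longrightarrow> s \<in> \<sigma> \<Longrightarrow> classes_of m \<subseteq> {s}"
  unfolding classes_of_def pi_number_def using classes_disjoint by blast

text \<open>
  A chief factor \<open>L/C\<close> above the core \<open>C\<close> of \<open>M\<close> is \<open>\<sigma>\<close>-primary and \<open>L M = Y\<close>, so
  \<open>|Y : M|\<close> divides \<open>|L : C|\<close>.
\<close>

lemma maximal_in_primary:
  assumes Y: "sigma_sol Y" and M: "maximal_in M Y" shows "primary (index Y M)"
proof -
  note m = maximal_inD[OF M] and c = core_in_props[OF maximal_inD(2)[OF M] maximal_inD(1)[OF M] maximal_inD(3)[OF M]]
  have "core_in Y M \<noteq> Y" using c(2) m by blast
  then obtain L where L: "normal_in L Y" "core_in Y M \<subset> L" "primary (index L (core_in Y M))"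
    using sigma_sol_step[OF Y c(1) normal_in_refl[OF m(2)] normal_inD(3)[OF c(1)]] by blast
  note l = normal_inD[OF L(1)]
  have "\<not> L \<subseteq> M" using c(3)[OF L(1)] L(2) by blast
  then have "L <#> M = Y" using m(5)[of "L <#> M"] set_mult_subgroup[OF L(1) m(1,3)] by blast
  then have "index Y M = index L (L \<inter> M)" using index_second_iso(2)[OF L(1) m(1,3)] by simp
  also have "\<dots> dvd index L (core_in Y M)"
    using index_mult[of "core_in Y M" "L \<inter> M" L] c(2) L(2) normal_inD(1)[OF c(1)] l m by auto
  finally show ?thesis using L(3) primary_dvd by blast
qed

text \<open>
  Each step contributes at most one class, by \<open>maximal_in_primary\<close>. This is the only source of
  lower bounds for the length of a chain.
\<close>

lemma max_chain_classes:
  assumes "max_chain k Y X" "sigma_sol Y" shows "finite (classes_of (index Y X)) \<and> card (classes_of (index Y X)) \<le> k"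
  using assms
proof (induction rule: max_chain.induct)
  case max_chain_0
  then show ?case by simp
next
  case (max_chain_Suc k Y Z X)
  note m = maximal_inD[OF max_chain_Suc(2)] and c = max_chain_sub[OF max_chain_Suc(1)]
  have "primary (index Z X)"
    using maximal_in_primary[OF sigma_sol_subgroup[OF max_chain_Suc.prems, of Z] max_chain_Suc(2)] c
    by blast
  then obtain s where "s \<in> \<sigma>" "pi_number s (index Z X)" by (auto simp: primary_def)
  then have 1: "classes_of (index Z X) \<subseteq> {s}" using classes_of_pi_num by blast
  then have "finite (classes_of (index Z X))" "card (classes_of (index Z X)) \<le> 1"
    using finite_subset card_mono[OF _ 1] by auto
  moreover have "classes_of (index Y X) = classes_of (index Y Z) \<union> classes_of (index Z X)"
    using index_mult[of X Z Y] m c by (simp add: classes_of_mult)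
  ultimately show ?case
    using max_chain_Suc card_Un_le[of "classes_of (index Y Z)" "classes_of (index Z X)"] by simp
qed

lemma max_chain_lower:
  assumes "max_chain k Y X" "sigma_sol Y" "C \<subseteq> classes_of (index Y X)" shows "card C \<le> k"
  using max_chain_classes[OF assms(1,2)] card_mono[of "classes_of (index Y X)" C] assms(3)
  by linarith

section \<open>Sigma-subnormal and sigma-nilpotent subgroups\<close>

text \<open>
  Any normal subgroup \<open>K\<close> inside \<open>B\<close> may take the place of the core; this makes the condition
  stable under intersection.
\<close>

definition sigma_step :: "'a set \<Rightarrow> 'a set \<Rightarrow> bool" where
  "sigma_step B C \<longleftrightarrow> subgroup B G \<and> subgroup C G \<and> B \<subseteq> C \<and>
     (normal_in B C \<or> (\<exists>K. normal_in K C \<and> K \<subseteq> B \<and> primary (index C K)))"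

inductive sigma_sub :: "'a set \<Rightarrow> 'a set \<Rightarrow> bool" for A where
  sigma_sub_refl: "subgroup A G \<Longrightarrow> sigma_sub A A"
| sigma_sub_step: "sigma_sub A B \<Longrightarrow> sigma_step B C \<Longrightarrow> sigma_sub A C"

lemma sigma_sub_sub: "sigma_sub A Y \<Longrightarrow> subgroup A G \<and> subgroup Y G \<and> A \<subseteq> Y"
  by (induction rule: sigma_sub.induct) (auto simp: sigma_step_def)

lemma sigma_sub_Int:
  assumes "sigma_sub A B" "subgroup T G" shows "sigma_sub (A \<inter> T) (B \<inter> T)"
  using assms
proof (induction rule: sigma_sub.induct)
  case sigma_sub_refl
  then show ?case by (intro sigma_sub.sigma_sub_refl) auto
next
  case (sigma_sub_step B C)
  have s: "subgroup B G" "subgroup C G" "B \<subseteq> C"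
    using sigma_sub_step(2) by (auto simp: sigma_step_def)
  have "normal_in (B \<inter> T) (C \<inter> T) \<or> (\<exists>K. normal_in K (C \<inter> T) \<and> K \<subseteq> B \<inter> T \<and> primary (index (C \<inter> T) K))"
  proof (cases "normal_in B C")
    case True
    have "normal_in (B \<inter> (C \<inter> T)) (C \<inter> T)"
      by (rule normal_in_Int_sub[OF True]) (use s sigma_sub_step in auto)
    moreover have "B \<inter> (C \<inter> T) = B \<inter> T" using s by blast
    ultimately show ?thesis by simp
  next
    case False
    then obtain K where K: "normal_in K C" "K \<subseteq> B" "primary (index C K)"
      using sigma_sub_step(2) by (auto simp: sigma_step_def)
    have "normal_in (K \<inter> (C \<inter> T)) (C \<inter> T)"
      by (rule normal_in_Int_sub[OF K(1)]) (use s sigma_sub_step in auto)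
    moreover have "index (C \<inter> T) (K \<inter> (C \<inter> T)) dvd index C K"
      by (rule index_Int_dvd[OF K(1)]) (use s sigma_sub_step in auto)
    ultimately show ?thesis using K primary_dvd by blast
  qed
  then have "sigma_step (B \<inter> T) (C \<inter> T)" using s sigma_sub_step unfolding sigma_step_def by auto
  then show ?case using sigma_sub.sigma_sub_step sigma_sub_step by blast
qed

lemma sigma_sub_proper:
  assumes "sigma_sub A Y" "A \<noteq> Y" shows "\<exists>B. A \<subseteq> B \<and> B \<noteq> Y \<and> sigma_step B Y"
  using assms
proof (induction rule: sigma_sub.induct)
  case sigma_sub_refl
  then show ?case by simp
next
  case (sigma_sub_step B C)
  then show ?case using sigma_sub_sub by (cases "B = C") blast+
qed

lemma maximal_in_sigma_sub:
  assumes Y: "sigma_sol Y" and A: "maximal_in A Y" "sigma_sub A Y"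
  shows "\<exists>C. normal_in C Y \<and> C \<subseteq> A \<and> primary (index Y C)"
proof -
  note m = maximal_inD[OF A(1)]
  obtain B where B: "A \<subseteq> B" "B \<noteq> Y" "sigma_step B Y" using sigma_sub_proper[OF A(2) m(4)] by blast
  then have "B = A" using m(5) by (auto simp: sigma_step_def)
  then show ?thesis using B maximal_in_primary[OF Y A(1)] by (auto simp: sigma_step_def)
qed

text \<open>
  If \<open>C/K\<close> is an \<open>s\<close>-group then \<open>K H = C\<close>, hence \<open>B H = C\<close> and
  \<open>|B : B \<inter> H| = |C : H|\<close>. If its order is prime to \<open>s\<close> then \<open>H\<close> lies in \<open>K\<close>.
\<close>

lemma hall_sigma_step:
  assumes s: "class_closed s" and B: "sigma_step B C" and H: "hall s H C" shows "hall s (B \<inter> H) B"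
proof (cases "normal_in B C")
  case True
  then show ?thesis using hall_normal_Int H by blast
next
  case False
  then obtain K where K: "normal_in K C" "K \<subseteq> B" "primary (index C K)"
    using B by (auto simp: sigma_step_def)
  have b: "subgroup B G" "subgroup C G" "B \<subseteq> C" using B by (auto simp: sigma_step_def)
  note h = hallD[OF H] and k = normal_inD[OF K(1)]
  consider "pi_number s (index C K)" | "pi_number (- s) (index C K)"
    using class_closed_primary[OF s K(3)] by blast
  then show ?thesis
  proof cases
    case 1
    note kh = set_mult_subgroup[OF K(1) h(1,3)]
    have "index C (K <#> H) dvd index C K" using index_mult[of K "K <#> H" C] kh k by simp
    moreover have "index C (K <#> H) dvd index C H" using index_mult[of H "K <#> H" C] kh h by simp
    ultimately have "index C (K <#> H) = 1" using 1 h(5) pi_number_compl_eq_1 pi_number_dvd by metis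
    then have "K <#> H = C" using index_eq_1[of "K <#> H" C] kh k by blast
    moreover have "K <#> H \<subseteq> B <#> H" using K(2) by (rule mono_set_mult) simp
    moreover have "B <#> H \<subseteq> C" using set_mult_least b h by blast
    ultimately have BH: "B <#> H = C" by blast
    have "index C H * card H * card (B \<inter> H) = card B * card H"
      using card_set_mult[OF b(1) h(1)] BH index_card[OF h(1,2,3)] by simp
    also have "\<dots> = index B (B \<inter> H) * card (B \<inter> H) * card H"
      using index_card[of "B \<inter> H" B] b h by simp
    finally have "index C H = index B (B \<inter> H)"
      using card_subgroup_pos[OF h(1)] card_subgroup_pos[of "B \<inter> H"] b h by simp
    moreover have "card (B \<inter> H) dvd card H" using b h by (intro card_dvd) auto
    ultimately show ?thesis using b h pi_number_dvd unfolding hall_def by auto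
  next
    case 2
    have "H \<subseteq> K" using pi_subgroup_in_normal[OF K(1) 2 h(1,3,4)] .
    then have "B \<inter> H = H" using K(2) by blast
    then show ?thesis using hall_subgroup[OF H b(1) _ b(3)] by auto
  qed
qed

lemma hall_sigma_sub:
  assumes "sigma_sub A Y" "class_closed s" "hall s H Y" shows "hall s (A \<inter> H) A"
  using assms
proof (induction arbitrary: H rule: sigma_sub.induct)
  case sigma_sub_refl
  then have "A \<inter> H = H" using hallD(3) by blast
  then show ?case using sigma_sub_refl by simp
next
  case (sigma_sub_step B C)
  have "hall s (A \<inter> (B \<inter> H)) A" using sigma_sub_step hall_sigma_step by blast
  moreover have "A \<inter> (B \<inter> H) = A \<inter> H" using sigma_sub_sub sigma_sub_step by blast
  ultimately show ?case by simp
qed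

text \<open>
  A \<open>\<sigma>\<close>-soluble group that is \<open>\<sigma>\<close>-primary modulo the core of each of its maximal subgroups is
  \<open>\<sigma>\<close>-nilpotent; here this is shown for all quotients \<open>Y/K\<close>, by induction on their
  order. Let \<open>L/K\<close> be a chief factor and \<open>H/L\<close> the normal Hall \<open>s\<close>-subgroup of \<open>Y/L\<close>. If
  some maximal subgroup over \<open>K\<close> does not contain \<open>L\<close>, there is a normal subgroup \<open>C\<close> with
  \<open>C \<inter> L = K\<close> and \<open>|Y : C|\<close> in the class \<open>t\<close> of \<open>|L : K|\<close>; for \<open>s \<noteq> t\<close> the Hall subgroup
  is \<open>(C \<inter> H)/K\<close>. Otherwise \<open>L/K\<close> lies in the Frattini subgroup. Two Frattini arguments then
  show that \<open>L/K\<close> is an abelian \<open>p\<close>-group, and that its complements in \<open>H/K\<close>, all conjugate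
  under \<open>L\<close>, are normal.
\<close>

lemma nilpotent_section:
  assumes "sigma_sol Y" and max: "\<And>A. maximal_in A Y \<Longrightarrow> \<exists>C. normal_in C Y \<and> C \<subseteq> A \<and> primary (index Y C)"
    and "normal_in K Y" "s \<in> \<sigma>"
  shows "\<exists>H. normal_in H Y \<and> K \<subseteq> H \<and> pi_number s (index H K) \<and> pi_number (- s) (index Y H)"
  using assms(3)
proof (induction "index Y K" arbitrary: K rule: less_induct)
  case less
  note k = normal_inD[OF less.prems]
  show ?case
  proof (cases "K = Y")
    case True
    then show ?thesis using less.prems k(2) by (intro exI[of _ Y]) auto
  next
    case False
    obtain L where L: "normal_in L Y" "K \<subset> L" "primary (index L K)"
      and chief: "\<And>E. normal_in E Y \<Longrightarrow> K \<subseteq> E \<Longrightarrow> E \<subseteq> L \<Longrightarrow> E = K \<or> E = L"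
      by (rule sigma_sol_chief[OF assms(1) less.prems normal_in_refl[OF k(2)] k(3) False]) blast
    note l = normal_inD[OF L(1)]
    have KL: "K \<subseteq> L" "K \<noteq> L" using L by auto
    have ne: "index L K \<noteq> 1" using index_eq_1 k l KL by blast
    have "index Y K = index Y L * index L K" using index_mult k l KL by blast
    then have "index Y L < index Y K"
      using ne index_pos[OF l(1,2,3)] index_pos[OF k(1) l(1) KL(1)] by simp
    from less.hyps[OF this L(1)] obtain H where H: "normal_in H Y" "L \<subseteq> H" "pi_number s (index H L)"
      "pi_number (- s) (index Y H)" by blast
    note h = normal_inD[OF H(1)]
    obtain t where t: "t \<in> \<sigma>" "pi_number t (index L K)"
      "t \<noteq> s \<Longrightarrow> \<exists>H. normal_in H Y \<and> K \<subseteq> H \<and> pi_number s (index H K) \<and> pi_number (- s) (index Y H)"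
    proof (cases "\<exists>A. maximal_in A Y \<and> K \<subseteq> A \<and> \<not> L \<subseteq> A")
      case True
      then obtain A where A: "maximal_in A Y" "K \<subseteq> A" "\<not> L \<subseteq> A" by blast
      note a = maximal_inD[OF A(1)]
      obtain C0 where C0: "normal_in C0 Y" "C0 \<subseteq> A" "primary (index Y C0)"
        using max[OF A(1)] by blast
      define C where "C = K <#> C0"
      have C: "normal_in C Y" "K \<subseteq> C" "C0 \<subseteq> C" "C \<subseteq> A"
        using set_mult_normal[OF less.prems C0(1)] set_mult_subgroup[OF less.prems normal_inD(1,3)[OF C0(1)]]
          set_mult_least[OF a(1) A(2) C0(2)] by (auto simp: C_def)
      note c = normal_inD[OF C(1)]
      have "index Y C dvd index Y C0"
        using index_mult[of C0 C Y] normal_inD(1)[OF C0(1)] c C by auto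
      then obtain t where t: "t \<in> \<sigma>" "pi_number t (index Y C)"
        using C0(3) primary_dvd unfolding primary_def by blast
      have "C \<inter> L = K" using chief[OF normal_in_Int[OF C(1) L(1)]] A(3) C KL by blast
      then have iLK: "index L K dvd index Y C" using index_Int_dvd[OF C(1) l(1,3)] by simp
      show ?thesis
      proof (rule that[OF t(1)])
        show "pi_number t (index L K)" using t iLK pi_number_dvd by blast
        assume ts: "t \<noteq> s"
        define T where "T = C \<inter> H"
        have T: "normal_in T Y" unfolding T_def using normal_in_Int[OF C(1) H(1)] .
        note tt = normal_inD[OF T]
        have KT: "K \<subseteq> T" using C H KL by (auto simp: T_def)
        have LT: "L \<inter> T = K" using \<open>C \<inter> L = K\<close> H(2) by (auto simp: T_def)
        have "L <#> T \<subseteq> H" using set_mult_least[OF h(1) H(2)] by (auto simp: T_def)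
        then have "index (L <#> T) L dvd index H L"
          using index_mult[of L "L <#> T" H] set_mult_subgroup[OF L(1) tt(1,3)] h l by simp
        then have "pi_number s (index T K)"
          using index_second_iso(1)[OF L(1) tt(1,3)] LT H(3) pi_number_dvd by simp
        moreover have "index H T dvd index Y C"
          unfolding T_def using index_Int_dvd[OF C(1) h(1,3)] .
        then have "pi_number (- s) (index H T)"
          using t pi_number_dvd pi_number_mono classes_disjoint[OF t(1) assms(4) ts]
          by (metis disjoint_eq_subset_Compl)
        then have "pi_number (- s) (index Y T)"
          using index_mult[of T H Y] tt h H(4) by (simp add: T_def)
        ultimately show "\<exists>H. normal_in H Y \<and> K \<subseteq> H \<and> pi_number s (index H K) \<and> pi_number (- s) (index Y H)"
          using T KT by blast
      qed
    next
      case False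
      \<comment> \<open>in \<open>Y/K\<close> the only supplement of \<open>L/K\<close> is the whole group\<close>
      have supp: "T = Y" if T: "subgroup T G" "K \<subseteq> T" "T \<subseteq> Y" "L <#> T = Y" for T
      proof (rule ccontr)
        assume "T \<noteq> Y"
        then obtain A where A: "maximal_in A Y" "T \<subseteq> A"
          using maximal_in_ex[OF T(1,3) _ k(2)] by blast
        then have "L \<subseteq> A" using False T by blast
        then have "Y \<subseteq> A" using set_mult_least[OF maximal_inD(1)[OF A(1)] _ A(2)] T(4) by blast
        then show False using maximal_inD[OF A(1)] by blast
      qed
      obtain p where p: "prime p" "p dvd index L K" using prime_factor_nat ne by blast
      obtain P where P: "hall {p} P L" using sylow_ex[OF p(1) l(1)] by blast
      note hp = hallD[OF P]
      have KnL: "normal_in K L" using normal_in_mono[OF less.prems l(1) KL(1) l(3)] .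
      note kp = set_mult_subgroup[OF KnL hp(1,3)]
      have kpY: "K <#> P \<subseteq> Y" using kp l by blast
      have "normalizer_in Y (K <#> P) = Y"
        using supp[OF normalizer_in_subgroup[OF k(2) subgroup.subset[OF kp(1)]]] normalizer_in_props[OF k(2) kp(1) kpY] kp
          frattini_mod[OF p(1) less.prems L(1) KL(1) P] by blast
      then have "normal_in (K <#> P) Y" using normal_in_of_normalizer[OF k(2) kp(1) kpY] by blast
      then have pi: "pi_number {p} (index L K)"
        using chief_p_number[OF p less.prems L(1) KL(1) chief P] by blast
      obtain t where t: "t \<in> \<sigma>" "p \<in> t" using class_of_prime p by blast
      show ?thesis
      proof (rule that[OF t(1)])
        show pit: "pi_number t (index L K)" using pi pi_number_mono t by blast
        assume ts: "t \<noteq> s"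
        have ms: "pi_number (- s) (index L K)"
          using pit pi_number_mono classes_disjoint[OF t(1) assms(4) ts] by blast
        have KH: "normal_in K H" using normal_in_mono[OF less.prems h(1)] KL H h by blast
        have LH: "normal_in L H" using normal_in_mono[OF L(1) h(1) H(2) h(3)] .
        interpret a: abelian_section G K L H
        proof (rule abelian_sectionI[OF KH LH KL(1)])
          show "a \<otimes> b \<otimes> inv a \<otimes> inv b \<in> K" if "a \<in> L" "b \<in> L" for a b
            using chief_p_section_abelian[OF p(1) less.prems L(1) KL chief pi that] by blast
          show "coprime (index L K) (index H L)"
            using pi_number_coprime H(3) ms coprime_commute by metis
        qed
        obtain U where aU: "a.complement U" using a.complement_ex by blast
        then have U: "subgroup U G" "U \<subseteq> H" "L \<inter> U = K" "L <#> U = H"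
          by (auto simp: a.complement_def)
        have Uc: "U \<subseteq> carrier G" using subgroup.subset[OF U(1)] .
        have LU: "L <#> normalizer_in Y U = Y"
        proof (rule frattini[OF L(1) Uc])
          fix g assume g: "g \<in> Y"
          have gc: "g \<in> carrier G" using g l subgroup_carrier by blast
          have "conjg g U \<subseteq> H" using conjg_mono[OF U(2), of g] conjg_normal[OF H(1) g] by simp
          moreover have "L \<inter> conjg g U = K"
          proof -
            have "inj_on (\<lambda>x. g \<otimes> x \<otimes> inv g) (carrier G)" using gc by (auto simp: inj_on_def)
            then have "conjg g (L \<inter> U) = conjg g L \<inter> conjg g U"
              unfolding conjg_def
                using inj_on_image_Int[of _ "carrier G" L U] Uc subgroup.subset[OF l(1)] by blast
            then show ?thesis
              using conjg_normal[OF L(1) g] conjg_normal[OF less.prems g] U(3) by simp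
          qed
          moreover have "L <#> conjg g U = H"
            using conjg_set_mult[OF gc subgroup.subset[OF l(1)] Uc] conjg_normal[OF L(1) g]
              conjg_normal[OF H(1) g] U(4) by simp
          ultimately have "a.complement (conjg g U)"
            using conjg_subgroup[OF gc U(1)] by (simp add: a.complement_def)
          then show "\<exists>n\<in>L. conjg g U = conjg n U" using a.complement_conj[OF aU] by blast
        qed
        have UY: "U \<subseteq> Y" using U h by blast
        have "K \<subseteq> normalizer_in Y U" using normalizer_in_props(1)[OF k(2) U(1) UY] U(3) by blast
        then have "normalizer_in Y U = Y"
          using supp[OF normalizer_in_subgroup[OF k(2) Uc]] normalizer_in_props[OF k(2) U(1) UY] LU
          by blast
        then have nU: "normal_in U Y" using normal_in_of_normalizer[OF k(2) U(1) UY] by blast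
        have "index U K = index H L" "index H U = index L K"
          using index_second_iso[OF LH U(1,2)] U by auto
        then have "pi_number s (index U K)" "pi_number (- s) (index Y U)"
          using H(3,4) ms index_mult[of U H Y] U h by auto
        then show "\<exists>H. normal_in H Y \<and> K \<subseteq> H \<and> pi_number s (index H K) \<and> pi_number (- s) (index Y H)"
          using nU U by blast
      qed
    qed
    show ?thesis
    proof (cases "t = s")
      case True
      then have "pi_number s (index H K)" using index_mult[of K L H] k l h H t KL by auto
      then show ?thesis using H KL by blast
    qed (rule t(3))
  qed
qed

lemma nilpotent_hall:
  assumes "sigma_sol Y" and "\<And>A. maximal_in A Y \<Longrightarrow> \<exists>C. normal_in C Y \<and> C \<subseteq> A \<and> primary (index Y C)"
    and "s \<in> \<sigma>"
  shows "\<exists>H. normal_in H Y \<and> hall s H Y"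
proof -
  have Y: "subgroup Y G" using assms by (simp add: sigma_sol_def)
  show ?thesis using nilpotent_section[OF assms(1,2) normal_in_one[OF Y] assms(3)] normal_inD
    unfolding hall_def by (metis index_one)
qed

text \<open>
  This is the form in which the hypothesis of the theorem enters the main argument. It concerns
  only \<open>s\<close>-subgroups at the end of chains with more than \<open>n\<close> steps and says nothing about
  \<open>\<sigma>\<close>-subnormality, and therefore passes to Hall complements in the final induction.
\<close>

definition deep_in_hall :: "nat \<Rightarrow> 'a set \<Rightarrow> bool" where
  "deep_in_hall n Y \<longleftrightarrow> (\<forall>k X s H. n < k \<longrightarrow> max_chain k Y X \<longrightarrow> s \<in> \<sigma> \<longrightarrow> pi_number s (card X) \<longrightarrow>
     hall s H Y \<longrightarrow> X \<subseteq> H)"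

text \<open>
  The chain from \<open>Y\<close> to \<open>X\<close> passes through an \<open>n\<close>-maximal subgroup \<open>W\<close> and a maximal
  subgroup \<open>Z\<close> of \<open>W\<close>. All maximal subgroups of \<open>W\<close> are \<open>\<sigma>\<close>-subnormal, so \<open>W\<close> has a
  normal Hall \<open>s\<close>-subgroup \<open>B\<close>, which contains \<open>X\<close>. As \<open>Z\<close> is \<open>\<sigma>\<close>-subnormal,
  \<open>Z \<inter> H\<close> is a Hall \<open>s\<close>-subgroup of \<open>Z\<close> and contains the normal subgroup \<open>B \<inter> Z\<close>.
\<close>

lemma deep_in_hallI:
  assumes Y: "sigma_sol Y" and sn: "\<And>Z. max_chain (Suc n) Y Z \<Longrightarrow> sigma_sub Z Y" shows "deep_in_hall n Y"
  unfolding deep_in_hall_def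
proof (intro allI impI)
  fix k X s H
  assume k: "n < k" and X: "max_chain k Y X" and s: "s \<in> \<sigma>" "pi_number s (card X)" and H: "hall s H Y"
  obtain Z where Z: "max_chain (Suc n) Y Z" "max_chain (k - Suc n) Z X"
    using max_chain_split[OF X, of "Suc n"] k by auto
  from Z(1) obtain W where W: "max_chain n Y W" "maximal_in Z W"
    by (cases rule: max_chain.cases) auto
  have w: "subgroup W G" "W \<subseteq> Y" using max_chain_sub[OF W(1)] by auto
  have sW: "sigma_sol W" using sigma_sol_subgroup[OF Y w] .
  have "\<exists>C. normal_in C W \<and> C \<subseteq> A \<and> primary (index W C)" if A: "maximal_in A W" for A
  proof (rule maximal_in_sigma_sub[OF sW A])
    have "sigma_sub A Y" using sn[OF max_chain_Suc[OF W(1) A]] .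
    then have "sigma_sub (A \<inter> W) (Y \<inter> W)" using sigma_sub_Int w(1) by blast
    moreover have "A \<inter> W = A" "Y \<inter> W = W" using maximal_inD(3)[OF A] w by auto
    ultimately show "sigma_sub A W" by simp
  qed
  then obtain B where B: "normal_in B W" "hall s B W" using nilpotent_hall[OF sW _ s(1)] by blast
  have XZ: "subgroup X G" "X \<subseteq> Z" using max_chain_sub[OF Z(2)] by auto
  note z = maximal_inD[OF W(2)]
  have XB: "X \<subseteq> B" using pi_subgroup_in_normal[OF B(1) hallD(5)[OF B(2)] XZ(1) _ s(2)] XZ z by blast
  have HZ: "hall s (Z \<inter> H) Z" using hall_sigma_sub[OF sn[OF Z(1)] class_closed_class[OF s(1)] H] .
  have "normal_in (B \<inter> Z) Z" using normal_in_Int_sub[OF B(1) z(1,3)] .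
  moreover have "card (B \<inter> Z) dvd card B" using hallD(1)[OF B(2)] z by (intro card_dvd) auto
  then have "pi_number s (card (B \<inter> Z))" using hallD(4)[OF B(2)] pi_number_dvd by blast
  ultimately have "B \<inter> Z \<subseteq> Z \<inter> H" using normal_pi_in_hall[OF _ _ HZ] by blast
  then show "X \<subseteq> H" using XB XZ by blast
qed

lemma deep_in_hallD: "deep_in_hall n Y \<Longrightarrow> max_chain k Y X \<Longrightarrow> n < k \<Longrightarrow> s \<in> \<sigma> \<Longrightarrow> pi_number s (card X) \<Longrightarrow> hall s H Y \<Longrightarrow> X \<subseteq> H"
  unfolding deep_in_hall_def by blast

text \<open>
  Conjugates of Hall subgroups are Hall subgroups.
\<close>

lemma deep_in_core:
  assumes d: "deep_in_hall n Y" "max_chain k Y X" "n < k" "s \<in> \<sigma>" "pi_number s (card X)" and H: "hall s H Y"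
  shows "X \<subseteq> core_in Y H"
proof
  fix x assume x: "x \<in> X"
  note h = hallD[OF H]
  have xY: "x \<in> Y" using x max_chain_sub[OF d(2)] by blast
  have "y \<otimes> x \<otimes> inv y \<in> H" if y: "y \<in> Y" for y
  proof -
    have yc: "y \<in> carrier G" "inv y \<in> Y"
      using subgroup_carrier[OF h(2) y] subgroup.m_inv_closed[OF h(2) y] .
    have "x \<in> conjg (inv y) H" using deep_in_hallD[OF d hall_conjg[OF yc(2) H]] x by blast
    then obtain a where a: "a \<in> H" "x = inv y \<otimes> a \<otimes> y" using yc by (auto simp: conjg_def)
    have "a \<in> carrier G" using a h subgroup_carrier by blast
    then show ?thesis using a yc by (simp add: m_assoc)
  qed
  then show "x \<in> core_in Y H" using xY by (simp add: core_in_def)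
qed

lemma max_chain_k_maximal:
  assumes "max_chain k (carrier G) X" "1 \<le> k" shows "k_maximal k X G"
proof -
  have "\<exists>M. M 0 = Y \<and> M k = X \<and> (\<forall>i\<in>{1..k}. maximal_subgroup (M i) (G\<lparr>carrier := M (i - 1)\<rparr>))"
    if "max_chain k Y X" for k Y X
    using that
  proof (induction rule: max_chain.induct)
    case (max_chain_0 Y)
    show ?case by (intro exI[of _ "\<lambda>_. Y"]) auto
  next
    case (max_chain_Suc k Y Z X)
    then obtain M where M: "M 0 = Y" "M k = Z"
      "\<forall>i\<in>{1..k}. maximal_subgroup (M i) (G\<lparr>carrier := M (i - 1)\<rparr>)" by blast
    note x = maximal_inD[OF max_chain_Suc(2)]
    have "subgroup L G \<and> L \<subseteq> Z" if "subgroup L (G\<lparr>carrier := Z\<rparr>)" for L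
      using incl_subgroup[OF x(2) that] subgroup.subset[OF that] by simp
    then have "maximal_subgroup X (G\<lparr>carrier := Z\<rparr>)"
      unfolding maximal_subgroup_def using subgroup_incl[OF x(1,2,3)] x(4,5) by auto
    then show ?case using M by (intro exI[of _ "M(Suc k := X)"]) (auto simp: le_Suc_eq)
  qed
  from this[OF assms(1)] show ?thesis using assms(2) by (simp add: k_maximal_def)
qed

lemma sigma_subnormal_sigma_sub:
  assumes "sigma_subnormal \<sigma> A G" shows "sigma_sub A (carrier G)"
proof -
  obtain t :: nat and B :: "nat \<Rightarrow> 'a set"
    where B: "B 0 = A" "B t = carrier G" "\<forall>i\<le>t. subgroup (B i) G"
    and step: "\<forall>i\<in>{1..t}. B (i - 1) \<subseteq> B i \<and> (B (i - 1) \<lhd> G\<lparr>carrier := B i\<rparr> \<or>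
       sigma_primary \<sigma> ((G\<lparr>carrier := B i\<rparr>) Mod normal_core (G\<lparr>carrier := B i\<rparr>) (B (i - 1))))"
    using assms unfolding sigma_subnormal_def by blast
  have "sigma_sub A (B i)" if "i \<le> t" for i
    using that
  proof (induction i)
    case 0
    then show ?case using B(1,3) sigma_sub_refl by (metis le0)
  next
    case (Suc i)
    have s: "subgroup (B i) G" "subgroup (B (Suc i)) G" "B i \<subseteq> B (Suc i)"
      using B(3) bspec[OF step, of "Suc i"] Suc by auto
    let ?C = "normal_core (G\<lparr>carrier := B (Suc i)\<rparr>) (B i)"
    have "subgroup (B i) (G\<lparr>carrier := B (Suc i)\<rparr>)" using subgroup_incl s by blast
    note nc = group.normal_core_greatest(1,2)[OF subgroup_imp_group[OF s(2)] this]
    have "normal_in ?C (B (Suc i))" using nc(1) normal_in_iff_normal s by blast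
    then have "sigma_primary \<sigma> ((G\<lparr>carrier := B (Suc i)\<rparr>) Mod ?C) \<Longrightarrow> primary (index (B (Suc i)) ?C)"
      using sigma_primary_primary order_section unfolding order_def by blast
    moreover have "B i \<lhd> G\<lparr>carrier := B (Suc i)\<rparr> \<or> sigma_primary \<sigma> ((G\<lparr>carrier := B (Suc i)\<rparr>) Mod ?C)"
      using bspec[OF step, of "Suc i"] Suc by simp
    ultimately have "sigma_step (B i) (B (Suc i))"
      unfolding sigma_step_def using s nc normal_in_iff_normal \<open>normal_in ?C (B (Suc i))\<close> by blast
    then show ?case using sigma_sub_step Suc by (meson Suc_leD)
  qed
  then show ?thesis using B(2) by force
qed

end

section \<open>Small indices and fixed points\<close>

context fin_group begin

lemma cauchy:
  assumes p: "prime p" and Y: "subgroup Y G" and d: "p dvd card Y"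
  shows "\<exists>P. subgroup P G \<and> P \<subseteq> Y \<and> card P = p"
proof -
  interpret Y: group "G\<lparr>carrier := Y\<rparr>" using Y by (rule subgroup_imp_group)
  obtain m where m: "card Y = p * m" using d by blast
  have "\<exists>P. subgroup P (G\<lparr>carrier := Y\<rparr>) \<and> card P = p ^ 1"
    using sylow_thm[of p "G\<lparr>carrier := Y\<rparr>" 1 m] p Y.group_axioms m Y by (simp add: order_def)
  then obtain P where P: "subgroup P (G\<lparr>carrier := Y\<rparr>)" "card P = p" by auto
  then show ?thesis using incl_subgroup[OF Y P(1)] subgroup.subset[OF P(1)] by auto
qed

lemma card_1_iff: "subgroup X G \<Longrightarrow> card X = Suc 0 \<longleftrightarrow> X = {\<one>}"
  using subgroup.one_closed
  by (metis One_nat_def card_1_singletonE is_singletonI is_singleton_altdef singletonD)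

lemma coprime_Int:
  assumes "subgroup X G" "subgroup Z G" "coprime (card X) (card Z)" shows "X \<inter> Z = {\<one>}"
proof -
  have "card (X \<inter> Z) dvd card X" "card (X \<inter> Z) dvd card Z" using assms by (auto intro!: card_dvd)
  then have "card (X \<inter> Z) = 1" using assms(3) by (metis coprime_common_divisor_nat)
  then show ?thesis using card_1_iff[of "X \<inter> Z"] assms by simp
qed

lemma no_proper_subgroup_prime:
  assumes X: "subgroup X G" "X \<noteq> {\<one>}"
    and np: "\<And>Z. subgroup Z G \<Longrightarrow> Z \<subseteq> X \<Longrightarrow> Z \<noteq> X \<Longrightarrow> Z = {\<one>}"
  shows "prime (card X)"
proof -
  have "card X \<noteq> 1" using card_1_iff X by simp
  then obtain p where p: "prime p" "p dvd card X" using prime_factor_nat by blast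
  obtain P where P: "subgroup P G" "P \<subseteq> X" "card P = p" using cauchy[OF p(1) X(1) p(2)] by blast
  have "P \<noteq> {\<one>}" using P(3) p(1) by auto
  then have "P = X" using np P by blast
  then show ?thesis using P p by simp
qed

lemma prime_no_proper_subgroup:
  assumes X: "subgroup X G" "prime (card X)" and Z: "subgroup Z G" "Z \<subseteq> X" "Z \<noteq> {\<one>}"
  shows "Z = X"
proof -
  have "card Z = 1 \<or> card Z = card X"
    using card_dvd[OF Z(1) X(1) Z(2)] X(2) by (simp add: prime_nat_iff)
  then show ?thesis using card_1_iff Z X by (metis One_nat_def card_subset_eq finite_subgroup)
qed

text \<open>
  The index of \<open>N \<inter> P\<close> in \<open>P\<close> is a power of \<open>p\<close> and at most \<open>|Y : N|\<close>.
\<close>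

lemma subgroup_of_small_index:
  assumes P: "subgroup P G" "P \<subseteq> Y" "pi_number {p} (card P)"
    and N: "subgroup N G" "N \<subseteq> Y" and Y: "subgroup Y G" and lt: "index Y N < p"
  shows "P \<subseteq> N"
proof (rule ccontr)
  assume "\<not> P \<subseteq> N"
  then have "N \<inter> P \<noteq> P" by blast
  then have "index P (N \<inter> P) \<noteq> 1" using index_eq_1[of "N \<inter> P" P] P N by auto
  then obtain q where q: "prime q" "q dvd index P (N \<inter> P)" using prime_factor_nat by blast
  have "index P (N \<inter> P) dvd card P" using P N by (intro index_dvd_card) auto
  then have "q = p" using q P(3) dvd_trans by (auto simp: pi_number_def)
  moreover have pos: "0 < index P (N \<inter> P)" using index_pos[of "N \<inter> P" P] P N by simp
  ultimately have ge: "p \<le> index P (N \<inter> P)" using q dvd_imp_le by blast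
  have "N <#> P \<subseteq> Y" using set_mult_least[OF Y N(2) P(2)] .
  then have "card (N <#> P) \<le> card Y" using Y by (simp add: card_mono)
  then have "card N * card P \<le> card Y * card (N \<inter> P)"
    using card_set_mult[OF N(1) P(1)] by (metis mult_le_mono1)
  then have "card N * (index P (N \<inter> P) * card (N \<inter> P)) \<le> index Y N * card N * card (N \<inter> P)"
    using index_card[of "N \<inter> P" P] index_card[OF N(1) Y N(2)] P N by simp
  then have "(card N * card (N \<inter> P)) * index P (N \<inter> P) \<le> (card N * card (N \<inter> P)) * index Y N"
    by (simp add: mult_ac)
  moreover have "0 < card N * card (N \<inter> P)"
    using card_subgroup_pos[of N] card_subgroup_pos[of "N \<inter> P"] N P by simp
  ultimately have "index P (N \<inter> P) \<le> index Y N" by (metis mult_le_cancel1)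
  then show False using ge lt by linarith
qed

lemma finprod_swap:
  assumes P: "comm_monoid P" and "finite B" "finite A" "\<And>a b. a \<in> A \<Longrightarrow> b \<in> B \<Longrightarrow> f a b \<in> carrier P"
  shows "finprod P (\<lambda>a. finprod P (f a) B) A = finprod P (\<lambda>b. finprod P (\<lambda>a. f a b) A) B"
  using assms(2,4)
proof (induction B rule: finite_induct)
  interpret P: comm_monoid P by fact
  case empty
  then show ?case by simp
next
  interpret P: comm_monoid P by fact
  case (insert b B)
  have c: "f a \<in> B \<rightarrow> carrier P" "f a b \<in> carrier P" if "a \<in> A" for a using insert.prems that by auto
  have d: "(\<lambda>a. f a b') \<in> A \<rightarrow> carrier P" if "b' \<in> insert b B" for b' using insert.prems that by auto
  have "finprod P (\<lambda>a. finprod P (f a) (insert b B)) A = finprod P (\<lambda>a. f a b \<otimes>\<^bsub>P\<^esub> finprod P (f a) B) A"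
    by (rule P.finprod_cong') (use insert c in auto)
  also have "\<dots> = finprod P (\<lambda>a. f a b) A \<otimes>\<^bsub>P\<^esub> finprod P (\<lambda>a. finprod P (f a) B) A"
    by (rule P.finprod_multf) (use c in auto)
  also have "\<dots> = finprod P (\<lambda>b. finprod P (\<lambda>a. f a b) A) (insert b B)"
    using insert d by (subst P.finprod_insert) auto
  finally show ?case .
qed

text \<open>
  The situation is that of a Frobenius group \<open>A L\<close> acting on \<open>V\<close>, where neither \<open>A\<close> nor \<open>L\<close>
  has nontrivial fixed points. Multiply the images of \<open>v\<close> under all \<open>a l a\<^sup>-\<^sup>1\<close>. For fixed
  \<open>a\<close> the product over \<open>l\<close> is a norm for a conjugate of \<open>L\<close>, hence trivial. For fixed
  \<open>l \<noteq> \<one>\<close> the elements \<open>a l a\<^sup>-\<^sup>1 l\<^sup>-\<^sup>1\<close> run through \<open>A\<close>, so the product over \<open>a\<close> is a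
  norm for \<open>A\<close>, hence trivial as well. What remains is the contribution of \<open>l = \<one>\<close>, and
  \<open>v\<close> raised to the power \<open>|A|\<close> is \<open>\<one>\<close>.
\<close>

lemma fixed_point_free_pair:
  assumes V: "normal_in V Z" and ab: "\<And>x y. x \<in> V \<Longrightarrow> y \<in> V \<Longrightarrow> x \<otimes> y = y \<otimes> x"
    and A: "subgroup A G" "A \<subseteq> Z" and L: "subgroup L G" "L \<subseteq> Z"
    and LA: "\<And>l. l \<in> L \<Longrightarrow> conjg l A = A"
    and reg: "\<And>l. l \<in> L \<Longrightarrow> l \<noteq> \<one> \<Longrightarrow> centralizer_in A {l} = {\<one>}"
    and fA: "centralizer_in V A = {\<one>}" and fL: "centralizer_in V L = {\<one>}"
    and cop: "coprime (card A) (card V)"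
  shows "V = {\<one>}"
proof -
  note n = normal_inD[OF V]
  have c: "z \<in> carrier G" if "z \<in> Z" for z using that n subgroup_carrier by blast
  have cV: "z \<in> carrier G" if "z \<in> V" for z using that n subgroup_carrier by blast
  let ?P = "G\<lparr>carrier := V\<rparr>"
  interpret g: group ?P using n(1) by (rule subgroup_imp_group)
  interpret P: comm_group ?P by (rule g.group_comm_groupI) (use ab in auto)
  have conj_prod: "z \<otimes> finprod ?P f X \<otimes> inv z = finprod ?P (\<lambda>x. z \<otimes> f x \<otimes> inv z) X"
    if z: "z \<in> Z" and "finite X" "f \<in> X \<rightarrow> V" for z X and f :: "'a \<Rightarrow> 'a"
    using that(2,3)
  proof (induction X rule: finite_induct)
    case empty
    then show ?case using c[OF z] by simp
  next
    case (insert x F)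
    have 1: "f \<in> F \<rightarrow> V" "f x \<in> V" using insert.prems by auto
    then have 2: "(\<lambda>x. z \<otimes> f x \<otimes> inv z) \<in> F \<rightarrow> V" "z \<otimes> f x \<otimes> inv z \<in> V" using n(4) z by auto
    have 3: "finprod ?P f F \<in> V" using P.finprod_closed[of f F] 1 by simp
    have "z \<otimes> (f x \<otimes> finprod ?P f F) \<otimes> inv z = (z \<otimes> f x \<otimes> inv z) \<otimes> (z \<otimes> finprod ?P f F \<otimes> inv z)"
      using c[OF z] cV 1 3 by (simp add: m_assoc)
    then show ?case using insert.IH insert.hyps 1 2 P.finprod_insert[of F x f]
        P.finprod_insert[of F x "\<lambda>x. z \<otimes> f x \<otimes> inv z"] by simp
  qed
  have norm_fixed: "y \<otimes> finprod ?P (\<lambda>x. x \<otimes> v \<otimes> inv x) X \<otimes> inv y = finprod ?P (\<lambda>x. x \<otimes> v \<otimes> inv x) X"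
    if X: "subgroup X G" "X \<subseteq> Z" and v: "v \<in> V" and y: "y \<in> X" for X v y
  proof -
    have xv: "(\<lambda>x. x \<otimes> v \<otimes> inv x) \<in> X \<rightarrow> V" using n(4) v X by blast
    have im: "(\<lambda>x. y \<otimes> x) ` X = X"
    proof
      show "(\<lambda>x. y \<otimes> x) ` X \<subseteq> X" using y X subgroup.m_closed by fast
      show "X \<subseteq> (\<lambda>x. y \<otimes> x) ` X"
      proof
        fix x assume x: "x \<in> X"
        then have "x = y \<otimes> (inv y \<otimes> x)" using X y c by (simp add: subset_iff)
        moreover have "inv y \<otimes> x \<in> X"
          using x y X by (simp add: subgroup.m_closed subgroup.m_inv_closed)
        ultimately show "x \<in> (\<lambda>x. y \<otimes> x) ` X" by blast
      qed
    qed
    have "y \<otimes> finprod ?P (\<lambda>x. x \<otimes> v \<otimes> inv x) X \<otimes> inv y = finprod ?P (\<lambda>x. y \<otimes> (x \<otimes> v \<otimes> inv x) \<otimes> inv y) X"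
      by (rule conj_prod) (use X y xv in auto)
    also have "\<dots> = finprod ?P (\<lambda>x. (y \<otimes> x) \<otimes> v \<otimes> inv (y \<otimes> x)) X"
    proof (rule P.finprod_cong')
      fix x assume "x \<in> X"
      then have "x \<in> carrier G" "y \<in> carrier G" "v \<in> carrier G" using X y c v cV by auto
      then show "y \<otimes> (x \<otimes> v \<otimes> inv x) \<otimes> inv y = (y \<otimes> x) \<otimes> v \<otimes> inv (y \<otimes> x)" by (simp add: word)
    next
      show "(\<lambda>x. (y \<otimes> x) \<otimes> v \<otimes> inv (y \<otimes> x)) \<in> X \<rightarrow> carrier ?P"
        using n(4)[OF subsetD[OF X(2) subgroup.m_closed[OF X(1) y]] v] by auto
    qed simp
    also have "\<dots> = finprod ?P (\<lambda>x. x \<otimes> v \<otimes> inv x) ((\<lambda>x. y \<otimes> x) ` X)"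
      by (rule P.finprod_reindex[symmetric])
        (use xv im X y c in \<open>auto simp: inj_on_def subset_iff\<close>)
    finally show ?thesis using im by simp
  qed
  have norm_closed: "finprod ?P (\<lambda>x. x \<otimes> v \<otimes> inv x) X \<in> V" if "X \<subseteq> Z" "v \<in> V" for X v
    using P.finprod_closed[of "\<lambda>x. x \<otimes> v \<otimes> inv x" X] n(4) that by auto
  have norm_cent: "finprod ?P (\<lambda>x. x \<otimes> v \<otimes> inv x) X \<in> centralizer_in V X"
    if X: "subgroup X G" "X \<subseteq> Z" and v: "v \<in> V" for X v
  proof -
    let ?w = "finprod ?P (\<lambda>x. x \<otimes> v \<otimes> inv x) X"
    have "y \<otimes> ?w = ?w \<otimes> y" if y: "y \<in> X" for y
    proof -
      have "y \<otimes> ?w = (y \<otimes> ?w \<otimes> inv y) \<otimes> y"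
        using cV[OF norm_closed[OF X(2) v]] c y X(2) by (auto simp: m_assoc subset_iff)
      then show ?thesis using norm_fixed[OF X v y] by simp
    qed
    then show ?thesis using norm_closed[OF X(2) v] by (simp add: centralizer_in_def)
  qed
  have NA: "finprod ?P (\<lambda>x. x \<otimes> v \<otimes> inv x) A = \<one>" if "v \<in> V" for v
    using norm_cent[OF A that] fA by simp
  have NL: "finprod ?P (\<lambda>x. x \<otimes> v \<otimes> inv x) L = \<one>" if "v \<in> V" for v
    using norm_cent[OF L that] fL by simp
  have "v = \<one>" if v: "v \<in> V" for v
  proof -
    have vc: "v \<in> carrier G" using v cV by blast
    let ?f = "\<lambda>a l. (a \<otimes> l \<otimes> inv a) \<otimes> v \<otimes> inv (a \<otimes> l \<otimes> inv a)"
    have ZZ: "a \<otimes> l \<otimes> inv a \<in> Z" if "a \<in> A" "l \<in> L" for a l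
      using that A L by (auto intro!: subgroup.m_closed[OF n(2)] subgroup.m_inv_closed[OF n(2)])
    have fV: "?f a l \<in> V" if "a \<in> A" "l \<in> L" for a l using n(4)[OF ZZ[OF that] v] .
    have cc: "a \<in> carrier G" if "a \<in> A \<or> a \<in> L" for a using that A L c by auto
    have 1: "finprod ?P (?f a) L = \<one>" if a: "a \<in> A" for a
    proof -
      have av: "inv a \<otimes> v \<otimes> a \<in> V" using normal_in_inv[OF V _ v] a A by blast
      have "finprod ?P (?f a) L = finprod ?P (\<lambda>l. a \<otimes> (l \<otimes> (inv a \<otimes> v \<otimes> a) \<otimes> inv l) \<otimes> inv a) L"
      proof (rule P.finprod_cong')
        fix l assume "l \<in> L"
        then show "?f a l = a \<otimes> (l \<otimes> (inv a \<otimes> v \<otimes> a) \<otimes> inv l) \<otimes> inv a"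
          using a cc[of a] cc[of l] vc by (simp add: word)
      next
        show "(\<lambda>l. a \<otimes> (l \<otimes> (inv a \<otimes> v \<otimes> a) \<otimes> inv l) \<otimes> inv a) \<in> L \<rightarrow> carrier ?P"
          using n(4)[OF subsetD[OF A(2) a] n(4)[OF subsetD[OF L(2)] av]] by simp
      qed simp
      also have "\<dots> = a \<otimes> finprod ?P (\<lambda>l. l \<otimes> (inv a \<otimes> v \<otimes> a) \<otimes> inv l) L \<otimes> inv a"
        by (rule conj_prod[symmetric]) (use a A L av n(4) in auto)
      also have "\<dots> = \<one>" unfolding NL[OF av] using a cc by simp
      finally show ?thesis .
    qed
    have 2: "finprod ?P (\<lambda>a. ?f a l) A = \<one>" if l: "l \<in> L" "l \<noteq> \<one>" for l
    proof -
      have lv: "l \<otimes> v \<otimes> inv l \<in> V" using n(4) v l L by blast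
      let ?h = "\<lambda>a. a \<otimes> (l \<otimes> inv a \<otimes> inv l)"
      have lc: "l \<in> carrier G" using l cc by blast
      have hA: "?h ` A \<subseteq> A"
      proof
        fix x assume "x \<in> ?h ` A"
        then obtain a where a: "a \<in> A" "x = ?h a" by blast
        have "inv a \<in> A" using a subgroup.m_inv_closed[OF A(1)] by blast
        then have "l \<otimes> inv a \<otimes> inv l \<in> A" using LA[OF l(1)] by (auto simp: conjg_def)
        then show "x \<in> A" using a subgroup.m_closed[OF A(1)] by blast
      qed
      have inj: "inj_on ?h A"
      proof (rule inj_onI)
        fix a b assume a: "a \<in> A" and b: "b \<in> A" and e: "?h a = ?h b"
        have ac: "a \<in> carrier G" "b \<in> carrier G" using a b cc by auto
        have "inv b \<otimes> a \<otimes> l = inv b \<otimes> ?h a \<otimes> l \<otimes> a" using ac lc by (simp add: m_assoc)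
        also have "\<dots> = l \<otimes> (inv b \<otimes> a)" unfolding e using ac lc by (simp add: m_assoc)
        finally have "l \<otimes> (inv b \<otimes> a) = (inv b \<otimes> a) \<otimes> l" by simp
        moreover have "inv b \<otimes> a \<in> A"
          using a b A by (simp add: subgroup.m_closed subgroup.m_inv_closed)
        ultimately have "inv b \<otimes> a \<in> centralizer_in A {l}" by (simp add: centralizer_in_def)
        then have "inv b \<otimes> a = \<one>" using reg[OF l] by simp
        then have "b \<otimes> (inv b \<otimes> a) = b" using ac by simp
        then show "a = b" using ac by simp
      qed
      have im: "?h ` A = A" using endo_inj_surj[OF finite_subgroup[OF A(1)] hA inj] .
      have "finprod ?P (\<lambda>a. ?f a l) A = finprod ?P (\<lambda>a. ?h a \<otimes> (l \<otimes> v \<otimes> inv l) \<otimes> inv (?h a)) A"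
      proof (rule P.finprod_cong')
        fix a assume "a \<in> A"
        then show "?f a l = ?h a \<otimes> (l \<otimes> v \<otimes> inv l) \<otimes> inv (?h a)"
          using cc[of a] lc vc by (simp add: word)
      next
        show "(\<lambda>a. ?h a \<otimes> (l \<otimes> v \<otimes> inv l) \<otimes> inv (?h a)) \<in> A \<rightarrow> carrier ?P"
          using n(4)[OF subsetD[OF A(2) subsetD[OF hA imageI]] lv] by simp
      qed simp
      also have "\<dots> = finprod ?P (\<lambda>x. x \<otimes> (l \<otimes> v \<otimes> inv l) \<otimes> inv x) (?h ` A)"
        by (rule P.finprod_reindex[symmetric]) (use n(4)[OF subsetD[OF A(2)] lv] hA inj in auto)
      also have "\<dots> = \<one>" unfolding im using NA[OF lv] .
      finally show ?thesis .
    qed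
    have oneL: "\<one> \<in> L" using subgroup.one_closed[OF L(1)] .
    have "finprod ?P (\<lambda>a. finprod ?P (?f a) L) A = \<one>"
      using P.finprod_one_eqI[of A "\<lambda>a. finprod ?P (?f a) L"] 1 by simp
    moreover have "finprod ?P (\<lambda>a. finprod ?P (?f a) L) A = finprod ?P (\<lambda>l. finprod ?P (\<lambda>a. ?f a l) A) L"
      by (rule finprod_swap[OF P.comm_monoid_axioms]) (use A L fV in auto)
    moreover have "finprod ?P (\<lambda>l. finprod ?P (\<lambda>a. ?f a l) A) L
       = finprod ?P (\<lambda>a. ?f a \<one>) A \<otimes> finprod ?P (\<lambda>l. finprod ?P (\<lambda>a. ?f a l) A) (L - {\<one>})"
    proof -
      have cl: "finprod ?P (\<lambda>a. ?f a l) A \<in> V" if "l \<in> L" for l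
        using P.finprod_closed[of "\<lambda>a. ?f a l" A] fV that by auto
      have "finprod ?P (\<lambda>l. finprod ?P (\<lambda>a. ?f a l) A) (insert \<one> (L - {\<one>}))
        = finprod ?P (\<lambda>a. ?f a \<one>) A \<otimes>\<^bsub>?P\<^esub> finprod ?P (\<lambda>l. finprod ?P (\<lambda>a. ?f a l) A) (L - {\<one>})"
        by (rule P.finprod_insert) (use cl oneL L in auto)
      then show ?thesis using oneL by (simp add: insert_absorb)
    qed
    moreover have "finprod ?P (\<lambda>l. finprod ?P (\<lambda>a. ?f a l) A) (L - {\<one>}) = \<one>"
      using P.finprod_one_eqI[of "L - {\<one>}" "\<lambda>l. finprod ?P (\<lambda>a. ?f a l) A"] 2 by simp
    moreover have "finprod ?P (\<lambda>a. ?f a \<one>) A = v [^]\<^bsub>?P\<^esub> card A"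
    proof -
      have "finprod ?P (\<lambda>a. ?f a \<one>) A = finprod ?P (\<lambda>a. v) A"
        by (rule P.finprod_cong') (use cc vc v in \<open>auto simp: r_inv\<close>)
      also have "\<dots> = v [^]\<^bsub>?P\<^esub> card A" by (rule P.finprod_const) (use v in simp)
      finally show ?thesis .
    qed
    moreover have "v [^]\<^bsub>?P\<^esub> card A \<in> V" using g.nat_pow_closed[of v "card A"] v by simp
    ultimately have "v [^]\<^bsub>?P\<^esub> card A = \<one>\<^bsub>?P\<^esub>" using cV by simp
    then have "g.ord v dvd card A" using g.pow_eq_id v by simp
    moreover have "g.ord v dvd card V" using g.ord_dvd_group_order[of v] v by (simp add: order_def)
    ultimately have "g.ord v = 1" using cop by (metis coprime_common_divisor_nat)
    then show "v = \<one>" using g.ord_eq_1[of v] v by simp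
  qed
  then show ?thesis using subgroup.one_closed[OF n(1)] by blast
qed

end

section \<open>Groups without normal Hall subgroups\<close>

text \<open>
  The aim is a contradiction for \<open>Y \<noteq> {\<one>}\<close>. The hypothesis \<open>deepY\<close> and the lower bound
  for the length of chains are played off against each other: a chain from \<open>Y\<close> to a Hall
  subgroup of one of the \<open>n\<close> classes has at most \<open>n\<close> steps (\<open>short_hall\<close>), while the classes
  dividing the index already require \<open>n - 1\<close>.
\<close>

locale no_normal_hall = sigma_fin_group +
  fixes Y :: "'a set" and n :: nat
  assumes solY: "sigma_sol Y" and deepY: "deep_in_hall n Y" and n_def: "n = card (classes_of (card Y))"
    and no_normal: "\<And>s H. s \<in> classes_of (card Y) \<Longrightarrow> hall s H Y \<Longrightarrow> \<not> normal_in H Y"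
begin

abbreviation "CY \<equiv> classes_of (card Y)"

lemma sY: "subgroup Y G" using solY by (simp add: sigma_sol_def)

lemma CYs: "s \<in> CY \<Longrightarrow> s \<in> \<sigma>" by (simp add: classes_of_def)

lemma finCY: "finite CY"
proof -
  obtain k where "max_chain k Y {\<one>}"
    using max_chain_ex[OF triv_subgroup _ sY] subgroup.one_closed[OF sY] by blast
  then show ?thesis using max_chain_classes[OF _ solY] by fastforce
qed

lemma hall_exY: "s \<in> \<sigma> \<Longrightarrow> \<exists>H. hall s H Y"
  using hall_ex[OF class_closed_class solY] .

lemma hall_ne: assumes "s \<in> CY" "hall s H Y" shows "card H \<noteq> 1" "H \<noteq> {\<one>}"
proof -
  note h = hallD[OF assms(2)]
  show *: "card H \<noteq> 1"
  proof
    assume "card H = 1"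
    then have "index Y H = card Y" by (simp add: index_def)
    then show False using h(5) assms(1) classes_of_iff[OF CYs[OF assms(1)]] by auto
  qed
  then show "H \<noteq> {\<one>}" by auto
qed

lemma short_hall:
  assumes "s \<in> CY" "hall s H Y" "max_chain k Y H" shows "k \<le> n"
proof (rule ccontr)
  assume "\<not> k \<le> n"
  then have "H \<subseteq> core_in Y H" using deep_in_core[OF deepY assms(3) _ CYs hallD(4)] assms by auto
  then have "core_in Y H = H" using core_in_props(2)[OF sY hallD(1,3)] assms by blast
  then show False using no_normal[OF assms(1,2)] core_in_props(1)[OF sY hallD(1,3)] assms(2)
    by metis
qed

text \<open>
  The largest normal \<open>s\<close>-subgroup of \<open>Y\<close>; by \<open>hall_core_props\<close> every Hall \<open>s\<close>-subgroup has
  this core.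
\<close>

definition hall_core :: "nat set \<Rightarrow> 'a set" where
  "hall_core s = core_in Y (SOME H. hall s H Y)"

lemma hall_core_props:
  assumes s: "s \<in> \<sigma>"
  shows "normal_in (hall_core s) Y" "pi_number s (card (hall_core s))" "\<And>N. normal_in N Y \<Longrightarrow> pi_number s (card N) \<Longrightarrow> N \<subseteq> hall_core s"
    "\<And>H. hall s H Y \<Longrightarrow> core_in Y H = hall_core s" "\<And>H. hall s H Y \<Longrightarrow> hall_core s \<subseteq> H"
proof -
  let ?H = "SOME H. hall s H Y"
  have H: "hall s ?H Y" using someI_ex[OF hall_exY[OF s]] .
  note h = hallD[OF H] and c = core_in_props[OF sY hallD(1)[OF H] hallD(3)[OF H], folded hall_core_def]
  show 1: "normal_in (hall_core s) Y" using c(1) .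
  show 2: "pi_number s (card (hall_core s))"
    using h(4) card_dvd[OF normal_inD(1)[OF 1] h(1) c(2)] pi_number_dvd by blast
  show 3: "N \<subseteq> hall_core s" if "normal_in N Y" "pi_number s (card N)" for N
    using c(3)[OF that(1)] normal_pi_in_hall[OF that H] by blast
  show 4: "hall_core s \<subseteq> H'" if "hall s H' Y" for H' using normal_pi_in_hall[OF 1 2 that] .
  show "core_in Y H' = hall_core s" if H': "hall s H' Y" for H'
  proof -
    note h' = hallD[OF H'] and c' = core_in_props[OF sY hallD(1)[OF H'] hallD(3)[OF H']]
    have "pi_number s (card (core_in Y H'))"
      using h'(4) card_dvd[OF normal_inD(1)[OF c'(1)] h'(1) c'(2)] pi_number_dvd by blast
    then show ?thesis using 3[OF c'(1)] c'(3)[OF 1 4[OF H']] by blast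
  qed
qed

lemma hall_core_ne_hall: assumes "s \<in> CY" "hall s H Y" shows "hall_core s \<noteq> H"
  using hall_core_props(1)[OF CYs[OF assms(1)]] no_normal[OF assms] by metis

lemma deep_in_hall_core:
  assumes "s \<in> CY" "hall s H Y" "max_chain k Y X" "n < k" "pi_number s (card X)" shows "X \<subseteq> hall_core s"
  using deep_in_core[OF deepY assms(3,4) CYs[OF assms(1)] assms(5,2)] hall_core_props(4)[OF CYs[OF assms(1)] assms(2)]
  by simp

lemma coprime_classes:
  assumes "s \<in> \<sigma>" "t \<in> \<sigma>" "s \<noteq> t" "pi_number s a" "pi_number t b" shows "coprime a b"
  using pi_number_disjoint_coprime[OF assms(4,5)] classes_disjoint assms by blast

lemma class_in_index:
  assumes Z: "subgroup Z G" "Z \<subseteq> Y" and s: "s \<in> CY" "hall s H Y" and nd: "\<not> card H dvd card Z"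
  shows "s \<in> classes_of (index Y Z)"
proof (rule ccontr)
  assume "s \<notin> classes_of (index Y Z)"
  then have "pi_number (- s) (index Y Z)" using classes_of_iff CYs s by blast
  then have "coprime (card H) (index Y Z)" using hallD(4)[OF s(2)] pi_number_coprime by blast
  moreover have "card H dvd index Y Z * card Z"
    using index_card[OF Z(1) sY Z(2)] card_dvd[OF hallD(1)[OF s(2)] sY hallD(3)[OF s(2)]] by simp
  ultimately show False using nd by (simp add: coprime_dvd_mult_right_iff)
qed

lemma hall_not_dvd_hall_core:
  assumes s: "s \<in> CY" "hall s H Y" and a: "a \<in> \<sigma>" shows "\<not> card H dvd card (hall_core a)"
proof
  assume d: "card H dvd card (hall_core a)"
  note o = hall_core_props[OF a]
  show False
  proof (cases "s = a")
    case True
    have "hall_core a \<subseteq> H" using o(5) True s by blast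
    moreover have "card H \<le> card (hall_core a)"
      using d card_subgroup_pos[OF normal_inD(1)[OF o(1)]] dvd_imp_le by blast
    ultimately have "hall_core a = H"
      using card_seteq[OF finite_subgroup[OF hallD(1)[OF s(2)]]] by blast
    then show False using hall_core_ne_hall[OF s] True by simp
  next
    case False
    have "coprime (card H) (card (hall_core a))"
      using coprime_classes[OF CYs[OF s(1)] a False hallD(4)[OF s(2)] o(2)] .
    then show False using d hall_ne(1)[OF s] coprime_absorb_left by auto
  qed
qed

text \<open>
  No class other than \<open>u\<close> is exhausted by \<open>N H\<close>, so all of them divide its index.
\<close>

lemma chain_to_NH:
  assumes N: "normal_in N Y" and u: "u \<in> CY" "hall u H Y"
    and nd: "\<And>s K. s \<in> CY \<Longrightarrow> hall s K Y \<Longrightarrow> \<not> card K dvd card N"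
    and c: "max_chain k Y (N <#> H)"
  shows "n \<le> k + 1"
proof -
  note h = hallD[OF u(2)] and nn = normal_inD[OF N] and sm = set_mult_subgroup[OF N hallD(1)[OF u(2)] hallD(3)[OF u(2)]]
  have "CY - {u} \<subseteq> classes_of (index Y (N <#> H))"
  proof
    fix s assume s: "s \<in> CY - {u}"
    obtain K where K: "hall s K Y" using hall_exY CYs s by blast
    have "\<not> card K dvd card (N <#> H)"
    proof
      assume "card K dvd card (N <#> H)"
      then have "card K dvd card N * card H"
        using card_set_mult[OF nn(1) h(1)] by (metis dvd_mult2 dvd_refl mult.commute)
      moreover have "coprime (card K) (card H)"
        using coprime_classes[OF _ _ _ hallD(4)[OF K] h(4)] CYs s u by blast
      ultimately show False using nd[OF _ K] s by (simp add: coprime_dvd_mult_left_iff)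
    qed
    then show "s \<in> classes_of (index Y (N <#> H))" using class_in_index[OF sm(1,2) _ K] s by blast
  qed
  then have "card (CY - {u}) \<le> k" using max_chain_lower[OF c solY] by blast
  then show ?thesis using u(1) finCY by (simp add: n_def)
qed

context
  fixes a assumes a: "a \<in> CY" and Oa: "hall_core a \<noteq> {\<one>}"
begin

lemmas oa = hall_core_props[OF CYs[OF a]]
lemmas oaD = normal_inD[OF oa(1)]

lemma hall_core_Int_hall: assumes "u \<in> CY" "u \<noteq> a" "hall u H Y" shows "hall_core a \<inter> H = {\<one>}"
  by (rule coprime_Int[OF oaD(1) hallD(1)[OF assms(3)]])
    (rule coprime_classes[OF CYs[OF a] CYs[OF assms(1)] _ oa(2) hallD(4)[OF assms(3)]], use assms in auto)

lemma chain_to_core_hall: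
  assumes u: "u \<in> CY" "u \<noteq> a" "hall u H Y"
  obtains k where "max_chain k Y (hall_core a <#> H)" "n \<le> k + 1"
proof -
  note sm = set_mult_subgroup[OF oa(1) hallD(1)[OF u(3)] hallD(3)[OF u(3)]]
  obtain k where k: "max_chain k Y (hall_core a <#> H)" using max_chain_ex[OF sm(1,2) sY] by blast
  have "n \<le> k + 1" using chain_to_NH[OF oa(1) u(1,3) _ k] hall_not_dvd_hall_core CYs a by blast
  then show ?thesis using k that by blast
qed

lemma hall_ne_core_hall: assumes "u \<in> CY" "u \<noteq> a" "hall u H Y" shows "H \<noteq> hall_core a <#> H"
  using hall_core_Int_hall[OF assms] set_mult_subgroup(3)[OF oa(1) hallD(1,3)[OF assms(3)]] Oa
  by blast

text \<open>
  An intermediate subgroup would give a chain from \<open>Y\<close> to \<open>H\<close> with at least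
  \<open>(n - 1) + 2\<close> steps.
\<close>

lemma hall_maximal_in_core_hall:
  assumes u: "u \<in> CY" "u \<noteq> a" "hall u H Y" shows "maximal_in H (hall_core a <#> H)"
proof (rule ccontr)
  assume n: "\<not> maximal_in H (hall_core a <#> H)"
  note sm = set_mult_subgroup[OF oa(1) hallD(1)[OF u(3)] hallD(3)[OF u(3)]]
  obtain k where k: "max_chain k Y (hall_core a <#> H)" "n \<le> k + 1" using chain_to_core_hall[OF u] .
  obtain l where l: "max_chain l (hall_core a <#> H) H"
    using max_chain_ex[OF hallD(1)[OF u(3)] sm(4,1)] by blast
  have "2 \<le> l" using max_chain_ge_2[OF l n hall_ne_core_hall[OF u]] .
  moreover have "k + l \<le> n" using short_hall[OF u(1,3) max_chain_append[OF l k(1)]] .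
  ultimately show False using k by simp
qed

lemma proper_subgroup_in_hall_core:
  assumes u: "u \<in> CY" "u \<noteq> a" "hall u H Y" and X: "subgroup X G" "X \<subseteq> H" "X \<noteq> H"
  shows "X \<subseteq> hall_core u"
proof -
  note h = hallD[OF u(3)]
  obtain M where M: "maximal_in M H" "X \<subseteq> M" using maximal_in_ex[OF X h(1)] by blast
  obtain k where k: "max_chain k Y (hall_core a <#> H)" "n \<le> k + 1" using chain_to_core_hall[OF u] .
  have "max_chain (Suc (Suc k)) Y M"
    using max_chain_Suc[OF max_chain_Suc[OF k(1) hall_maximal_in_core_hall[OF u]] M(1)] .
  moreover have "pi_number u (card M)"
    using h(4) card_dvd[OF maximal_inD(1)[OF M(1)] h(1) maximal_inD(3)[OF M(1)]] pi_number_dvd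
    by blast
  ultimately have "M \<subseteq> hall_core u" using deep_in_hall_core[OF u(1,3)] k by simp
  then show ?thesis using M by blast
qed

lemma minimal_hall_core:
  assumes u: "u \<in> CY" "u \<noteq> a" "hall u H Y" and E: "normal_in E (hall_core a <#> H)" "E \<subseteq> hall_core a"
  shows "E = {\<one>} \<or> E = hall_core a"
proof -
  note h = hallD[OF u(3)] and m = maximal_inD[OF hall_maximal_in_core_hall[OF u]] and e = normal_inD[OF E(1)]
  note s = set_mult_subgroup[OF E(1) h(1) m(3)]
  have i: "E \<inter> H = {\<one>}"
    using hall_core_Int_hall[OF u] E(2) subgroup.one_closed[OF e(1)] subgroup.one_closed[OF h(1)]
    by blast
  consider "E <#> H = H" | "E <#> H = hall_core a <#> H" using m(5)[OF s(1,4,2)] by blast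
  then show ?thesis
  proof cases
    case 1
    then show ?thesis using s(3) i by blast
  next
    case 2
    have "card E * card H = card (hall_core a) * card H"
      using card_set_mult[OF e(1) h(1)] card_set_mult[OF oaD(1) h(1)] 2 i hall_core_Int_hall[OF u]
      by simp
    then have "card E = card (hall_core a)" using card_subgroup_pos[OF h(1)] by simp
    then show ?thesis using card_subset_eq[OF finite_subgroup[OF oaD(1)] E(2)] by blast
  qed
qed

end

text \<open>
  With a third class \<open>u\<close>, the chain through \<open>O\<^sub>b O\<^sub>a H\<close> and \<open>O\<^sub>a H\<close> down to a Hall
  \<open>u\<close>-subgroup \<open>H\<close> would be too long, where \<open>O\<^sub>a\<close> and \<open>O\<^sub>b\<close> are the two cores.
\<close>

lemma two_cores_two_classes:
  assumes a: "a \<in> CY" "hall_core a \<noteq> {\<one>}" and b: "b \<in> CY" "hall_core b \<noteq> {\<one>}" "a \<noteq> b" and u: "u \<in> CY"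
  shows "u = a \<or> u = b"
proof (rule ccontr)
  assume "\<not> ?thesis"
  then have ne: "u \<noteq> a" "u \<noteq> b" by auto
  obtain H where H: "hall u H Y" using hall_exY CYs u by blast
  note h = hallD[OF H]
  note oA = hall_core_props[OF CYs[OF a(1)]] and oB = hall_core_props[OF CYs[OF b(1)]]
  note sa = normal_inD[OF oA(1)] and sb = normal_inD[OF oB(1)]
  let ?N = "hall_core b <#> hall_core a"
  have N: "normal_in ?N Y" using set_mult_normal[OF oB(1) oA(1)] .
  note sn = normal_inD[OF N]
  have i: "hall_core b \<inter> hall_core a = {\<one>}"
    by (rule coprime_Int[OF sb(1) sa(1)])
      (rule coprime_classes[OF CYs[OF b(1)] CYs[OF a(1)] _ oB(2) oA(2)], use b in auto)
  have cN: "card ?N = card (hall_core b) * card (hall_core a)"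
    using card_set_mult[OF sb(1) sa(1)] i by simp
  have nd: "\<not> card K dvd card ?N" if s: "s \<in> CY" "hall s K Y" for s K
  proof
    assume d: "card K dvd card ?N"
    note k = hallD[OF s(2)]
    show False
    proof (cases "s = a")
      case True
      then have "coprime (card K) (card (hall_core b))"
        using coprime_classes[OF CYs[OF s(1)] CYs[OF b(1)] _ k(4) oB(2)] b by blast
      then show False using d cN hall_not_dvd_hall_core[OF s CYs[OF a(1)]]
        by (simp add: coprime_dvd_mult_right_iff)
    next
      case False
      then have "coprime (card K) (card (hall_core a))"
        using coprime_classes[OF CYs[OF s(1)] CYs[OF a(1)] _ k(4) oA(2)] by blast
      then show False using d cN hall_not_dvd_hall_core[OF s CYs[OF b(1)]]
        by (simp add: coprime_dvd_mult_left_iff)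
    qed
  qed
  note nh = set_mult_subgroup[OF N h(1,3)] and ah = set_mult_subgroup[OF oA(1) h(1,3)]
  obtain k where k: "max_chain k Y (?N <#> H)" using max_chain_ex[OF nh(1,2) sY] by blast
  have 1: "n \<le> k + 1" using chain_to_NH[OF N u H nd k] .
  have sub: "hall_core a <#> H \<subseteq> ?N <#> H"
    using mono_set_mult[OF set_mult_subgroup(4)[OF oB(1) sa(1,3)] subset_refl] .
  obtain l where l: "max_chain l (?N <#> H) (hall_core a <#> H)"
    using max_chain_ex[OF ah(1) sub nh(1)] by blast
  have "hall_core a <#> H \<noteq> ?N <#> H"
  proof
    assume e: "hall_core a <#> H = ?N <#> H"
    have "hall_core b \<subseteq> ?N <#> H" using set_mult_subgroup(3)[OF oB(1) sa(1,3)] nh(3) by blast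
    then have d: "card (hall_core b) dvd card (hall_core a <#> H)"
      unfolding e[symmetric] using sb(1) ah(1) by (intro card_dvd) auto
    have "card (hall_core a <#> H) * card (hall_core a \<inter> H) = card (hall_core a) * card H"
      using card_set_mult[OF sa(1) h(1)] .
    then have "card (hall_core b) dvd card (hall_core a) * card H" using d by (metis dvd_mult2)
    moreover have "coprime (card (hall_core b)) (card (hall_core a))"
      by (rule coprime_classes[OF CYs[OF b(1)] CYs[OF a(1)] _ oB(2) oA(2)]) (use b in auto)
    moreover have "coprime (card (hall_core b)) (card H)"
      by (rule coprime_classes[OF CYs[OF b(1)] CYs[OF u] _ oB(2) h(4)]) (use ne in auto)
    ultimately have "card (hall_core b) dvd 1"
      by (metis coprime_dvd_mult_right_iff coprime_absorb_left is_unit_gcd gcd_nat.absorb1 coprime_iff_gcd_eq_1)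
    then show False using b(2) card_1_iff[OF sb(1)] by simp
  qed
  then have 2: "1 \<le> l" using max_chain_pos[OF l] by blast
  have "max_chain (Suc (k + l)) Y H"
    using max_chain_Suc[OF max_chain_append[OF l k] hall_maximal_in_core_hall[OF a u ne(1) H]] .
  then show False using short_hall[OF u H] 1 2 by fastforce
qed

text \<open>
  All proper subgroups of \<open>H\<close> lie in its core \<open>O\<close>, so any \<open>x\<close> outside \<open>O\<close> generates
  \<open>H\<close>. In particular \<open>H\<close> is abelian, and for a prime \<open>p\<close> dividing \<open>|O|\<close> the elements of
  \<open>O\<close> with \<open>p\<close>-th power \<open>\<one>\<close> form a nontrivial normal subgroup of \<open>Y\<close>, which by
  \<open>minimal_hall_core\<close> is \<open>O\<close>. Since the \<open>p\<close>-th power of \<open>x\<close> lies in \<open>O\<close>, the order of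
  \<open>x\<close> divides \<open>p\<^sup>2\<close>.
\<close>

lemma hall_core_prime_hall_prime_square:
  assumes a: "a \<in> CY" "hall_core a \<noteq> {\<one>}" and b: "b \<in> CY" "hall_core b \<noteq> {\<one>}" "a \<noteq> b" and H: "hall a H Y"
  shows "\<exists>p. prime p \<and> p \<in> a \<and> card H = p ^ 2 \<and> card (hall_core a) = p"
proof -
  note h = hallD[OF H] and o = hall_core_props[OF CYs[OF a(1)]]
  note so = normal_inD[OF o(1)]
  have OH: "hall_core a \<subseteq> H" "hall_core a \<noteq> H" using o(5)[OF H] hall_core_ne_hall[OF a(1) H] by auto
  have proper: "X \<subseteq> hall_core a" if "subgroup X G" "X \<subseteq> H" "X \<noteq> H" for X
    using proper_subgroup_in_hall_core[OF b(1,2) a(1) b(3) H that] .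
  obtain x where x: "x \<in> H" "x \<notin> hall_core a" using OH by blast
  have xc: "x \<in> carrier G" using x h subgroup_carrier by blast
  have gen: "subgroup (generate G {y}) G \<and> generate G {y} \<subseteq> H \<and> y \<in> generate G {y}" if "y \<in> H" for y
  proof -
    have "y \<in> carrier G" using that h subgroup_carrier by blast
    then show ?thesis
      using generate_is_subgroup[of "{y}"] generate_subgroup_incl[OF _ h(1), of "{y}"] that
      generate.incl[of y "{y}" G] by auto
  qed
  have gx: "generate G {x} = H" using gen[OF x(1)] proper x by blast
  have ordx: "ord x = card H" using generate_pow_card[OF xc] gx by simp
  have comm: "y \<otimes> z = z \<otimes> y" if yz: "y \<in> H" "z \<in> H" for y z
  proof -
    obtain i j :: int where "y = x [^] i" "z = x [^] j" using yz generate_pow[OF xc] gx by auto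
    then show ?thesis using xc by (simp add: int_pow_mult[symmetric] add.commute)
  qed
  have "card (hall_core a) \<noteq> 1" using card_1_iff[OF so(1)] a(2) by simp
  then obtain p where p: "prime p" "p dvd card (hall_core a)" using prime_factor_nat by blast
  have pa: "p \<in> a" using p o(2) by (auto simp: pi_number_def)
  have pH: "p dvd card H" using p card_dvd[OF so(1) h(1) OH(1)] dvd_trans by blast
  have "x [^] p \<in> hall_core a"
  proof -
    have xpH: "x [^] p \<in> H" 
    proof (induction p)
      case (Suc k)
      then show ?case using x(1) subgroup.m_closed[OF h(1)] by simp
    qed (use subgroup.one_closed[OF h(1)] in simp)
    have "ord (x [^] p) = ord x div p" using ord_pow[OF xc] pH ordx p by (metis not_prime_0)
    then have "card (generate G {x [^] p}) = card H div p"
      using generate_pow_card[of "x [^] p"] xc ordx by simp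
    moreover have "card H div p < card H"
      using card_subgroup_pos[OF h(1)] prime_gt_1_nat[OF p(1)] by simp
    ultimately have "generate G {x [^] p} \<noteq> H" by auto
    then show ?thesis using proper gen[OF xpH] by blast
  qed
  define E where "E = {y \<in> hall_core a. y [^] p = \<one>}"
  have E: "normal_in E Y"
  proof -
    have c: "y \<in> carrier G" if "y \<in> hall_core a" for y using that so subgroup_carrier by blast
    have "subgroup E G"
    proof (rule subgroupI)
      show "E \<subseteq> carrier G" using c by (auto simp: E_def)
      have "\<one> \<in> E" using subgroup.one_closed[OF so(1)] by (simp add: E_def)
      then show "E \<noteq> {}" by blast
      fix y assume y: "y \<in> E"
      then show "inv y \<in> E" using c subgroup.m_inv_closed[OF so(1)] by (simp add: E_def nat_pow_inv)
      fix z assume z: "z \<in> E"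
      have "(y \<otimes> z) [^] p = y [^] p \<otimes> z [^] p"
        by (rule pow_mult_distrib) (use y z c subsetD[OF OH(1)] comm[of y z] in \<open>auto simp: E_def\<close>)
      then show "y \<otimes> z \<in> E" using y z subgroup.m_closed[OF so(1)] by (simp add: E_def)
    qed
    moreover have "g \<otimes> y \<otimes> inv g \<in> E" if "g \<in> Y" "y \<in> E" for g y
    proof -
      have gc: "g \<in> carrier G" "y \<in> carrier G"
        using that subgroup_carrier[OF sY] c by (auto simp: E_def)
      have "(g \<otimes> y \<otimes> inv g) [^] k = g \<otimes> y [^] k \<otimes> inv g" for k :: nat
      proof (induction k)
        case (Suc k)
        then show ?case using gc by (simp add: m_assoc)
      qed (use gc in simp)
      then show ?thesis using that so(4) gc by (simp add: E_def)
    qed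
    ultimately show ?thesis unfolding normal_in_def using sY so(3) by (auto simp: E_def)
  qed
  have EO: "E = hall_core a"
  proof -
    obtain K where K: "hall b K Y" using hall_exY CYs b by blast
    have oK: "hall_core a <#> K \<subseteq> Y" "hall_core a \<subseteq> hall_core a <#> K" "subgroup (hall_core a <#> K) G"
      using set_mult_subgroup[OF o(1) hallD(1)[OF K] hallD(3)[OF K]] by auto
    have EOa: "E \<subseteq> hall_core a" by (auto simp: E_def)
    have "normal_in E (hall_core a <#> K)"
      using normal_in_mono[OF E oK(3) _ oK(1)] EOa oK(2) by blast
    then have "E = {\<one>} \<or> E = hall_core a" using minimal_hall_core[OF a b(1) _ K _ EOa] b(3) by blast
    moreover have "E \<noteq> {\<one>}"
    proof
      assume e: "E = {\<one>}"
      obtain P where P: "subgroup P G" "P \<subseteq> hall_core a" "card P = p"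
        using cauchy[OF p(1) so(1) p(2)] by blast
      have "P \<subseteq> E"
      proof
        fix y assume y: "y \<in> P"
        have yc: "y \<in> carrier G" using y P subgroup_carrier by blast
        have "generate G {y} \<subseteq> P" using generate_subgroup_incl[OF _ P(1)] y by blast
        then have "ord y dvd p"
          using generate_pow_card[OF yc] card_dvd[OF generate_is_subgroup P(1)] yc P(3) by auto
        then have "y [^] p = \<one>" using yc pow_eq_id by blast
        then show "y \<in> E" using y P by (auto simp: E_def)
      qed
      then have "P = {\<one>}" using e subgroup.one_closed[OF P(1)] by blast
      then show False using P(3) p(1) by auto
    qed
    ultimately show ?thesis by blast
  qed
  have "(x [^] p) [^] p = \<one>" using \<open>x [^] p \<in> hall_core a\<close> EO by (auto simp: E_def)
  then have "x [^] (p * p) = \<one>" using xc by (simp add: nat_pow_pow)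
  then have "card H dvd p ^ 2" using pow_eq_id[OF xc] ordx by (simp add: power2_eq_square)
  then obtain i where i: "i \<le> 2" "card H = p ^ i" using divides_primepow_nat[OF p(1)] by blast
  have lt: "card (hall_core a) < card H" using OH h(1) by (simp add: psubset_card_mono psubset_eq)
  have d: "card (hall_core a) dvd card H" using card_dvd[OF so(1) h(1) OH(1)] .
  then obtain j where j: "j \<le> i" "card (hall_core a) = p ^ j"
    using i divides_primepow_nat[OF p(1)] by metis
  have "j \<noteq> 0" using j \<open>card (hall_core a) \<noteq> 1\<close> by auto
  moreover have "j \<noteq> i" using lt i j by auto
  ultimately have "j = 1" "i = 2" using i(1) j(1) by auto
  then show ?thesis using p pa i j by auto
qed

text \<open>
  The order of \<open>Y\<close> is \<open>p\<^sup>2 q\<^sup>2\<close>. The index of \<open>H\<close> in \<open>T = O\<^sub>b H\<close> is \<open>q < p\<close>, hence \<open>H\<close>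
  is normal in \<open>T\<close>. So the normaliser of \<open>H\<close> has index at most \<open>q\<close> in \<open>Y\<close>; it contains every
  conjugate of \<open>H\<close>, and \<open>H\<close> is its only Sylow \<open>p\<close>-subgroup.
\<close>

lemma prime_square_halls_contradiction:
  assumes a: "a \<in> CY" "hall_core a \<noteq> {\<one>}" and b: "b \<in> CY" "hall_core b \<noteq> {\<one>}" "a \<noteq> b"
    and H: "hall a H Y" and K: "hall b K Y" and p: "prime p" "card H = p ^ 2"
    and q: "card (hall_core b) = q" "card K = q ^ 2" and lt: "q < p"
  shows False
proof -
  note h = hallD[OF H] and k = hallD[OF K] and oB = hall_core_props[OF CYs[OF b(1)]]
  note sb = normal_inD[OF oB(1)]
  have pH: "pi_number {p} (card H)" using p pi_number_prime_power by simp
  have i: "hall_core b \<inter> H = {\<one>}" using hall_core_Int_hall[OF b(1,2) a(1) b(3) H] .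
  let ?T = "hall_core b <#> H"
  note t = set_mult_subgroup[OF oB(1) h(1,3)]
  have cT: "card ?T = q * card H" using card_set_mult[OF sb(1) h(1)] i q by simp
  have qpos: "0 < q" using card_subgroup_pos[OF sb(1)] q by simp
  have "index ?T H * card H = q * card H" using index_card[OF h(1) t(1,4)] cT by simp
  then have iT: "index ?T H = q"
    using card_subgroup_pos[OF h(1)] by (metis mult_right_cancel less_irrefl)
  have index_YH: "index Y H \<le> q ^ 2"
  proof -
    have "coprime (index Y H) (index Y K)"
    proof (rule ccontr)
      assume "\<not> coprime (index Y H) (index Y K)"
      then obtain r where r: "prime r" "r dvd index Y H" "r dvd index Y K"
        using coprime_iff_gcd_eq_1 prime_factor_nat by (metis gcd_nat.boundedE)
      have "r dvd card Y" using r(2) index_dvd_card[OF h(1,2,3)] dvd_trans by blast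
      obtain s where s: "s \<in> \<sigma>" "r \<in> s" using class_of_prime r by blast
      then have "s \<in> CY" using r \<open>r dvd card Y\<close> by (auto simp: classes_of_def)
      then have "s = a \<or> s = b" using two_cores_two_classes[OF a b] by blast
      then show False using r s h(5) k(5) by (auto simp: pi_number_def)
    qed
    moreover have "index Y H dvd index Y K * card K"
      using index_dvd_card[OF h(1,2,3)] index_card[OF k(1,2,3)] by simp
    ultimately have "index Y H dvd card K" by (simp add: coprime_dvd_mult_right_iff)
    then show ?thesis using q card_subgroup_pos[OF k(1)] dvd_imp_le by metis
  qed
  have cc: "g \<in> carrier G" if "g \<in> Y" for g using that subgroup_carrier[OF sY] by blast
  have Hc: "H \<subseteq> carrier G" using subgroup.subset[OF h(1)] .
  let ?N = "normalizer_in Y H"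
  have sN: "subgroup ?N G" using normalizer_in_subgroup[OF sY Hc] .
  note nz = normalizer_in_props[OF sY h(1,3)]
  have TN: "?T \<subseteq> ?N"
  proof
    fix g assume g: "g \<in> ?T"
    have gY: "g \<in> Y" using g t by blast
    have sub: "conjg g H \<subseteq> ?T" using conjg_subset[OF t(1,4) g] .
    have "index ?T H < p" using iT lt by simp
    then have "conjg g H \<subseteq> H"
      by (intro subgroup_of_small_index[OF conjg_subgroup[OF cc[OF gY] h(1)] sub _ h(1) t(4,1)])
        (use pH cc[OF gY] Hc in auto)
    then have "conjg g H = H" using card_subset_eq[OF finite_subgroup[OF h(1)]] cc[OF gY] Hc by simp
    then show "g \<in> ?N" using gY by (simp add: normalizer_in_def)
  qed
  have "index Y ?T * q \<le> q ^ 2" using index_mult[OF h(1) t(1) sY t(4,2)] iT index_YH by simp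
  then have "index Y ?T \<le> q" using qpos by (simp add: power2_eq_square)
  moreover have "index Y ?N dvd index Y ?T" using index_mult[OF t(1) sN sY TN nz(3)] by simp
  moreover have "0 < index Y ?T" using index_pos[OF t(1) sY t(2)] .
  ultimately have iN: "index Y ?N < p"
    using lt dvd_imp_le by (metis le_trans less_le_not_le linorder_not_less)
  have "conjg g H = H" if g: "g \<in> Y" for g
  proof -
    have sc: "subgroup (conjg g H) G" "conjg g H \<subseteq> Y"
      using conjg_subgroup[OF cc[OF g] h(1)] conjg_subset[OF sY h(3) g] by auto
    have "conjg g H \<subseteq> ?N"
      by (rule subgroup_of_small_index[OF sc _ sN nz(3) sY iN]) (use pH cc[OF g] Hc in simp)
    moreover have "pi_number (- a) (index ?N H)"
      using hall_subgroup[OF H sN nz(1,3)] by (simp add: hall_def)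
    ultimately have "conjg g H \<subseteq> H"
      using pi_subgroup_in_normal[OF nz(2) _ sc(1)] h(4) cc[OF g] Hc by simp
    then show ?thesis using card_subset_eq[OF finite_subgroup[OF h(1)]] cc[OF g] Hc by simp
  qed
  then have "normal_in H Y" using h by (simp add: normal_in_iff_conjg)
  then show False using no_normal[OF a(1) H] by blast
qed

lemma two_cores_contradiction:
  assumes a: "a \<in> CY" "hall_core a \<noteq> {\<one>}" and b: "b \<in> CY" "hall_core b \<noteq> {\<one>}" "a \<noteq> b" shows False
proof -
  obtain H where H: "hall a H Y" using hall_exY CYs a by blast
  obtain K where K: "hall b K Y" using hall_exY CYs b by blast
  obtain p where p: "prime p" "p \<in> a" "card H = p ^ 2" "card (hall_core a) = p"
    using hall_core_prime_hall_prime_square[OF a b H] by blast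
  obtain q where q: "prime q" "q \<in> b" "card K = q ^ 2" "card (hall_core b) = q"
    using hall_core_prime_hall_prime_square[OF b(1,2) a b(3)[symmetric] K] by blast
  have "p \<noteq> q" using p q classes_disjoint[OF CYs[OF a(1)] CYs[OF b(1)] b(3)] by blast
  then consider "q < p" | "p < q" by linarith
  then show False
  proof cases
    case 1
    show False by (rule prime_square_halls_contradiction[OF a b H K p(1,3) q(4,3) 1])
  next
    case 2
    show False by (rule prime_square_halls_contradiction[OF b(1,2) a b(3)[symmetric] K H q(1,3) p(4,3) 2])
  qed
qed

text \<open>
  The fixed points of \<open>X\<close> in \<open>V\<close> form a normal subgroup \<open>E\<close> of \<open>V X\<close>, and \<open>E X\<close> lies
  between \<open>X\<close> and \<open>V X\<close>.
\<close>

lemma maximal_in_centralizer_trivial: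
  assumes V: "normal_in V Y" and X: "subgroup X G" "X \<subseteq> Y"
    and ab: "\<And>x y. x \<in> V \<Longrightarrow> y \<in> V \<Longrightarrow> x \<otimes> y = y \<otimes> x"
    and i: "V \<inter> X = {\<one>}" and max: "maximal_in X (V <#> X)"
    and faithful: "centralizer_in X V \<noteq> X"
  shows "centralizer_in V X = {\<one>}"
proof -
  note n = normal_inD[OF V] and s = set_mult_subgroup[OF V X] and m = maximal_inD[OF max]
  have cV: "z \<in> carrier G" if "z \<in> V" for z using that n subgroup_carrier by blast
  have cX: "z \<in> carrier G" if "z \<in> X" for z using that X subgroup_carrier by blast
  let ?E = "centralizer_in V X"
  have sE: "subgroup ?E G" using centralizer_in_subgroup[OF n(1) subgroup.subset[OF X(1)]] .
  have "y \<otimes> v \<otimes> inv y = v" if y: "y \<in> V <#> X" and v: "v \<in> ?E" for y v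
  proof -
    obtain u x where u: "u \<in> V" "x \<in> X" "y = u \<otimes> x" using set_multE y by blast
    have c: "u \<in> carrier G" "x \<in> carrier G" "v \<in> carrier G"
      using u v cV cX by (auto simp: centralizer_in_def)
    have "y \<otimes> v \<otimes> inv y = u \<otimes> (x \<otimes> v) \<otimes> inv x \<otimes> inv u" using u c by (simp add: word)
    also have "\<dots> = u \<otimes> (v \<otimes> x) \<otimes> inv x \<otimes> inv u" using u v by (simp add: centralizer_in_def)
    also have "\<dots> = (u \<otimes> v) \<otimes> inv u" using c by (simp add: m_assoc)
    also have "\<dots> = (v \<otimes> u) \<otimes> inv u" using ab[of u v] u v by (simp add: centralizer_in_def)
    also have "\<dots> = v" using c by (simp add: m_assoc)
    finally show ?thesis .
  qed
  then have E: "normal_in ?E (V <#> X)"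
    unfolding normal_in_def using sE s by (auto simp: centralizer_in_def)
  note t = set_mult_subgroup[OF E X(1) m(3)]
  have EX: "?E \<inter> X = {\<one>}" using i subgroup.one_closed[OF sE] subgroup.one_closed[OF X(1)]
    by (auto simp: centralizer_in_def)
  consider "?E <#> X = X" | "?E <#> X = V <#> X" using m(5)[OF t(1,4,2)] by blast
  then show ?thesis
  proof cases
    case 1
    then show ?thesis using t(3) EX by blast
  next
    case 2
    have "card ?E * card X = card V * card X"
      using card_set_mult[OF sE X(1)] card_set_mult[OF n(1) X(1)] 2 i EX by simp
    then have "card ?E = card V" using card_subgroup_pos[OF X(1)] by simp
    then have "?E = V"
      using card_subset_eq[OF finite_subgroup[OF n(1)], of ?E] by (auto simp: centralizer_in_def)
    then have "\<forall>v\<in>V. \<forall>x\<in>X. x \<otimes> v = v \<otimes> x" unfolding centralizer_in_def by blast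
    then have "centralizer_in X V = X" unfolding centralizer_in_def by (auto dest: sym)
    then show ?thesis using faithful by simp
  qed
qed

text \<open>
  Write \<open>O\<close> for the nontrivial core. The Hall subgroups of the other classes have prime order,
  and each is maximal in its product with \<open>O\<close>. For a chief factor \<open>R/O\<close> we have \<open>R = O Q\<close>
  with such a Hall subgroup \<open>Q\<close>, whose normaliser \<open>N\<close> is a complement of \<open>O\<close> by the Frattini
  argument. The group \<open>O\<close> is an abelian \<open>p\<close>-group on which \<open>N\<close> acts faithfully, since the
  kernel of the action would contain a normal subgroup of \<open>Y\<close> of primary order. A Hall
  \<open>a\<close>-subgroup \<open>L\<close> of \<open>N\<close> has prime order and is maximal in \<open>O L\<close>, because otherwise
  \<open>L\<close> or a subgroup of it would end a long chain and lie in \<open>O\<close>. As \<open>O L\<close> is not normal,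
  \<open>L\<close> acts nontrivially on a normal subgroup of \<open>N\<close> of order prime to \<open>a\<close>, and so
  normalises without centralising some Sylow subgroup \<open>A\<close> of it, again of prime order. Now
  \<open>fixed_point_free_pair\<close> applies to \<open>A\<close> and \<open>L\<close> acting on \<open>O\<close>.
\<close>

lemma single_core_contradiction:
  assumes a: "a \<in> CY" "hall_core a \<noteq> {\<one>}"
    and others: "\<And>u. u \<in> CY \<Longrightarrow> u \<noteq> a \<Longrightarrow> hall_core u = {\<one>}"
  shows False
proof -
  note oa = hall_core_props[OF CYs[OF a(1)]]
  note o = normal_inD[OF oa(1)]
  have as: "a \<in> \<sigma>" using CYs a by blast
  have c: "z \<in> carrier G" if "z \<in> Y" for z using that sY subgroup_carrier by blast
  have hprime: "prime (card H)" if u: "u \<in> CY" "u \<noteq> a" "hall u H Y" for u H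
  proof (rule no_proper_subgroup_prime[OF hallD(1)[OF u(3)] hall_ne(2)[OF u(1,3)]])
    fix Z assume Z: "subgroup Z G" "Z \<subseteq> H" "Z \<noteq> H"
    have "Z \<subseteq> {\<one>}" using proper_subgroup_in_hall_core[OF a u Z] others u by simp
    then show "Z = {\<one>}" using subgroup.one_closed[OF Z(1)] by blast
  qed
  \<comment> \<open>the chief factor R / hall_core a\<close>
  have OY: "hall_core a \<noteq> Y"
  proof
    assume e: "hall_core a = Y"
    obtain H where H: "hall a H Y" using hall_exY as by blast
    then have "hall_core a = H" using oa(5)[OF H] hallD(3)[OF H] e by blast
    then show False using hall_core_ne_hall[OF a(1) H] by simp
  qed
  obtain R where R: "normal_in R Y" "hall_core a \<subset> R" "primary (index R (hall_core a))"
    using sigma_sol_step[OF solY oa(1) normal_in_refl[OF sY] o(3) OY] by blast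
  note r = normal_inD[OF R(1)]
  have OR: "hall_core a \<subseteq> R" using R by blast
  have iR: "index R (hall_core a) \<noteq> 1" using index_eq_1[OF o(1) r(1) OR] R(2) by blast
  have cR: "card R = index R (hall_core a) * card (hall_core a)"
    using index_card[OF o(1) r(1) OR] by simp
  obtain t where t: "t \<in> \<sigma>" "pi_number t (index R (hall_core a))"
    using R(3) by (auto simp: primary_def)
  have ta: "t \<noteq> a"
  proof
    assume "t = a"
    then have "pi_number a (card R)" using t(2) cR oa(2) by simp
    then show False using oa(3)[OF R(1)] R(2) by blast
  qed
  have tC: "t \<in> CY"
  proof -
    obtain p where p: "prime p" "p dvd index R (hall_core a)" using prime_factor_nat[OF iR] by blast
    then have "p dvd card Y" using cR card_dvd[OF r(1) sY r(3)] by (metis dvd_mult2 dvd_trans)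
    then show ?thesis using p t by (auto simp: classes_of_def pi_number_def)
  qed
  obtain Q where Q: "hall t Q Y" using hall_exY t by blast
  note q = hallD[OF Q]
  have qp: "prime (card Q)" using hprime[OF tC ta Q] .
  have QR: "Q \<subseteq> R"
  proof -
    have hR: "hall t (R \<inter> Q) R" using hall_normal_Int[OF R(1) Q] .
    have "R \<inter> Q \<noteq> {\<one>}"
    proof
      assume e: "R \<inter> Q = {\<one>}"
      then have "pi_number (- t) (card R)" using hallD(5)[OF hR] by simp
      then have "pi_number (- t) (index R (hall_core a))" using cR by simp
      then show False using pi_number_compl_eq_1[OF t(2)] iR by simp
    qed
    then have "R \<inter> Q = Q" using prime_no_proper_subgroup[OF q(1) qp hallD(1)[OF hR]] by blast
    then show ?thesis by blast
  qed
  have OR': "normal_in (hall_core a) R" using normal_in_mono[OF oa(1) r(1) OR r(3)] .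
  note oq = set_mult_subgroup[OF OR' q(1) QR]
  have ROQ: "hall_core a <#> Q = R"
  proof -
    have "index R (hall_core a <#> Q) dvd index R (hall_core a)"
      using index_mult[OF o(1) oq(1) r(1) oq(3,2)] by simp
    moreover have "index R (hall_core a <#> Q) dvd index Y Q"
      using index_mult[OF q(1) r(1) sY QR r(3)] index_mult[OF q(1) oq(1) r(1) oq(4,2)] by simp
    ultimately have "index R (hall_core a <#> Q) = 1"
      using pi_number_compl_eq_1 pi_number_dvd t(2) q(5) by metis
    then show ?thesis using index_eq_1[OF oq(1) r(1) oq(2)] by blast
  qed
  have hallQR: "hall {card Q} Q R"
  proof -
    have ct: "card Q \<in> t" using q(4) qp by (auto simp: pi_number_def)
    have "pi_number (- t) (index R Q)"
      using hall_subgroup[OF Q r(1) QR r(3)] by (simp add: hall_def)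
    then have "pi_number (- {card Q}) (index R Q)" using ct by (auto simp: pi_number_def)
    moreover have "pi_number {card Q} (card Q)" using pi_number_prime_power[OF qp, of 1] by simp
    ultimately show ?thesis using q(1) r(1) QR by (simp add: hall_def)
  qed
  \<comment> \<open>a complement N of hall_core a\<close>
  define N where "N = normalizer_in Y Q"
  have sN: "subgroup N G"
    unfolding N_def using normalizer_in_subgroup[OF sY] subgroup.subset[OF q(1)] by blast
  note nz = normalizer_in_props[OF sY q(1,3), folded N_def]
  have RN: "R <#> N = Y" unfolding N_def using frattini_sylow[OF qp R(1) hallQR] .
  note on = set_mult_subgroup[OF oa(1) sN nz(3)]
  have ON: "hall_core a <#> N = Y"
  proof
    have "R \<subseteq> hall_core a <#> N" using set_mult_least[OF on(1,3), of Q] nz(1) on(4) ROQ by blast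
    then show "Y \<subseteq> hall_core a <#> N" using set_mult_least[OF on(1) _ on(4), of R] RN by blast
  qed (rule on(2))
  have iON: "hall_core a \<inter> N = {\<one>}"
  proof -
    have E: "normal_in (hall_core a \<inter> N) N" using normal_in_Int_sub[OF oa(1) sN nz(3)] .
    note s = set_mult_subgroup[OF E q(1) nz(1)]
    have m: "maximal_in Q (hall_core a <#> Q)" using hall_maximal_in_core_hall[OF a tC ta Q] .
    have "(hall_core a \<inter> N) <#> Q \<subseteq> hall_core a <#> Q" by (rule mono_set_mult) auto
    then consider "(hall_core a \<inter> N) <#> Q = Q" | "(hall_core a \<inter> N) <#> Q = hall_core a <#> Q"
      using maximal_inD(5)[OF m s(1,4)] by blast
    then show ?thesis
    proof cases
      case 1
      then have "hall_core a \<inter> N \<subseteq> hall_core a \<inter> Q" using s(3) by blast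
      then show ?thesis
        using hall_core_Int_hall[OF a tC ta Q] subgroup.one_closed[OF normal_inD(1)[OF E]] by blast
    next
      case 2
      then have "R \<subseteq> N" using s(2) ROQ by blast
      then have "N = Y" using RN set_mult_least[OF sN _ subset_refl, of R] nz(3) by blast
      then show ?thesis using nz(2) no_normal[OF tC Q] by simp
    qed
  qed
  have cY: "card Y = card (hall_core a) * card N" using card_set_mult[OF o(1) sN] ON iON by simp
  \<comment> \<open>hall_core a is an abelian p-group\<close>
  have "card (hall_core a) \<noteq> 1" using card_1_iff[OF o(1)] a(2) by simp
  then obtain p where p: "prime p" "p dvd card (hall_core a)" using prime_factor_nat by blast
  have pO: "pi_number {p} (card (hall_core a))"
  proof -
    obtain P where P: "hall {p} P (hall_core a)" using sylow_ex[OF p(1) o(1)] by blast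
    note hp = hallD[OF P]
    have PR: "P \<subseteq> R" using hp(3) OR by blast
    let ?M = "normalizer_in R P"
    have sM: "subgroup ?M G" using normalizer_in_subgroup[OF r(1) subgroup.subset[OF hp(1)]] .
    note mz = normalizer_in_props[OF r(1) hp(1) PR]
    have OM: "hall_core a <#> ?M = R" using frattini_sylow[OF p(1) OR' P] .
    have "index R ?M dvd card (hall_core a)"
      using index_second_iso(2)[OF OR' sM mz(3)] OM index_dvd_card[of "hall_core a \<inter> ?M" "hall_core a"] o(1) sM by simp
    then have "pi_number a (index R ?M)" using oa(2) pi_number_dvd by blast
    moreover have ct: "card Q \<notin> a"
      using q(4) qp classes_disjoint[OF t(1) as ta] by (auto simp: pi_number_def)
    ultimately have "\<not> card Q dvd index R ?M" using qp by (auto simp: pi_number_def)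
    moreover have "card Q dvd index R ?M * card ?M"
      using card_dvd[OF q(1) r(1) QR] index_card[OF sM r(1) mz(3)] by simp
    ultimately have "card Q dvd card ?M" using qp prime_dvd_mult_iff by blast
    then obtain Q0 where Q0: "subgroup Q0 G" "Q0 \<subseteq> ?M" "card Q0 = card Q"
      using cauchy[OF qp sM] by blast
    have Q0Y: "Q0 \<subseteq> Y" using Q0 mz r by blast
    have hQ0: "hall t Q0 Y" using q Q0 Q0Y by (simp add: hall_def index_def)
    have m: "maximal_in Q0 (hall_core a <#> Q0)" using hall_maximal_in_core_hall[OF a tC ta hQ0] .
    note s = set_mult_subgroup[OF mz(2) Q0(1,2)]
    have iQ0: "hall_core a \<inter> Q0 = {\<one>}" using hall_core_Int_hall[OF a tC ta hQ0] .
    have iP: "P \<inter> Q0 = {\<one>}"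
      using iQ0 hp(3) subgroup.one_closed[OF hp(1)] subgroup.one_closed[OF Q0(1)] by blast
    have "P <#> Q0 \<subseteq> hall_core a <#> Q0" by (rule mono_set_mult) (use hp(3) in auto)
    then consider "P <#> Q0 = Q0" | "P <#> Q0 = hall_core a <#> Q0"
      using maximal_inD(5)[OF m s(1,4)] by blast
    then show ?thesis
    proof cases
      case 1
      then have "P = {\<one>}" using s(3) iP by blast
      then have "pi_number (- {p}) (card (hall_core a))" using hp(5) by simp
      then show ?thesis using p by (auto simp: pi_number_def)
    next
      case 2
      then have "card P * card Q0 = card (hall_core a) * card Q0"
        using card_set_mult[OF hp(1) Q0(1)] card_set_mult[OF o(1) Q0(1)] iP iQ0 by simp
      then have "card P = card (hall_core a)" using card_subgroup_pos[OF Q0(1)] by simp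
      then show ?thesis using hp(4) by simp
    qed
  qed
  have cO: "z \<in> carrier G" if "z \<in> hall_core a" for z using that o c by blast
  have abO: "x \<otimes> y = y \<otimes> x" if xy: "x \<in> hall_core a" "y \<in> hall_core a" for x y
  proof -
    have one: "normal_in {\<one>} Y" using normal_in_one[OF sY] .
    have chief: "D = {\<one>} \<or> D = hall_core a" if D: "normal_in D Y" "{\<one>} \<subseteq> D" "D \<subseteq> hall_core a" for D
    proof -
      note s = set_mult_subgroup[OF oa(1) q(1,3)]
      have "normal_in D (hall_core a <#> Q)"
        using normal_in_mono[OF D(1) s(1) _ s(2)] D(3) s(3) by blast
      then show ?thesis using minimal_hall_core[OF a tC ta Q _ D(3)] by blast
    qed
    have "x \<otimes> y \<otimes> inv x \<otimes> inv y \<in> {\<one>}"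
      by (rule chief_p_section_abelian[OF p(1) one oa(1) _ _ chief _ xy])
        (use a(2) pO subgroup.one_closed[OF o(1)] in auto)
    then have e: "x \<otimes> y \<otimes> inv x \<otimes> inv y = \<one>" by simp
    have cc: "x \<in> carrier G" "y \<in> carrier G" using xy cO by auto
    have "x \<otimes> y = (x \<otimes> y \<otimes> inv x \<otimes> inv y) \<otimes> (y \<otimes> x)" using cc by (simp add: m_assoc)
    then show ?thesis using e cc by simp
  qed
  \<comment> \<open>L, of prime order and maximal in hall_core a L\<close>
  obtain L where L: "hall a L N"
    using hall_ex[OF class_closed_class[OF as] sigma_sol_subgroup[OF solY sN nz(3)]] by blast
  note l = hallD[OF L]
  have LY: "L \<subseteq> Y" using l nz by blast
  have iOL: "hall_core a \<inter> L = {\<one>}"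
    using iON l(3) subgroup.one_closed[OF o(1)] subgroup.one_closed[OF l(1)] by blast
  note ol = set_mult_subgroup[OF oa(1) l(1) LY]
  have cOL: "card (hall_core a <#> L) = card (hall_core a) * card L"
    using card_set_mult[OF o(1) l(1)] iOL by simp
  have hOL: "hall a (hall_core a <#> L) Y"
  proof -
    have "index Y (hall_core a <#> L) * card (hall_core a <#> L) = card (hall_core a) * (index N L * card L)"
      using index_card[OF ol(1) sY ol(2)] cY index_card[OF l(1) sN l(3)] by metis
    then have "index Y (hall_core a <#> L) * card (hall_core a <#> L) = index N L * card (hall_core a <#> L)"
      using cOL by (metis mult.left_commute)
    then have "index Y (hall_core a <#> L) = index N L"
      using card_subgroup_pos[OF ol(1)] by (metis mult_right_cancel less_irrefl)
    then show ?thesis using ol(1,2) sY cOL oa(2) l(4,5) by (simp add: hall_def)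
  qed
  have L1: "L \<noteq> {\<one>}"
  proof
    assume "L = {\<one>}"
    then have "card (hall_core a <#> L) = card (hall_core a)" using cOL by simp
    then have "hall_core a = hall_core a <#> L"
      using card_subset_eq[OF finite_subgroup[OF ol(1)] ol(3)] by simp
    then show False using hall_core_ne_hall[OF a(1) hOL] by simp
  qed
  have LO: "\<not> L \<subseteq> hall_core a" using iOL L1 by blast
  have LneOL: "L \<noteq> hall_core a <#> L" using ol(3) iOL a(2) by blast
  obtain k where k: "max_chain k Y (hall_core a <#> L)" using max_chain_ex[OF ol(1,2) sY] by blast
  have kn: "n \<le> k + 1"
  proof -
    have "CY - {a} \<subseteq> classes_of (index Y (hall_core a <#> L))"
    proof
      fix s assume s: "s \<in> CY - {a}"
      obtain K where K: "hall s K Y" using hall_exY CYs s by blast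
      have sC: "s \<in> CY" "s \<noteq> a" using s by auto
      have "coprime (card K) (card (hall_core a <#> L))"
        by (rule coprime_classes[OF CYs[OF sC(1)] as sC(2) hallD(4)[OF K] hallD(4)[OF hOL]])
      then have "\<not> card K dvd card (hall_core a <#> L)"
        using hall_ne(1)[OF sC(1) K] coprime_absorb_left by auto
      then show "s \<in> classes_of (index Y (hall_core a <#> L))"
        by (rule class_in_index[OF ol(1,2) sC(1) K])
    qed
    then have "card (CY - {a}) \<le> k" using max_chain_lower[OF k solY] by blast
    then show ?thesis using a(1) finCY by (simp add: n_def)
  qed
  have maxL: "maximal_in L (hall_core a <#> L)"
  proof (rule ccontr)
    assume nm: "\<not> maximal_in L (hall_core a <#> L)"
    obtain j where j: "max_chain j (hall_core a <#> L) L"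
      using max_chain_ex[OF l(1) ol(4,1)] by blast
    have "2 \<le> j" using max_chain_ge_2[OF j nm LneOL] .
    then have "L \<subseteq> hall_core a"
      using deep_in_hall_core[OF a(1) hOL max_chain_append[OF j k] _ l(4)] kn by simp
    then show False using LO by blast
  qed
  have cL: "z \<in> carrier G" if "z \<in> L" for z using that LY c by blast
  have rL: "prime (card L)"
  proof (rule no_proper_subgroup_prime[OF l(1) L1])
    fix Z assume Z: "subgroup Z G" "Z \<subseteq> L" "Z \<noteq> L"
    obtain M where M: "maximal_in M L" "Z \<subseteq> M" using maximal_in_ex[OF Z l(1)] by blast
    have "pi_number a (card M)"
      using l(4) card_dvd[OF maximal_inD(1)[OF M(1)] l(1) maximal_inD(3)[OF M(1)]] pi_number_dvd
      by blast
    then have "M \<subseteq> hall_core a"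
      using deep_in_hall_core[OF a(1) hOL max_chain_Suc[OF max_chain_Suc[OF k maxL] M(1)]] kn
      by simp
    then have "Z \<subseteq> {\<one>}" using M(2) Z(2) iOL by blast
    then show "Z = {\<one>}" using subgroup.one_closed[OF Z(1)] by blast
  qed
  \<comment> \<open>N acts faithfully on hall_core a\<close>
  have faithful: "centralizer_in N (hall_core a) = {\<one>}"
  proof -
    define D where "D = centralizer_in N (hall_core a)"
    have sD: "subgroup D G"
      unfolding D_def using centralizer_in_subgroup[OF sN subgroup.subset[OF o(1)]] .
    have DN: "D \<subseteq> N" by (auto simp: D_def centralizer_in_def)
    have Dcent: "D = N \<inter> centralizer_in Y (hall_core a)"
      using nz(3) by (auto simp: D_def centralizer_in_def)
    have DY: "normal_in D Y"
    proof -
      have "y \<otimes> d \<otimes> inv y \<in> D" if y: "y \<in> Y" and d: "d \<in> D" for y d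
      proof -
        obtain u m where u: "u \<in> hall_core a" "m \<in> N" "y = u \<otimes> m"
          using set_multE[of y] y ON by metis
        have cc: "u \<in> carrier G" "m \<in> carrier G" "d \<in> carrier G" using u d DN cO nz c by blast+
        have "m \<otimes> d \<otimes> inv m \<in> N"
          using u d DN subgroup.m_closed[OF sN] subgroup.m_inv_closed[OF sN] by blast
        moreover have "m \<otimes> d \<otimes> inv m \<in> centralizer_in Y (hall_core a)"
          using normal_inD(4)[OF centralizer_in_normal[OF oa(1)]] u(2) d nz(3) Dcent by blast
        ultimately have e: "m \<otimes> d \<otimes> inv m \<in> D" "u \<otimes> (m \<otimes> d \<otimes> inv m) = (m \<otimes> d \<otimes> inv m) \<otimes> u"
          using Dcent u(1) by (auto simp: centralizer_in_def)
        have "y \<otimes> d \<otimes> inv y = u \<otimes> (m \<otimes> d \<otimes> inv m) \<otimes> inv u" using u cc by (simp add: word)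
        also have "\<dots> = m \<otimes> d \<otimes> inv m" unfolding e(2) using cc by (simp add: m_assoc)
        finally show ?thesis using e(1) by simp
      qed
      then show ?thesis using sD sY DN nz(3) unfolding normal_in_def by blast
    qed
    have "D = {\<one>}"
    proof (rule ccontr)
      assume ne: "D \<noteq> {\<one>}"
      have "{\<one>} \<subseteq> D" using subgroup.one_closed[OF sD] by blast
      then obtain E where E: "normal_in E Y" "{\<one>} \<subset> E" "E \<subseteq> D" "primary (index E {\<one>})"
        using sigma_sol_step[OF solY normal_in_one[OF sY] DY _ ne[symmetric]] by blast
      note e = normal_inD[OF E(1)]
      obtain s where s: "s \<in> \<sigma>" "pi_number s (card E)" using E(4) by (auto simp: primary_def)
      have "card E \<noteq> 1" using card_1_iff[OF e(1)] E(2) by auto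
      then obtain x where x: "prime x" "x dvd card E" using prime_factor_nat by blast
      have "x dvd card Y" using x card_dvd[OF e(1,2,3)] dvd_trans by blast
      then have sC: "s \<in> CY" using x s by (auto simp: classes_of_def pi_number_def)
      have "E \<subseteq> hall_core s" using hall_core_props(3)[OF s(1) E(1) s(2)] .
      then have "E \<subseteq> hall_core a" using others[OF sC] E(2) by (cases "s = a") auto
      then have "E \<subseteq> hall_core a \<inter> N" using E(3) DN by blast
      then show False using iON E(2) by blast
    qed
    then show ?thesis by (simp add: D_def)
  qed
  have centralizer_in_ne: "centralizer_in X (hall_core a) \<noteq> X" if "X \<subseteq> N" "X \<noteq> {\<one>}" "subgroup X G" for X
    using faithful that subgroup.one_closed[OF that(3)] by (auto simp: centralizer_in_def)
  \<comment> \<open>above the largest normal subgroup \<open>K\<close> of order prime to \<open>a\<close> comes a factor \<open>M/K\<close> of class \<open>a\<close>\<close>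
  let ?S = "{K. normal_in K N \<and> pi_number (- a) (card K)}"
  have fS: "finite ?S" by (rule finite_subset[of _ "Pow N"]) (use sN normal_inD(3) in auto)
  have "{\<one>} \<in> ?S" using normal_in_one[OF sN] by simp
  then obtain K where K: "K \<in> ?S" and Kmax0: "\<forall>b\<in>?S. K \<subseteq> b \<longrightarrow> K = b"
    by (rule bexE[OF finite_has_maximal2[OF fS]]) (elim conjE)
  have Kmax: "K = b" if b: "b \<in> ?S" "K \<subseteq> b" for b
    using bspec[OF Kmax0 b(1)] b(2) by (rule mp)
  have Kn: "normal_in K N" and Ka: "pi_number (- a) (card K)" using K by auto
  note kk = normal_inD[OF Kn]
  have rL': "card L \<in> a" using l(4) rL by (auto simp: pi_number_def)
  have KN: "K \<noteq> N"
  proof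
    assume "K = N"
    then have "card L dvd card K" using card_dvd[OF l(1) sN l(3)] by simp
    then show False using Ka rL rL' by (auto simp: pi_number_def)
  qed
  have solN: "sigma_sol N" using sigma_sol_subgroup[OF solY sN nz(3)] .
  obtain M where M: "normal_in M N" "K \<subset> M" "primary (index M K)"
    using sigma_sol_step[OF solN Kn normal_in_refl[OF sN] kk(3) KN] by blast
  note m = normal_inD[OF M(1)]
  have KM: "K \<subseteq> M" using M by blast
  have MY: "M \<subseteq> Y" using m nz by blast
  have cM: "card M = index M K * card K" using index_card[OF kk(1) m(1) KM] by simp
  have iMK: "pi_number a (index M K)"
  proof (rule ccontr)
    assume "\<not> pi_number a (index M K)"
    then have "pi_number (- a) (index M K)"
      using class_closed_primary[OF class_closed_class[OF as] M(3)] by blast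
    then have "M \<in> ?S" using M(1) Ka cM by simp
    then show False using Kmax M(2) by blast
  qed
  have hLM: "hall a (M \<inter> L) M" using hall_normal_Int[OF M(1) L] .
  have LM: "L \<subseteq> M"
  proof -
    have "M \<inter> L \<noteq> {\<one>}"
    proof
      assume "M \<inter> L = {\<one>}"
      then have "pi_number (- a) (card M)" using hallD(5)[OF hLM] by simp
      then have "M \<in> ?S" using M(1) by simp
      then show False using Kmax M(2) by blast
    qed
    then have "M \<inter> L = L" using prime_no_proper_subgroup[OF l(1) rL hallD(1)[OF hLM]] by blast
    then show ?thesis by blast
  qed
  then have hLM': "hall a L M" using hLM by (simp add: Int_absorb1)
  have KnM: "normal_in K M" using normal_in_mono[OF Kn m(1) KM m(3)] .
  note kl = set_mult_subgroup[OF KnM l(1) LM]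
  have KL: "K <#> L = M"
  proof -
    have "index M (K <#> L) dvd index M K" using index_mult[OF kk(1) kl(1) m(1) kl(3,2)] by simp
    moreover have "index M (K <#> L) dvd index M L"
      using index_mult[OF l(1) kl(1) m(1) kl(4,2)] by simp
    ultimately have "index M (K <#> L) = 1"
      using pi_number_compl_eq_1 pi_number_dvd iMK hallD(5)[OF hLM'] by metis
    then show ?thesis using index_eq_1[OF kl(1) m(1) kl(2)] by blast
  qed
  have KY: "K \<subseteq> Y" using kk nz by blast
  have noncentral: "centralizer_in K L \<noteq> K"
  proof
    assume cen: "centralizer_in K L = K"
    have Lc: "L \<subseteq> carrier G" using cL by blast
    have "K \<subseteq> normalizer_in M L"
    proof
      fix y assume y: "y \<in> K"
      have yc: "y \<in> carrier G" using y KY c by blast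
      have e: "y \<otimes> x \<otimes> inv y = x" if x: "x \<in> L" for x
      proof -
        have "y \<in> centralizer_in K L" using y cen by simp
        then have "x \<otimes> y = y \<otimes> x" using x by (simp add: centralizer_in_def)
        then have "y \<otimes> x \<otimes> inv y = x \<otimes> y \<otimes> inv y" by simp
        then show ?thesis using yc cL[OF x] by (simp add: m_assoc)
      qed
      then have "conjg y L = L" unfolding conjg_def by force
      then show "y \<in> normalizer_in M L" using y KM by (auto simp: normalizer_in_def)
    qed
    then have "normalizer_in M L = M"
      using set_mult_least[OF normalizer_in_subgroup[OF m(1) Lc] _ normalizer_in_props(1)[OF m(1) l(1) LM]] KL
        normalizer_in_props(3)[OF m(1) l(1) LM] by blast
    then have LnM: "normal_in L M" using normal_in_of_normalizer[OF m(1) l(1) LM] by blast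
    have "conjg g L \<subseteq> L" if g: "g \<in> N" for g
    proof -
      have gc: "g \<in> carrier G" using g nz c by blast
      have "conjg g L \<subseteq> M" using conjg_mono[OF LM, of g] conjg_normal[OF M(1) g] by simp
      then show ?thesis
        using pi_subgroup_in_normal[OF LnM hallD(5)[OF hLM'] conjg_subgroup[OF gc l(1)]] l(4) gc Lc
        by simp
    qed
    then have "normal_in L N" using l by (simp add: normal_in_iff_conjg)
    then show False using normal_product[OF oa(1) ON sN] no_normal[OF a(1) hOL] by blast
  qed
  \<comment> \<open>\<open>M = K B\<close> for the normaliser \<open>B\<close> of a Sylow subgroup, so \<open>|M : B|\<close> is prime to \<open>|L|\<close>\<close>
  have invariant: "\<exists>A. hall {q} A K \<and> (\<forall>x\<in>L. conjg x A = A)" if q: "prime q" for q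
  proof -
    obtain A0 where A0: "hall {q} A0 K" using sylow_ex[OF q kk(1)] by blast
    note h0 = hallD[OF A0]
    have A0M: "A0 \<subseteq> M" using h0 KM by blast
    have A0c: "A0 \<subseteq> carrier G" using subgroup.subset[OF h0(1)] .
    let ?B = "normalizer_in M A0"
    have sB: "subgroup ?B G" using normalizer_in_subgroup[OF m(1) A0c] .
    note bz = normalizer_in_props[OF m(1) h0(1) A0M]
    have KB: "K <#> ?B = M" using frattini_sylow[OF q KnM A0] .
    have "index M ?B dvd card K"
      using index_second_iso(2)[OF KnM sB bz(3)] KB index_dvd_card[of "K \<inter> ?B" K] kk(1) sB by simp
    then have nd: "\<not> card L dvd index M ?B" using Ka rL rL' dvd_trans by (auto simp: pi_number_def)
    have "pi_number {card L} (card L)" using pi_number_prime_power[OF rL, of 1] by simp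
    then obtain y where y: "y \<in> M" "L \<subseteq> conjg y ?B"
      using p_subgroup_in_conj[OF rL l(1) LM _ sB bz(3) m(1) nd] by blast
    have yc: "y \<in> carrier G" using y MY c by blast
    have "conjg x (conjg y A0) = conjg y A0" if x: "x \<in> L" for x
    proof -
      obtain b where b: "b \<in> ?B" "x = y \<otimes> b \<otimes> inv y" using x y(2) by (auto simp: conjg_def)
      have bc: "b \<in> carrier G" "conjg b A0 = A0" using b MY c by (auto simp: normalizer_in_def)
      have "conjg x (conjg y A0) = conjg (y \<otimes> b \<otimes> inv y \<otimes> y) A0"
        unfolding b(2) using yc bc A0c by (simp add: conjg_mult)
      also have "\<dots> = conjg (y \<otimes> b) A0" using yc bc by (simp add: m_assoc)
      also have "\<dots> = conjg y A0" using conjg_mult[OF yc bc(1) A0c] bc by simp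
      finally show ?thesis .
    qed
    then show ?thesis using hall_conjg_normal[OF KnM A0 y(1)] by blast
  qed
  obtain r A where r: "prime r" and A: "hall {r} A K" "\<And>x. x \<in> L \<Longrightarrow> conjg x A = A"
    and nc: "centralizer_in A L \<noteq> A"
  proof (rule ccontr)
    assume nt: "\<not> thesis"
    have all: "centralizer_in A L = A" if "prime q" "hall {q} A K" "\<forall>x\<in>L. conjg x A = A" for q A
    proof (rule ccontr)
      assume "centralizer_in A L \<noteq> A"
      then have thesis using \<open>\<And>r A. \<lbrakk>prime r; hall {r} A K; \<And>x. x \<in> L \<Longrightarrow> conjg x A = A;
        centralizer_in A L \<noteq> A\<rbrakk> \<Longrightarrow> thesis\<close> that by blast
      then show False using nt by blast
    qed
    have sC: "subgroup (centralizer_in K L) G" using centralizer_in_subgroup[OF kk(1)] cL by blast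
    have CK: "centralizer_in K L \<subseteq> K" by (auto simp: centralizer_in_def)
    have "index K (centralizer_in K L) = 1"
    proof (rule ccontr)
      assume "index K (centralizer_in K L) \<noteq> 1"
      then obtain q where q: "prime q" "q dvd index K (centralizer_in K L)"
        using prime_factor_nat by blast
      obtain A where A: "hall {q} A K" "\<forall>x\<in>L. conjg x A = A" using invariant[OF q(1)] by blast
      have "A \<subseteq> centralizer_in K L"
        using all[OF q(1) A] hallD(3)[OF A(1)] unfolding centralizer_in_def by blast
      then have "index K (centralizer_in K L) dvd index K A"
        using index_mult[OF hallD(1)[OF A(1)] sC kk(1) _ CK] by simp
      then have "q dvd index K A" using q dvd_trans by blast
      then show False using hallD(5)[OF A(1)] q by (auto simp: pi_number_def)
    qed
    then show False using index_eq_1[OF sC kk(1) CK] noncentral by blast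
  qed
  note ha = hallD[OF A(1)]
  have AN: "A \<subseteq> N" and AY: "A \<subseteq> Y" using ha kk nz by blast+
  have cA: "z \<in> carrier G" if "z \<in> A" for z using that AY c by blast
  have A1: "A \<noteq> {\<one>}" using nc cL by (auto simp: centralizer_in_def)
  obtain u where u: "u \<in> \<sigma>" "r \<in> u" using class_of_prime[OF r] by blast
  have "card A \<noteq> 1" using card_1_iff[OF ha(1)] A1 by simp
  then obtain r' where "prime r'" "r' dvd card A" using prime_factor_nat by blast
  then have rA: "r dvd card A" using ha(4) by (auto simp: pi_number_def)
  have rK: "r dvd card K" using rA card_dvd[OF ha(1,2,3)] dvd_trans by blast
  have ua: "u \<noteq> a" using u Ka rK r by (auto simp: pi_number_def)
  have uC: "u \<in> CY"
    using u r rK card_dvd[OF kk(1) sY KY] dvd_trans unfolding classes_of_def by blast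
  have uA: "pi_number u (card A)" using ha(4) u pi_number_mono by blast
  obtain H where H: "hall u H Y" using hall_exY u by blast
  have "card A dvd card H" using hall_card_dvd[OF H ha(1) AY uA] .
  then have "card A = card H" using hprime[OF uC ua H] \<open>card A \<noteq> 1\<close> unfolding prime_nat_iff by blast
  then have hA: "hall u A Y" using hallD[OF H] ha(1) AY by (simp add: hall_def index_def)
  have maxA: "maximal_in A (hall_core a <#> A)" using hall_maximal_in_core_hall[OF a uC ua hA] .
  have pA: "prime (card A)" using hprime[OF uC ua hA] .
  have iOA: "hall_core a \<inter> A = {\<one>}" using hall_core_Int_hall[OF a uC ua hA] .
  have "hall_core a = {\<one>}"
  proof (rule fixed_point_free_pair[OF oa(1) abO ha(1) AY l(1) LY A(2)])
    show "coprime (card A) (card (hall_core a))"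
      using coprime_classes[OF u(1) as ua uA oa(2)] .
  next
    show "centralizer_in (hall_core a) A = {\<one>}"
      by (rule maximal_in_centralizer_trivial[OF oa(1) ha(1) AY abO iOA maxA centralizer_in_ne[OF AN A1 ha(1)]])
    show "centralizer_in (hall_core a) L = {\<one>}"
      by (rule maximal_in_centralizer_trivial[OF oa(1) l(1) LY abO iOL maxL centralizer_in_ne[OF l(3) L1 l(1)]])
  next
    fix x assume x: "x \<in> L" "x \<noteq> \<one>"
    show "centralizer_in A {x} = {\<one>}"
    proof (rule ccontr)
      assume ne: "centralizer_in A {x} \<noteq> {\<one>}"
      have "centralizer_in A {x} = A"
        using prime_no_proper_subgroup[OF ha(1) pA centralizer_in_subgroup[OF ha(1)] _ ne] cL[OF x(1)]
        by (auto simp: centralizer_in_def)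
      then have "\<forall>y\<in>A. x \<otimes> y = y \<otimes> x" unfolding centralizer_in_def by blast
      then have xL: "x \<in> centralizer_in L A" using x(1) by (simp add: centralizer_in_def)
      have "centralizer_in L A = L"
        using prime_no_proper_subgroup[OF l(1) rL centralizer_in_subgroup[OF l(1)], of A] cA xL x(2)
        by (auto simp: centralizer_in_def)
      then have "\<forall>y\<in>L. \<forall>z\<in>A. z \<otimes> y = y \<otimes> z" unfolding centralizer_in_def by blast
      then have "centralizer_in A L = A" unfolding centralizer_in_def by (auto dest: sym)
      then show False using nc by blast
    qed
  qed
  then show False using a(2) by blast
qed

text \<open>
  A minimal normal subgroup is primary, so some core is nontrivial.
\<close>

theorem contradiction: assumes "CY \<noteq> {}" shows False
proof -
  have "card Y \<noteq> 1" using assms by (auto simp: classes_of_def)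
  then have "{\<one>} \<noteq> Y" by auto
  moreover have "{\<one>} \<subseteq> Y" using subgroup.one_closed[OF sY] by blast
  ultimately obtain M where M: "normal_in M Y" "{\<one>} \<subset> M" "primary (index M {\<one>})"
    using sigma_sol_step[OF solY normal_in_one[OF sY] normal_in_refl[OF sY]] by blast
  note m = normal_inD[OF M(1)]
  obtain a where a: "a \<in> \<sigma>" "pi_number a (card M)" using M(3) by (auto simp: primary_def)
  have "card M \<noteq> 1" using card_1_iff[OF m(1)] M(2) by auto
  then obtain p where p: "prime p" "p dvd card M" using prime_factor_nat by blast
  have "p dvd card Y" using p card_dvd[OF m(1,2,3)] dvd_trans by blast
  then have aC: "a \<in> CY" using p a by (auto simp: classes_of_def pi_number_def)
  have "M \<subseteq> hall_core a" using hall_core_props(3)[OF a(1) M(1) a(2)] .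
  then have a1: "hall_core a \<noteq> {\<one>}" using M(2) by blast
  show False
  proof (cases "\<exists>b\<in>CY. b \<noteq> a \<and> hall_core b \<noteq> {\<one>}")
    case True
    then show False using two_cores_contradiction[OF aC a1] by blast
  next
    case False
    then show False using single_core_contradiction[OF aC a1] by blast
  qed
qed

end

section \<open>Towers of Hall subgroups\<close>

context sigma_fin_group begin

text \<open>
  The function \<open>\<tau>\<close> records the class of the \<open>i\<close>-th factor; its injectivity makes the Hall
  subgroup of a class unique in the tower.
\<close>

definition tower :: "'a set \<Rightarrow> nat \<Rightarrow> (nat \<Rightarrow> 'a set) \<Rightarrow> (nat \<Rightarrow> 'a set) \<Rightarrow> (nat \<Rightarrow> nat set) \<Rightarrow> bool" where
  "tower Y t N H \<tau> \<longleftrightarrow> N 1 = {\<one>} \<and> N (t + 1) = Y \<and> (\<forall>i\<in>{1..t + 1}. normal_in (N i) Y) \<and>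
     (\<forall>i\<in>{1..t}. N i \<subset> N (i + 1) \<and> N i <#> H i = N (i + 1) \<and> hall (\<tau> i) (H i) Y) \<and>
     \<tau> ` {1..t} = classes_of (card Y) \<and> inj_on \<tau> {1..t}"

text \<open>
  By \<open>no_normal_hall.contradiction\<close> there is a normal Hall subgroup \<open>A\<close> for some class \<open>a\<close>
  dividing the order. A complement \<open>K\<close> involves one class less and lies at least one step below
  \<open>Y\<close>, so it inherits \<open>deep_in_hall\<close> with \<open>n - 1\<close>; multiplying a tower of \<open>K\<close> by \<open>A\<close>
  gives the terms above \<open>A\<close>.
\<close>

lemma tower_ex:
  assumes "sigma_sol Y" "deep_in_hall n Y" "n = card (classes_of (card Y))"
  shows "\<exists>t N H \<tau>. tower Y t N H \<tau>"
  using assms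
proof (induction "card Y" arbitrary: Y n rule: less_induct)
  case less
  have sY: "subgroup Y G" using less.prems by (simp add: sigma_sol_def)
  show ?case
  proof (cases "classes_of (card Y) = {}")
    case True
    have "card Y = 1"
    proof (rule ccontr)
      assume "card Y \<noteq> 1"
      then obtain p where p: "prime p" "p dvd card Y" using prime_factor_nat by blast
      obtain s where "s \<in> \<sigma>" "p \<in> s" using class_of_prime[OF p(1)] by blast
      then have "s \<in> classes_of (card Y)" using p by (auto simp: classes_of_def)
      then show False using True by simp
    qed
    then have "Y = {\<one>}" using card_1_iff[OF sY] by simp
    then have "tower Y 0 (\<lambda>_. Y) (\<lambda>_. Y) (\<lambda>_. {})"
      using True normal_in_refl[OF sY] by (simp add: tower_def)
    then show ?thesis by blast
  next
    case False
    have "\<exists>a A. a \<in> classes_of (card Y) \<and> hall a A Y \<and> normal_in A Y"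
    proof (rule ccontr)
      assume nt: "\<nexists>a A. a \<in> classes_of (card Y) \<and> hall a A Y \<and> normal_in A Y"
      have "no_normal_hall G \<sigma> Y n"
      proof
        show "\<not> normal_in H Y" if "s \<in> classes_of (card Y)" "hall s H Y" for s H
          using nt that by blast
      qed (use less.prems in auto)
      then show False using no_normal_hall.contradiction False by blast
    qed
    then obtain a A where a: "a \<in> classes_of (card Y)" "hall a A Y" "normal_in A Y" by blast
    have as: "a \<in> \<sigma>" using a by (simp add: classes_of_def)
    note hA = hallD[OF a(2)]
    obtain K where K: "hall (- a) K Y"
      using hall_ex[OF class_closed_compl[OF class_closed_class[OF as]] less.prems(1)] by blast
    note k = hallD[OF K]
    have piK: "pi_number a (index Y K)" using k(5) by simp
    have iAK: "A \<inter> K = {\<one>}" using coprime_Int[OF hA(1) k(1)] pi_number_coprime hA(4) k(4) by blast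
    note ak = set_mult_subgroup[OF a(3) k(1,3)]
    have AK: "A <#> K = Y"
    proof -
      have "index Y (A <#> K) dvd index Y A" using index_mult[OF hA(1) ak(1) sY ak(3,2)] by simp
      moreover have "index Y (A <#> K) dvd index Y K"
        using index_mult[OF k(1) ak(1) sY ak(4,2)] by simp
      ultimately have "index Y (A <#> K) = 1"
        using pi_number_compl_eq_1 pi_number_dvd piK hA(5) by metis
      then show ?thesis using index_eq_1[OF ak(1) sY ak(2)] by blast
    qed
    have cY: "card Y = card A * card K" using card_set_mult[OF hA(1) k(1)] AK iAK by simp
    have aK: "a \<notin> classes_of (card K)" using classes_of_iff[OF as] k(4) by blast
    have "classes_of (card A) \<subseteq> {a}" using classes_of_pi_num[OF hA(4) as] .
    then have clK: "classes_of (card K) = classes_of (card Y) - {a}"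
      using aK cY by (auto simp: classes_of_mult)
    have A1: "card A \<noteq> 1" using a(1) aK cY by auto
    have ltK: "card K < card Y"
      using cY A1 card_subgroup_pos[OF hA(1)] card_subgroup_pos[OF k(1)] by simp
    have hY: "hall s H Y" if "hall s H K" "s \<in> \<sigma>" "s \<noteq> a" for s H
    proof (rule hall_trans[OF that(1) sY k(3)])
      show "pi_number (- s) (index Y K)"
        using piK pi_number_mono classes_disjoint[OF as that(2)] that(3) by blast
    qed
    have "finite (classes_of (card Y))"
    proof -
      obtain l where "max_chain l Y {\<one>}"
        using max_chain_ex[OF triv_subgroup _ sY] subgroup.one_closed[OF sY] by blast
      then show ?thesis using max_chain_classes[OF _ less.prems(1)] by fastforce
    qed
    then have n: "n = Suc (card (classes_of (card K)))"
      using less.prems(3) clK a(1) card_Suc_Diff1 by metis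
    have dK: "deep_in_hall (card (classes_of (card K))) K"
      unfolding deep_in_hall_def
    proof (intro allI impI)
      fix m X s H
      assume m: "card (classes_of (card K)) < m" "max_chain m K X" and s: "s \<in> \<sigma>" "pi_number s (card X)" and H: "hall s H K"
      have X: "subgroup X G" "X \<subseteq> K" using max_chain_sub[OF m(2)] by auto
      show "X \<subseteq> H"
      proof (cases "s = a")
        case True
        have "pi_number (- a) (card X)"
          using k(4) card_dvd[OF X(1) k(1) X(2)] pi_number_dvd by blast
        then have "card X = 1" using s True pi_number_compl_eq_1 by blast
        then have "X = {\<one>}" using card_1_iff[OF X(1)] by simp
        then show ?thesis using subgroup.one_closed[OF hallD(1)[OF H]] by simp
      next
        case False
        obtain j where j: "max_chain j Y K" using max_chain_ex[OF k(1,3) sY] by blast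
        have "1 \<le> j" using max_chain_pos[OF j] ltK by blast
        then have "n < j + m" using m n by simp
        then show ?thesis
          using deep_in_hallD[OF less.prems(2) max_chain_append[OF m(2) j] _ s hY[OF H s(1) False]]
          by blast
      qed
    qed
    obtain t N H \<tau> where T: "tower K t N H \<tau>"
      using less.hyps[OF ltK sigma_sol_subgroup[OF less.prems(1) k(1,3)] dK] by blast
    define N' where "N' i = (if i = 1 then {\<one>} else A <#> N (i - 1))" for i
    define H' where "H' i = (if i = 1 then A else H (i - 1))" for i
    define \<tau>' where "\<tau>' i = (if i = 1 then a else \<tau> (i - 1))" for i
    have Nn: "normal_in (N i) K" if "i \<in> {1..t + 1}" for i using T that by (simp add: tower_def)
    have Nstep: "N i \<subset> N (i + 1)" "N i <#> H i = N (i + 1)" "hall (\<tau> i) (H i) K" if "i \<in> {1..t}" for i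
      using T that by (auto simp: tower_def)
    have N1: "N 1 = {\<one>}" "N (t + 1) = K" using T by (auto simp: tower_def)
    have ctau: "\<tau> ` {1..t} = classes_of (card K)" "inj_on \<tau> {1..t}"
      using T by (auto simp: tower_def)
    have Ac: "A \<subseteq> carrier G" using subgroup.subset[OF hA(1)] .
    have A_one: "A <#> {\<one>} = A" "{\<one>} <#> A = A"
      using Ac by (force simp: set_mult_def)+
    have e: "{1..t + 1} = insert 1 (Suc ` {1..t})" by (auto simp: image_Suc_atLeastAtMost)
    have "tower Y (t + 1) N' H' \<tau>'"
      unfolding tower_def
    proof (intro conjI ballI)
      show "N' 1 = {\<one>}" by (simp add: N'_def)
      show "N' (t + 1 + 1) = Y" using N1(2) AK by (simp add: N'_def)
    next
      fix i assume i: "i \<in> {1..t + 1 + 1}"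
      show "normal_in (N' i) Y"
      proof (cases "i = 1")
        case True
        then show ?thesis using normal_in_one[OF sY] by (simp add: N'_def)
      next
        case False
        then have "normal_in (N (i - 1)) K" using i by (intro Nn) auto
        then show ?thesis using normal_product[OF a(3) AK k(1)] False by (simp add: N'_def)
      qed
    next
      fix i assume i: "i \<in> {1..t + 1}"
      have "N' i \<subset> N' (i + 1) \<and> N' i <#> H' i = N' (i + 1) \<and> hall (\<tau>' i) (H' i) Y"
      proof (cases "i = 1")
        case True
        have "{\<one>} \<subset> A" using subgroup.one_closed[OF hA(1)] A1 by auto
        then show ?thesis using True N1(1) A_one a(2) by (simp add: N'_def H'_def \<tau>'_def)
      next
        case False
        then obtain j where j: "i = Suc j" "j \<in> {1..t}" using i by (cases i) auto
        note st = Nstep[OF j(2)]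
        have nj: "normal_in (N j) K" "normal_in (N (j + 1)) K" using Nn j(2) by auto
        note n1 = normal_inD[OF nj(1)] and n2 = normal_inD[OF nj(2)]
        have i1: "A \<inter> N j = {\<one>}" "A \<inter> N (j + 1) = {\<one>}"
          using iAK n1(3) n2(3) subgroup.one_closed[OF hA(1)] subgroup.one_closed[OF n1(1)]
            subgroup.one_closed[OF n2(1)] by blast+
        have "card (N j) < card (N (j + 1))" using st(1) n2(1) by (simp add: psubset_card_mono)
        then have "card (A <#> N j) \<noteq> card (A <#> N (j + 1))"
          using card_set_mult[OF hA(1) n1(1)] card_set_mult[OF hA(1) n2(1)] i1 card_subgroup_pos[OF hA(1)] by simp
        moreover have "A <#> N j \<subseteq> A <#> N (j + 1)" using st(1) by (intro mono_set_mult) auto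
        ultimately have 1: "A <#> N j \<subset> A <#> N (j + 1)" by auto
        have 2: "(A <#> N j) <#> H j = A <#> N (j + 1)"
          using set_mult_assoc[OF Ac subgroup.subset[OF n1(1)] subgroup.subset[OF hallD(1)[OF st(3)]]] st(2) by simp
        have "\<tau> j \<in> classes_of (card K)" using ctau(1) j(2) by blast
        then have "\<tau> j \<in> \<sigma>" "\<tau> j \<noteq> a" using aK by (auto simp: classes_of_def)
        then have 3: "hall (\<tau> j) (H j) Y" using hY[OF st(3)] by blast
        have "j \<noteq> 0" using j(2) by simp
        then show ?thesis using 1 2 3 j(1) by (simp add: N'_def H'_def \<tau>'_def)
      qed
      then show "N' i \<subset> N' (i + 1)" "N' i <#> H' i = N' (i + 1)" "hall (\<tau>' i) (H' i) Y" by auto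
    next
      have im: "\<tau>' ` Suc ` {1..t} = \<tau> ` {1..t}"
        unfolding image_image by (rule image_cong) (auto simp: \<tau>'_def)
      have "\<tau>' ` {1..t + 1} = insert a (\<tau> ` {1..t})"
        unfolding e image_insert im by (simp add: \<tau>'_def)
      then show "\<tau>' ` {1..t + 1} = classes_of (card Y)" using ctau(1) clK a(1) by auto
      show "inj_on \<tau>' {1..t + 1}"
      proof (rule inj_onI)
        fix i j assume ij: "i \<in> {1..t + 1}" "j \<in> {1..t + 1}" "\<tau>' i = \<tau>' j"
        have na: "\<tau>' i \<noteq> a" if "i \<in> {1..t + 1}" "i \<noteq> 1" for i
        proof -
          have "i - 1 \<in> {1..t}" using that by auto
          then have "\<tau> (i - 1) \<in> classes_of (card K)" using ctau(1) by blast
          then show ?thesis using aK that by (auto simp: \<tau>'_def)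
        qed
        have ta: "\<tau>' 1 = a" by (simp add: \<tau>'_def)
        show "i = j"
        proof (cases "i = 1 \<or> j = 1")
          case True
          then show ?thesis using na[OF ij(1)] na[OF ij(2)] ij(3) ta by metis
        next
          case False
          then have "\<tau> (i - 1) = \<tau> (j - 1)" "i - 1 \<in> {1..t}" "j - 1 \<in> {1..t}"
            using ij by (auto simp: \<tau>'_def)
          then have "i - 1 = j - 1" using inj_onD[OF ctau(2)] by blast
          then show ?thesis using False ij by auto
        qed
      qed
    qed
    then show ?thesis by blast
  qed
qed

lemma sigma_classes_eq: "sigma_classes \<sigma> G = classes_of (card (carrier G))"
  by (auto simp: sigma_classes_def classes_of_def prime_divs_def order_def)

lemma hall_hall_subgroup: "hall s H (carrier G) \<longleftrightarrow> hall_subgroup s H G"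
proof (cases "subgroup H G")
  case True
  have "card (rcosets H) * card H = card (carrier G)"
    using lagrange[OF True] by (simp add: order_def)
  also have "\<dots> = index (carrier G) H * card H"
    using index_card[OF True subgroup_self subgroup.subset[OF True]] by simp
  finally have "card (rcosets H) = index (carrier G) H"
    using card_subgroup_pos[OF True] by (metis mult_right_cancel less_irrefl)
  then show ?thesis using True subgroup_self subgroup.subset[OF True]
    by (auto simp: hall_def hall_subgroup_def pi_number_def)
qed (simp add: hall_def hall_subgroup_def)

lemma tower_sigma_dispersive:
  assumes T: "tower (carrier G) t N H \<tau>" shows "sigma_dispersive \<sigma> G"
proof -
  have hl: "hall (\<tau> i) (H i) (carrier G)" "\<tau> i \<in> classes_of (card (carrier G))" if "i \<in> {1..t}" for i
    using T that unfolding tower_def by blast+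
  have classes_of_eq: "s = \<tau> i" if i: "i \<in> {1..t}" and s: "s \<in> \<sigma>" "hall s (H i) (carrier G)" for i s
  proof (rule ccontr)
    assume ne: "s \<noteq> \<tau> i"
    have ti: "\<tau> i \<in> \<sigma>" using hl(2)[OF i] by (simp add: classes_of_def)
    have "coprime (card (H i)) (card (H i))"
      using pi_number_disjoint_coprime[OF hallD(4)[OF s(2)] hallD(4)[OF hl(1)[OF i]]]
        classes_disjoint[OF s(1) ti ne] by blast
    then have "card (H i) = 1" by simp
    then have "index (carrier G) (H i) = card (carrier G)" by (simp add: index_def)
    then show False using hallD(5)[OF hl(1)[OF i]] hl(2)[OF i] classes_of_iff[OF ti] by simp
  qed
  have c: "complete_hall_set \<sigma> (H ` {1..t}) G"
    unfolding complete_hall_set_def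
  proof (intro conjI ballI impI)
    fix X assume "X \<in> H ` {1..t}"
    then obtain i where i: "i \<in> {1..t}" "X = H i" by blast
    then show "subgroup X G" using hallD(1)[OF hl(1)] by blast
    show "\<exists>s\<in>sigma_classes \<sigma> G. hall_subgroup s X G"
      using hl[OF i(1)] i(2) hall_hall_subgroup sigma_classes_eq by blast
  next
    fix s assume s: "s \<in> sigma_classes \<sigma> G"
    have "\<tau> ` {1..t} = sigma_classes \<sigma> G" using T by (simp add: tower_def sigma_classes_eq)
    then obtain i where i: "i \<in> {1..t}" "s = \<tau> i" using s by (metis imageE)
    have s\<sigma>: "s \<in> \<sigma>" using s by (simp add: sigma_classes_def)
    show "\<exists>!X. X \<in> H ` {1..t} \<and> hall_subgroup s X G"
    proof (rule ex1I[of _ "H i"])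
      show "H i \<in> H ` {1..t} \<and> hall_subgroup s (H i) G"
        using i hl(1)[OF i(1)] hall_hall_subgroup by blast
      fix X assume X: "X \<in> H ` {1..t} \<and> hall_subgroup s X G"
      then obtain j where j: "j \<in> {1..t}" "X = H j" by blast
      then have "s = \<tau> j" using classes_of_eq[OF j(1) s\<sigma>] X hall_hall_subgroup by blast
      then have "i = j" using T i j(1) unfolding tower_def inj_on_def by blast
      then show "X = H i" using j by simp
    qed
  qed
  have "\<forall>i\<in>{1..t + 1}. N i \<lhd> G" using T by (simp add: tower_def normal_in_carrier_iff)
  moreover have "N 1 = {\<one>}" "N (t + 1) = carrier G" "\<forall>i\<in>{1..t}. N i \<subset> N (i + 1)"
    "\<forall>i\<in>{1..t}. N i <#> H i = N (i + 1)"
    using T by (auto simp: tower_def)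
  ultimately have "\<exists>(t::nat) N H. N 1 = {\<one>} \<and> N (t + 1) = carrier G \<and> (\<forall>i\<in>{1..t + 1}. N i \<lhd> G) \<and>
      (\<forall>i\<in>{1..t}. N i \<subset> N (i + 1)) \<and> complete_hall_set \<sigma> (H ` {1..t}) G \<and>
      (\<forall>i\<in>{1..t}. N i <#> H i = N (i + 1))"
    using c by (intro exI[of _ t] exI[of _ N] exI[of _ H]) simp
  then show ?thesis unfolding sigma_dispersive_def sigma_group_def using c by blast
qed

end

theorem theorem1p3:
  fixes \<sigma> :: "nat set set" and G :: "('a, 'b) monoid_scheme" and n :: nat
  assumes "prime_partition \<sigma>"
    and "Group.group G" and "finite (carrier G)"
    and "sigma_soluble \<sigma> G"
    and "card (sigma_classes \<sigma> G) = n"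
    and "\<And>M. k_maximal (n + 1) M G \<Longrightarrow> sigma_subnormal \<sigma> M G"
  shows "sigma_dispersive \<sigma> G"
proof -
  interpret group G by fact
  interpret sigma_fin_group G \<sigma> by unfold_locales (use assms in auto)
  have sigma_sol: "sigma_sol (carrier G)" using sigma_soluble_sigma_sol[OF assms(4)] .
  have "deep_in_hall n (carrier G)"
  proof (rule deep_in_hallI[OF sigma_sol])
    fix Z assume "max_chain (Suc n) (carrier G) Z"
    then have "k_maximal (n + 1) Z G" using max_chain_k_maximal by fastforce
    then show "sigma_sub Z (carrier G)" using assms(6) sigma_subnormal_sigma_sub by blast
  qed
  moreover have "n = card (classes_of (card (carrier G)))" using assms(5) sigma_classes_eq by simp
  ultimately obtain t N H \<tau> where "tower (carrier G) t N H \<tau>" using tower_ex[OF sigma_sol] by blast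
  then show ?thesis by (rule tower_sigma_dispersive)
qed

end
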